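(* Let $\{d_n : n\ge 1\}$ be a sequence of non-negative integers and let $\{C_n\subset\mathbb{R}^{d_n} : n\ge 1\}$ be a collection of non-empty closed convex cones such that $\delta_{C_n}\to\infty$ as $n\to\infty$. Write $\tau_{C_n}^2=\mathrm{Var}(V_{C_n})$, let $\mathbf{g}_n\sim\mathcal{N}(0,I_{d_n})$, and write $\sigma_{C_n}^2=\mathrm{Var}(\|\Pi_{C_n}(\mathbf{g}_n)\|^2)$, $n\ge1$. Let $N\sim\mathcal{N}(0,1)$. Then the following holds. 1. One has $2\delta_{C_n}\le\sigma_{C_n}^2\le 4\delta_{C_n}$ for every $n$ and, as $n\to\infty$, the sequence $$\frac{\|\Pi_{C_n}(\mathbf{g}_n)\|^2-\delta_{C_n}}{\sigma_{C_n}},\quad n\ge1,$$ converges in distribution to $N$. 2. If, in addition, $\liminf_{n\to\infty}\tau_{C_n}^2/\delta_{C_n}>0$, then, as $n\to\infty$, the sequence $$\frac{V_{C_n}-\delta_{C_n}}{\tau_{C_n}},\quad n\ge 1,$$ also converges in distribution to $N$, and moreover one has the Berry-Esseen estimate $$\sup_{u\in\mathbb{R}}\left|P\left[\frac{V_{C_n}-\delta_{C_n}}{\tau_{C_n}}\le u\right]-P[N\le u]\right|=O\left(\frac{1}{\sqrt{\log\delta_{C_n}}}\right).$$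
   Context: A set $C\subset\mathbb{R}^d$ is a convex cone if $a\mathbf{x}+b\mathbf{y}\in C$ for all $\mathbf{x},\mathbf{y}\in C$ and all reals $a,b>0$. For a non-empty closed convex cone $C\subset\mathbb{R}^d$, $\Pi_C(\mathbf{x})$ denotes the metric projection of $\mathbf{x}$ onto $C$ (the unique point of $C$ nearest to $\mathbf{x}$ in Euclidean norm), and $C^0=\{\mathbf{y}\in\mathbb{R}^d:\langle\mathbf{y},\mathbf{x}\rangle\le0\ \forall\mathbf{x}\in C\}$ is the polar cone. The conic intrinsic volumes $v_0,\dots,v_d$ of $C$ are the uniquely determined nonnegative numbers summing to one such that, for $\mathbf{g}\sim\mathcal{N}(0,I_d)$ and every bounded measurable $f:\mathbb{R}_+^2\to\mathbb{R}$, $$E f(\|\Pi_C(\mathbf{g})\|^2,\|\Pi_{C^0}(\mathbf{g})\|^2)=\sum_{j=0}^d v_j\,E f(Y_j,Y'_{d-j}),$$ where the $Y_j,Y_j'$ are independent with chi-squared distributions with $j$ degrees of freedom ($\chi^2_0$ is the point mass at $0$). $V_C$ denotes a random variable with $P(V_C=j)=v_j$, $j=0,\dots,d$, and $\delta_C=E[V_C]=E\|\Pi_C(\mathbf{g})\|^2$ is the statistical dimension of $C$. *)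

theory Defs
  imports "HOL-Analysis.Abstract_Euclidean_Space" "HOL-Probability.Probability"
    "HOL-Library.Landau_Symbols"
begin

text \<open>The dimension varies with the index of the sequence of cones, so points of
  \<open>\<real>\<^sup>d\<close> are the points of the library's space \<^const>\<open>Euclidean_space\<close> \<open>d\<close>: functions
  \<open>x :: nat \<Rightarrow> real\<close> with \<open>x i = 0\<close> for all \<open>i \<ge> d\<close>.\<close>

definition inner_d :: "nat \<Rightarrow> (nat \<Rightarrow> real) \<Rightarrow> (nat \<Rightarrow> real) \<Rightarrow> real" where
  "inner_d d x y = (\<Sum>i<d. x i * y i)"

definition norm_d :: "nat \<Rightarrow> (nat \<Rightarrow> real) \<Rightarrow> real" where
  "norm_d d x = L2_set x {..<d}"

definition closed_convex_cone :: "nat \<Rightarrow> (nat \<Rightarrow> real) set \<Rightarrow> bool" where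
  "closed_convex_cone d C \<longleftrightarrow>
     C \<noteq> {} \<and> closedin (Euclidean_space d) C \<and>
     (\<forall>x\<in>C. \<forall>y\<in>C. \<forall>a>0. \<forall>b>0. (\<lambda>i. a * x i + b * y i) \<in> C)"

definition proj :: "nat \<Rightarrow> (nat \<Rightarrow> real) set \<Rightarrow> (nat \<Rightarrow> real) \<Rightarrow> (nat \<Rightarrow> real)" where
  "proj d C x =
     (THE y. y \<in> C \<and> (\<forall>z\<in>C. norm_d d (\<lambda>i. x i - y i) \<le> norm_d d (\<lambda>i. x i - z i)))"

definition polar_cone :: "nat \<Rightarrow> (nat \<Rightarrow> real) set \<Rightarrow> (nat \<Rightarrow> real) set" where
  "polar_cone d C = {y \<in> topspace (Euclidean_space d). \<forall>x\<in>C. inner_d d y x \<le> 0}"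

text \<open>The law of \<open>g \<sim> N(0, I\<^sub>d)\<close>: \<open>d\<close> independent standard normal coordinates,
  extended by zero.\<close>

definition std_gaussian :: "nat \<Rightarrow> (nat \<Rightarrow> real) measure" where
  "std_gaussian d =
     distr (Pi\<^sub>M {..<d} (\<lambda>_. std_normal_distribution)) borel (\<lambda>x i. if i < d then x i else 0)"

text \<open>The law of the sum of squares of \<open>j\<close> independent standard normals; for \<open>j = 0\<close> this is
  the point mass at \<open>0\<close>.\<close>

definition chi_squared :: "nat \<Rightarrow> real measure" where
  "chi_squared j =
     distr (Pi\<^sub>M {..<j} (\<lambda>_. std_normal_distribution)) borel (\<lambda>x. \<Sum>i<j. (x i)\<^sup>2)"

text \<open>\<open>V\<close> is the law of the random variable \<open>V\<^sub>C\<close>, i.e. \<open>pmf V j\<close> is the conic intrinsic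
  volume \<open>v\<^sub>j\<close> of \<open>C\<close>.  Nonnegativity of the \<open>v\<^sub>j\<close> and \<open>\<Sum>\<^sub>j v\<^sub>j = 1\<close> are part of the type
  \<open>pmf\<close>.  The test functions are bounded and measurable on the whole plane: every bounded
  measurable function on the closed quadrant has such an extension, and both sides only
  depend on the values on the quadrant.\<close>

definition intrinsic_volume_law :: "nat \<Rightarrow> (nat \<Rightarrow> real) set \<Rightarrow> nat pmf \<Rightarrow> bool" where
  "intrinsic_volume_law d C V \<longleftrightarrow>
     set_pmf V \<subseteq> {..d} \<and>
     (\<forall>f :: real \<times> real \<Rightarrow> real. f \<in> borel_measurable borel \<longrightarrow> bounded (range f) \<longrightarrow>
        (\<integral>g. f ((norm_d d (proj d C g))\<^sup>2, (norm_d d (proj d (polar_cone d C) g))\<^sup>2)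
           \<partial>std_gaussian d) =
        (\<Sum>j\<le>d. pmf V j * (\<integral>z. f z \<partial>(chi_squared j \<Otimes>\<^sub>M chi_squared (d - j)))))"

definition stat_dim :: "nat pmf \<Rightarrow> real" where
  "stat_dim V = measure_pmf.expectation V real"

definition tau2 :: "nat pmf \<Rightarrow> real" where
  "tau2 V = measure_pmf.variance V real"

definition sigma2 :: "nat \<Rightarrow> (nat \<Rightarrow> real) set \<Rightarrow> real" where
  "sigma2 d C = prob_space.variance (std_gaussian d) (\<lambda>g. (norm_d d (proj d C g))\<^sup>2)"

end

theory Submission
  imports Defs "HOL-Real_Asymp.Real_Asymp"
begin

text \<open>
  Let \<open>P\<close> be the metric projection onto the cone, \<open>F x = \<parallel>P x\<parallel>\<^sup>2\<close>, let \<open>g\<close> be a standard Gaussian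
  vector and \<open>M z = E exp (z F(g))\<close>. Both central limit theorems are statements about this one
  transform.

  The defining property of the intrinsic volumes says that \<open>F(g)\<close> has a chi-squared law with a
  random number \<open>V\<close> of degrees of freedom. Let \<open>\<zeta>(\<xi>)\<close> be the complex number with
  \<open>1 - 2 \<zeta>(\<xi>) = exp (-2 \<i> \<xi>)\<close>. A squared standard normal variable has transform \<open>exp (\<i> \<xi>)\<close> at
  \<open>\<zeta>(\<xi>)\<close> (\<open>integral_std_normal_\<zeta>\<close>), so a chi-squared variable with \<open>j\<close> degrees of freedom has
  transform \<open>exp (\<i> \<xi> j)\<close> there, and the characteristic function of \<open>V\<close> at \<open>\<xi>\<close> is \<open>M (\<zeta>(\<xi>))\<close>
  (\<open>M_\<zeta>\<close>). The first two derivatives at \<open>0\<close> give \<open>E F(g) = E V = \<delta>\<close> and \<open>Var F(g) = Var V + 2 \<delta>\<close>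
  (\<open>V_moments\<close>), which contains the lower variance bound.

  The analytic heart is the inequality
  \<open>\<bar>M' z - (\<delta> + \<sigma>\<^sup>2 z) M z\<bar> \<le> 48 \<bar>z\<bar>\<^sup>2 \<delta> exp (2 \<delta> Re z)\<close> (\<open>M_ode\<close>): up to a quadratic error \<open>M\<close>
  satisfies the differential equation of a Gaussian transform. It rests on three properties of the
  cone: \<open>F\<close> is differentiable with gradient \<open>2 P\<close>, \<open>P\<close> is nonexpansive, and \<open>\<parallel>P x\<parallel>\<^sup>2 = F x\<close>. Let \<open>y\<close>
  be an independent copy of \<open>g\<close> and \<open>g\<^sub>\<theta> = cos \<theta> g + sin \<theta> y\<close>, which moves from \<open>g\<close> to \<open>y\<close> as \<open>\<theta>\<close> goes
  from \<open>0\<close> to \<open>\<pi>/2\<close>. Differentiating \<open>E F(g\<^sub>\<theta>) exp (z F(g))\<close> in \<open>\<theta>\<close> and integrating by parts writes the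
  covariance \<open>M' z - \<delta> M z\<close> as the integral over \<open>\<theta>\<close> of \<open>4 z sin \<theta> q(\<theta>, z)\<close>, where
  \<open>q(\<theta>, z) = E \<langle>P g\<^sub>\<theta>, P g\<rangle> exp (z F(g))\<close> (\<open>covariance_interpolation\<close>). The same computation for
  the variance yields \<open>\<sigma>\<^sup>2\<close> as the integral of \<open>4 sin \<theta> q(\<theta>, 0)\<close>; as \<open>\<bar>q(\<theta>, 0)\<bar> \<le> \<delta>\<close> by
  Cauchy-Schwarz, \<open>\<sigma>\<^sup>2 \<le> 4 \<delta>\<close> (\<open>\<sigma>2_le\<close>). It remains to compare \<open>q(\<theta>, z)\<close> with \<open>q(\<theta>, 0) M z\<close>. That
  difference is again a covariance, of \<open>exp (z F(g))\<close> with \<open>Q(g)\<close>, the conditional mean of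
  \<open>\<langle>P g\<^sub>\<theta>, P g\<rangle>\<close>, and a second interpolation bounds it (\<open>q_decouple\<close>). Now \<open>Q\<close> is merely locally
  Lipschitz. Gaussian integration by parts is therefore done with difference quotients, moving a
  small shift from the function to the Gaussian density (\<open>gaussian_shift_derivative\<close>).

  Integrating this inequality along the imaginary axis gives the characteristic function of \<open>F(g)\<close>
  and, by Levy continuity, its normal limit. Integrating it along \<open>\<zeta>\<close> gives that of \<open>V\<close> with error
  \<open>58 \<xi>\<^sup>3 \<delta> exp (2 \<delta> \<xi>\<^sup>2)\<close> (\<open>char_V_bound\<close>). At \<open>\<xi> = t / \<tau>\<close>, with \<open>\<tau>\<^sup>2\<close> of order \<open>\<delta>\<close>, the error is
  of order \<open>\<delta>\<close> to the power \<open>-1/2\<close>, up to factors in \<open>t\<close> that grow like \<open>exp (c t\<^sup>2)\<close>. It stays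
  small for \<open>t\<close> up to a cutoff \<open>T\<close> of order \<open>sqrt (ln \<delta>)\<close>, and \<open>esseen_smoothing\<close> turns
  closeness of characteristic functions on \<open>[0, T]\<close> into a Kolmogorov distance of order \<open>1 / T\<close>.
\<close>

section \<open>Vectors with finitely many coordinates\<close>

text \<open>Differences, rotations and cone combinations of vectors all have this shape, so one bilinear
  expansion rule for \<open>inner_d\<close> serves all computations below.\<close>

definition lin :: "real \<Rightarrow> (nat \<Rightarrow> real) \<Rightarrow> real \<Rightarrow> (nat \<Rightarrow> real) \<Rightarrow> nat \<Rightarrow> real" where
  "lin a x b y = (\<lambda>i. a * x i + b * y i)"

lemma lin_apply [simp]: "lin a x b y i = a * x i + b * y i"
  by (simp add: lin_def)

lemma inner_d_lin_left: "inner_d d (lin a x b y) z = a * inner_d d x z + b * inner_d d y z"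
  by (simp add: inner_d_def sum.distrib sum_distrib_left algebra_simps)

lemma inner_d_commute: "inner_d d x y = inner_d d y x"
  by (simp add: inner_d_def mult.commute)

lemma inner_d_lin_right: "inner_d d z (lin a x b y) = a * inner_d d z x + b * inner_d d z y"
  using inner_d_lin_left[of d a x b y z] by (simp add: inner_d_commute)

lemma norm_d_power2: "(norm_d d x)\<^sup>2 = inner_d d x x"
  by (simp add: norm_d_def inner_d_def L2_set_def sum_nonneg power2_eq_square)

lemma norm_d_nonneg [simp]: "0 \<le> norm_d d x"
  by (simp add: norm_d_def)

lemma inner_d_nonneg [simp]: "0 \<le> inner_d d x x"
  by (simp flip: norm_d_power2)

lemma abs_inner_d_le: "\<bar>inner_d d x y\<bar> \<le> norm_d d x * norm_d d y"
proof -
  have "\<bar>inner_d d x y\<bar> \<le> (\<Sum>i<d. \<bar>x i\<bar> * \<bar>y i\<bar>)"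
    unfolding inner_d_def by (rule order_trans[OF sum_abs]) (simp add: abs_mult)
  also have "\<dots> \<le> norm_d d x * norm_d d y"
    unfolding norm_d_def by (rule L2_set_mult_ineq)
  finally show ?thesis .
qed

lemma inner_d_le: "inner_d d x y \<le> norm_d d x * norm_d d y"
  using abs_inner_d_le[of d x y] by linarith

lemma norm_d_lin_le: "norm_d d (lin a x b y) \<le> \<bar>a\<bar> * norm_d d x + \<bar>b\<bar> * norm_d d y"
proof (rule power2_le_imp_le)
  have "a * b * inner_d d x y \<le> \<bar>a\<bar> * \<bar>b\<bar> * (norm_d d x * norm_d d y)"
    by (rule order_trans[OF abs_ge_self]) (simp add: abs_mult mult_left_mono abs_inner_d_le)
  then show "(norm_d d (lin a x b y))\<^sup>2 \<le> (\<bar>a\<bar> * norm_d d x + \<bar>b\<bar> * norm_d d y)\<^sup>2"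
    unfolding norm_d_power2 power2_sum power_mult_distrib
    by (simp add: inner_d_lin_left inner_d_lin_right inner_d_commute[of d y x] algebra_simps power2_eq_square)
qed auto

text \<open>The pair \<open>(a, b)\<close> is the first row of an orthogonal matrix; the second row contributes the
  nonnegative term that is dropped.\<close>

lemma norm_d_rotation:
  assumes "a\<^sup>2 + b\<^sup>2 = 1"
  shows "(norm_d d (lin a x b y))\<^sup>2 \<le> (norm_d d x)\<^sup>2 + (norm_d d y)\<^sup>2"
proof -
  have "(norm_d d (lin a x b y))\<^sup>2 + (norm_d d (lin b x (-a) y))\<^sup>2
      = (a\<^sup>2 + b\<^sup>2) * ((norm_d d x)\<^sup>2 + (norm_d d y)\<^sup>2)"
    unfolding norm_d_power2
    by (simp add: inner_d_lin_left inner_d_lin_right inner_d_commute[of d y x]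
        algebra_simps power2_eq_square)
  then have "(norm_d d (lin a x b y))\<^sup>2 + (norm_d d (lin b x (-a) y))\<^sup>2
      = (norm_d d x)\<^sup>2 + (norm_d d y)\<^sup>2"
    unfolding assms by simp
  moreover have "0 \<le> (norm_d d (lin b x (-a) y))\<^sup>2" by simp
  ultimately show ?thesis by linarith
qed

lemma norm_d_eq_0D: "norm_d d x = 0 \<Longrightarrow> i < d \<Longrightarrow> x i = 0"
  by (simp add: norm_d_def L2_set_eq_0_iff)

lemma abs_component_le_norm_d: "i < d \<Longrightarrow> \<bar>x i\<bar> \<le> norm_d d x"
  using member_le_L2_set[of "{..<d}" i "\<lambda>i. \<bar>x i\<bar>"] by (simp add: norm_d_def L2_set_def)

lemma continuous_on_norm_d [continuous_intros]:
  assumes "\<And>i. i < d \<Longrightarrow> continuous_on S (\<lambda>x. f x i)"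
  shows "continuous_on S (\<lambda>x. norm_d d (f x))"
  unfolding norm_d_def L2_set_def using assms by (intro continuous_intros) auto

lemma le_if_power2_le_mult: "a\<^sup>2 \<le> b * a \<Longrightarrow> 0 \<le> a \<Longrightarrow> 0 \<le> b \<Longrightarrow> a \<le> (b::real)"
  by (cases "a = 0") (simp_all add: power2_eq_square)

section \<open>Metric projection onto a closed convex cone\<close>

locale convex_cone =
  fixes d :: nat and C :: "(nat \<Rightarrow> real) set"
  assumes cone: "closed_convex_cone d C"
begin

lemma lin_mem: "x \<in> C \<Longrightarrow> y \<in> C \<Longrightarrow> 0 < a \<Longrightarrow> 0 < b \<Longrightarrow> lin a x b y \<in> C"
  using cone by (auto simp: closed_convex_cone_def lin_def)

lemma nonempty: "C \<noteq> {}" and closed_C: "closed C"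
  using cone by (auto simp: closed_convex_cone_def closedin_Euclidean_space_iff)

lemma vanishes_beyond: "x \<in> C \<Longrightarrow> d \<le> i \<Longrightarrow> x i = 0"
  using cone by (auto simp: closed_convex_cone_def closedin_Euclidean_space_iff topspace_Euclidean_space)

text \<open>A minimizing sequence is Cauchy: midpoints stay in the cone, so by the parallelogram identity
  two almost minimal points are close to each other. The limit is in the cone because it is closed
  in the product topology, where convergence is coordinatewise.\<close>

lemma nearest_point_ex:
  "\<exists>y\<in>C. \<forall>z\<in>C. norm_d d (lin 1 x (-1) y) \<le> norm_d d (lin 1 x (-1) z)"
proof -
  define D where "D y = norm_d d (lin 1 x (-1) y)" for y
  define m where "m = Inf (D ` C)"
  have bdd: "bdd_below (D ` C)" by (rule bdd_belowI[of _ 0]) (auto simp: D_def)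
  have m_le: "m \<le> D y" if "y \<in> C" for y
    unfolding m_def using bdd that by (intro cInf_lower) auto
  have m0: "0 \<le> m" unfolding m_def using nonempty by (intro cInf_greatest) (auto simp: D_def)
  have "\<exists>y\<in>C. D y < m + 1 / Suc n" for n
  proof -
    have "\<exists>r\<in>D ` C. r < m + 1 / Suc n"
      by (rule cInf_lessD) (use nonempty in \<open>auto simp: m_def\<close>)
    then show ?thesis by auto
  qed
  then obtain Y where Y: "\<And>n. Y n \<in> C" "\<And>n. D (Y n) < m + 1 / Suc n" by metis
  have close: "(norm_d d (lin 1 (Y k) (-1) (Y l)))\<^sup>2 \<le> 2 * ((m + 1 / Suc k)\<^sup>2 - m\<^sup>2) + 2 * ((m + 1 / Suc l)\<^sup>2 - m\<^sup>2)" for k l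
  proof -
    have "m \<le> D (lin (1/2) (Y k) (1/2) (Y l))"
      by (intro m_le lin_mem Y) auto
    then have "m\<^sup>2 \<le> (D (lin (1/2) (Y k) (1/2) (Y l)))\<^sup>2" using m0 by (intro power_mono) auto
    moreover have "(norm_d d (lin 1 (Y k) (-1) (Y l)))\<^sup>2 + 4 * (D (lin (1/2) (Y k) (1/2) (Y l)))\<^sup>2
        = 2 * (D (Y k))\<^sup>2 + 2 * (D (Y l))\<^sup>2"
      unfolding D_def norm_d_power2
      by (simp add: inner_d_lin_left inner_d_lin_right inner_d_commute[of d "Y l" x] inner_d_commute[of d "Y k" x] inner_d_commute[of d "Y l" "Y k"]
        algebra_simps power2_eq_square)
    moreover have "(D (Y k))\<^sup>2 \<le> (m + 1 / Suc k)\<^sup>2" "(D (Y l))\<^sup>2 \<le> (m + 1 / Suc l)\<^sup>2"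
      using Y(2)[THEN less_imp_le] by (auto intro!: power_mono simp: D_def simp del: of_nat_Suc)
    ultimately show ?thesis by argo
  qed
  have lim0: "(\<lambda>n. (m + 1 / Suc n)\<^sup>2 - m\<^sup>2) \<longlonglongrightarrow> 0"
  proof -
    have "(\<lambda>n. (m + 1 / Suc n)\<^sup>2 - m\<^sup>2) \<longlonglongrightarrow> (m + 0)\<^sup>2 - m\<^sup>2"
      by (intro tendsto_intros LIMSEQ_Suc lim_1_over_n)
    then show ?thesis by simp
  qed
  have conv: "convergent (\<lambda>n. Y n i)" for i
  proof (cases "i < d")
    case True
    have "Cauchy (\<lambda>n. Y n i)"
    proof (rule metric_CauchyI)
      fix e :: real assume e: "0 < e"
      then have "eventually (\<lambda>n. (m + 1 / Suc n)\<^sup>2 - m\<^sup>2 < e\<^sup>2 / 4) sequentially"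
        using order_tendstoD(2)[OF lim0, of "e\<^sup>2 / 4"] by simp
      then obtain M where M: "\<And>n. n \<ge> M \<Longrightarrow> (m + 1 / Suc n)\<^sup>2 - m\<^sup>2 < e\<^sup>2 / 4"
        by (auto simp: eventually_sequentially)
      show "\<exists>M. \<forall>k\<ge>M. \<forall>l\<ge>M. dist (Y k i) (Y l i) < e"
      proof (intro exI allI impI)
        fix k l assume "M \<le> k" "M \<le> l"
        then have "(norm_d d (lin 1 (Y k) (-1) (Y l)))\<^sup>2 < e\<^sup>2"
        proof -
          have "(norm_d d (lin 1 (Y k) (-1) (Y l)))\<^sup>2 < 2 * (e\<^sup>2 / 4) + 2 * (e\<^sup>2 / 4)"
            using \<open>M \<le> k\<close> \<open>M \<le> l\<close>
            by (intro order.strict_trans1[OF close] add_strict_mono mult_strict_left_mono M) auto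
          then show ?thesis by simp
        qed
        then have "norm_d d (lin 1 (Y k) (-1) (Y l)) < e"
          using e by (simp add: power_less_imp_less_base)
        then show "dist (Y k i) (Y l i) < e"
          using abs_component_le_norm_d[OF True, of "lin 1 (Y k) (-1) (Y l)"]
          by (simp add: dist_real_def)
      qed
    qed
    then show ?thesis by (simp add: real_Cauchy_convergent)
  next
    case False
    then show ?thesis using vanishes_beyond[OF Y(1)] by (simp add: convergent_const)
  qed
  define L where "L i = lim (\<lambda>n. Y n i)" for i
  have lim: "(\<lambda>n. Y n i) \<longlonglongrightarrow> L i" for i
    using conv[of i] by (simp add: L_def convergent_LIMSEQ_iff)
  have "Y \<longlonglongrightarrow> L"
    unfolding limitin_canonical_iff[symmetric] euclidean_product_topology[symmetric]
    using lim by (simp add: limitin_componentwise)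
  then have L: "L \<in> C"
    using closed_C Y(1) closed_sequentially by blast
  have "(\<lambda>n. D (Y n)) \<longlonglongrightarrow> D L"
    unfolding D_def norm_d_def L2_set_def by (auto intro!: tendsto_intros lim)
  moreover have "(\<lambda>n. m + 1 / Suc n) \<longlonglongrightarrow> m + 0"
    by (intro tendsto_intros LIMSEQ_Suc lim_1_over_n)
  ultimately have "D L \<le> m + 0"
    by (rule LIMSEQ_le) (use Y(2) in \<open>auto intro: less_imp_le\<close>)
  then have "D L \<le> D z" if "z \<in> C" for z using m_le[OF that] by simp
  with L show ?thesis unfolding D_def by blast
qed

text \<open>Moving from the nearest point \<open>y\<close> to \<open>y + t c\<close> stays in the cone and would reduce the distance
  to first order in \<open>t\<close> if \<open>x - y\<close> had a positive inner product with \<open>c\<close>.\<close>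

lemma nearest_point_polar:
  assumes y: "y \<in> C" and min: "\<And>z. z \<in> C \<Longrightarrow> norm_d d (lin 1 x (-1) y) \<le> norm_d d (lin 1 x (-1) z)"
    and c: "c \<in> C"
  shows "inner_d d x c \<le> inner_d d y c"
proof (rule ccontr)
  assume "\<not> ?thesis"
  then have pos: "0 < inner_d d x c - inner_d d y c" (is "0 < ?q") by simp
  \<comment> \<open>The denominator keeps the quadratic term of the squared distance below the linear gain.\<close>
  define t where "t = ?q / (inner_d d c c + 1)"
  have t: "0 < t" and tc: "t * inner_d d c c < ?q"
  proof -
    have q: "0 < inner_d d c c + 1" by (simp add: add_nonneg_pos)
    then show "0 < t" using pos by (simp add: t_def)
    then have "t * inner_d d c c < t * (inner_d d c c + 1)" by simp
    also have "\<dots> = ?q" using q unfolding t_def by simp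
    finally show "t * inner_d d c c < ?q" .
  qed
  have "(norm_d d (lin 1 x (-1) y))\<^sup>2 \<le> (norm_d d (lin 1 x (-1) (lin 1 y t c)))\<^sup>2"
    using t by (intro power_mono min lin_mem y c) auto
  then have "2 * t * ?q \<le> t * (t * inner_d d c c)"
    unfolding norm_d_power2
    by (simp add: inner_d_lin_left inner_d_lin_right inner_d_commute[of d c x] inner_d_commute[of d y x] inner_d_commute[of d c y]
        algebra_simps power2_eq_square)
  then have "2 * ?q \<le> t * inner_d d c c" using t by (simp add: mult.assoc mult.left_commute)
  from order.strict_trans1[OF this tc] pos show False by simp
qed

text \<open>Along the ray of the nearest point the distance can be varied in both directions, so its
  derivative vanishes.\<close>

lemma nearest_point_orthogonal:
  assumes y: "y \<in> C" and min: "\<And>z. z \<in> C \<Longrightarrow> norm_d d (lin 1 x (-1) y) \<le> norm_d d (lin 1 x (-1) z)"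
  shows "inner_d d x y = inner_d d y y"
proof (rule antisym)
  show "inner_d d x y \<le> inner_d d y y" by (rule nearest_point_polar[OF y min y])
  show "inner_d d y y \<le> inner_d d x y"
  proof (rule ccontr)
    assume "\<not> ?thesis"
    then have pos: "0 < inner_d d y y - inner_d d x y" (is "0 < ?q") by simp
    define t where "t = min (1/2) (?q / (inner_d d y y + 1))"
    have t: "0 < t" "t < 1" and tc: "t * inner_d d y y < ?q"
    proof -
      show "0 < t" "t < 1" using pos by (auto simp: t_def add_nonneg_pos)
      have q: "0 < inner_d d y y + 1" by (simp add: add_nonneg_pos)
      have "t * inner_d d y y < t * (inner_d d y y + 1)" using \<open>0 < t\<close> by simp
      also have "\<dots> \<le> ?q / (inner_d d y y + 1) * (inner_d d y y + 1)"
        using q by (intro mult_right_mono) (auto simp: t_def)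
      also have "\<dots> = ?q" using q by simp
      finally show "t * inner_d d y y < ?q" .
    qed
    \<comment> \<open>The competitor is \<open>(1 - t) y\<close>, written as a combination with two positive coefficients.\<close>
    have "(norm_d d (lin 1 x (-1) y))\<^sup>2 \<le> (norm_d d (lin 1 x (-1) (lin ((1-t)/2) y ((1-t)/2) y)))\<^sup>2"
      using t by (intro power_mono min lin_mem y) auto
    then have "2 * t * ?q \<le> t * (t * inner_d d y y)"
      unfolding norm_d_power2
      by (simp add: inner_d_lin_left inner_d_lin_right inner_d_commute[of d y x]
          algebra_simps power2_eq_square)
    then have "2 * ?q \<le> t * inner_d d y y" using t by (simp add: mult.assoc mult.left_commute)
    from order.strict_trans1[OF this tc] pos show False by simp
  qed
qed

definition P :: "(nat \<Rightarrow> real) \<Rightarrow> nat \<Rightarrow> real" where "P = proj d C"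

lemma P_nearest: "P x \<in> C \<and> (\<forall>z\<in>C. norm_d d (lin 1 x (-1) (P x)) \<le> norm_d d (lin 1 x (-1) z))"
proof -
  let ?near = "\<lambda>y. y \<in> C \<and> (\<forall>z\<in>C. norm_d d (lin 1 x (-1) y) \<le> norm_d d (lin 1 x (-1) z))"
  have "\<exists>!y. ?near y"
  proof (rule ex_ex1I)
    show "\<exists>y. ?near y" using nearest_point_ex by blast
    fix y y' assume "?near y" "?near y'"
    then have y: "y \<in> C" and my: "\<And>z. z \<in> C \<Longrightarrow> norm_d d (lin 1 x (-1) y) \<le> norm_d d (lin 1 x (-1) z)"
      and y': "y' \<in> C" and my': "\<And>z. z \<in> C \<Longrightarrow> norm_d d (lin 1 x (-1) y') \<le> norm_d d (lin 1 x (-1) z)"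
      by auto
    have "(norm_d d (lin 1 y (-1) y'))\<^sup>2 \<le> 0"
      unfolding norm_d_power2
      using nearest_point_polar[OF y my y'] nearest_point_polar[OF y' my' y]
        nearest_point_orthogonal[OF y my] nearest_point_orthogonal[OF y' my']
      by (simp add: inner_d_lin_left inner_d_lin_right inner_d_commute[of d y' y])
    then have "norm_d d (lin 1 y (-1) y') = 0" by simp
    then have "y i = y' i" for i
      using norm_d_eq_0D[of d "lin 1 y (-1) y'" i] vanishes_beyond[OF y, of i] vanishes_beyond[OF y', of i]
      by (cases "i < d") auto
    then show "y = y'" by auto
  qed
  from theI'[OF this] show ?thesis
    by (simp add: P_def proj_def lin_def)
qed

lemma P_mem: "P x \<in> C"
  using P_nearest by blast

lemma P_beyond: "d \<le> i \<Longrightarrow> P x i = 0"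
  using P_mem vanishes_beyond by blast

lemma P_polar: "c \<in> C \<Longrightarrow> inner_d d x c \<le> inner_d d (P x) c"
  using nearest_point_polar P_nearest by blast

lemma P_orthogonal: "inner_d d x (P x) = (norm_d d (P x))\<^sup>2"
  unfolding norm_d_power2 using nearest_point_orthogonal P_nearest by blast

text \<open>The polarity and orthogonality relations of both projections add up to
  \<open>\<parallel>P x - P y\<parallel>\<^sup>2 \<le> \<langle>x - y, P x - P y\<rangle>\<close>; Cauchy-Schwarz does the rest.\<close>

lemma P_nonexpansive: "norm_d d (lin 1 (P x) (-1) (P y)) \<le> norm_d d (lin 1 x (-1) y)"
proof -
  let ?D = "lin 1 (P x) (-1) (P y)"
  have "(norm_d d ?D)\<^sup>2 \<le> inner_d d (lin 1 x (-1) y) ?D"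
    using P_polar[OF P_mem, of x y] P_polar[OF P_mem, of y x] P_orthogonal[of x] P_orthogonal[of y]
    unfolding norm_d_power2
    by (simp add: inner_d_lin_left inner_d_lin_right inner_d_commute[of d "P y" "P x"])
  also have "\<dots> \<le> norm_d d (lin 1 x (-1) y) * norm_d d ?D"
    by (rule inner_d_le)
  finally show ?thesis
    by (rule le_if_power2_le_mult) auto
qed

lemma P_norm_le: "norm_d d (P x) \<le> norm_d d x"
  by (rule le_if_power2_le_mult) (use inner_d_le[of d x "P x"] P_orthogonal[of x] in auto)

definition F :: "(nat \<Rightarrow> real) \<Rightarrow> real" where "F x = (norm_d d (P x))\<^sup>2"

lemma F_nonneg [simp]: "0 \<le> F x"
  by (simp add: F_def)

lemma F_le: "F x \<le> (norm_d d x)\<^sup>2"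
  unfolding F_def by (intro power_mono P_norm_le) auto

text \<open>Since \<open>F x = \<parallel>x\<parallel>\<^sup>2 - \<parallel>x - P x\<parallel>\<^sup>2\<close>, comparing the distance of \<open>y\<close> to the cone with its distance to
  \<open>P x\<close> shows that \<open>2 P x\<close> is a subgradient of \<open>F\<close>.\<close>

lemma F_above_tangent: "F x + 2 * inner_d d (P x) (lin 1 y (-1) x) \<le> F y"
proof -
  have "(norm_d d (lin 1 y (-1) (P y)))\<^sup>2 \<le> (norm_d d (lin 1 y (-1) (P x)))\<^sup>2"
    using P_nearest[of y] P_mem[of x] by (intro power_mono) auto
  then show ?thesis
    using P_orthogonal[of x] P_orthogonal[of y] unfolding F_def norm_d_power2
    by (simp add: inner_d_lin_left inner_d_lin_right inner_d_commute[of d "P x" x] inner_d_commute[of d "P x" y] inner_d_commute[of d "P y" y])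
qed

text \<open>The subgradient at \<open>y\<close> differs from the one at \<open>x\<close> by at most \<open>2 \<parallel>y - x\<parallel>\<close>. Together the two
  tangent inequalities say that \<open>F\<close> is continuously differentiable with gradient \<open>2 P\<close>.\<close>

lemma F_below_tangent: "F y \<le> F x + 2 * inner_d d (P x) (lin 1 y (-1) x) + 2 * (norm_d d (lin 1 y (-1) x))\<^sup>2"
proof -
  let ?D = "lin 1 y (-1) x"
  have "F y + 2 * inner_d d (P y) (lin 1 x (-1) y) \<le> F x" by (rule F_above_tangent)
  then have "F y \<le> F x + 2 * inner_d d (P x) ?D + 2 * inner_d d (lin 1 (P y) (-1) (P x)) ?D"
    by (simp add: inner_d_lin_left inner_d_lin_right)
  moreover have "inner_d d (lin 1 (P y) (-1) (P x)) ?D \<le> norm_d d ?D * norm_d d ?D"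
    by (rule order_trans[OF inner_d_le] mult_right_mono P_nonexpansive norm_d_nonneg)+
  ultimately show ?thesis by (simp add: power2_eq_square)
qed

lemma continuous_P: "continuous_on UNIV P"
proof (rule continuous_on_coordinatewise_then_product)
  fix i
  show "continuous_on UNIV (\<lambda>x. P x i)"
  proof (cases "i < d")
    case False
    then show ?thesis by (simp add: P_beyond)
  next
    case True
    have "(\<lambda>y. P y i) \<midarrow>x\<rightarrow> P x i" for x
    proof (rule LIM_zero_cancel, rule Lim_null_comparison)
      have "continuous_on UNIV (\<lambda>y. norm_d d (lin 1 y (-1) x))"
        by (intro continuous_intros) (auto intro!: continuous_intros)
      then have "isCont (\<lambda>y. norm_d d (lin 1 y (-1) x)) x"
        by (simp add: continuous_on_eq_continuous_at)
      then show "(\<lambda>y. norm_d d (lin 1 y (-1) x)) \<midarrow>x\<rightarrow> 0"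
        by (simp add: isCont_def norm_d_def L2_set_def)
      show "\<forall>\<^sub>F y in at x. norm (P y i - P x i) \<le> norm_d d (lin 1 y (-1) x)"
      proof (rule always_eventually, rule allI)
        fix y show "norm (P y i - P x i) \<le> norm_d d (lin 1 y (-1) x)"
          using order_trans[OF abs_component_le_norm_d[OF True, of "lin 1 (P y) (-1) (P x)"] P_nonexpansive]
          by simp
      qed
    qed
    then show ?thesis by (simp add: continuous_on_eq_continuous_at isCont_def)
  qed
qed

lemma borel_measurable_P [measurable]: "P \<in> borel_measurable borel"
  by (rule borel_measurable_continuous_onI[OF continuous_P])

end

section \<open>The standard Gaussian measure and its rotations\<close>

lemma borel_measurable_lin [measurable (raw)]:
  assumes "f \<in> borel_measurable M" "g \<in> borel_measurable M"
    "h \<in> borel_measurable M" "k \<in> borel_measurable M"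
  shows "(\<lambda>w. lin (h w) (f w) (k w) (g w)) \<in> borel_measurable M"
  unfolding lin_def
  by (rule measurable_coordinatewise_then_product)
    (intro borel_measurable_add borel_measurable_times assms(3,4)
      assms(1,2)[THEN measurable_product_then_coordinatewise])

lemma borel_measurable_fun_upd [measurable (raw)]:
  assumes "f \<in> borel_measurable M" "g \<in> borel_measurable M"
  shows "(\<lambda>w. (f w)(i := g w) :: nat \<Rightarrow> real) \<in> borel_measurable M"
proof (rule measurable_coordinatewise_then_product)
  fix j show "(\<lambda>w. ((f w)(i := g w)) j) \<in> borel_measurable M"
    using assms measurable_product_then_coordinatewise[OF assms(1), of j] by (cases "j = i") auto
qed

lemma borel_measurable_inner_d [measurable (raw)]:
  assumes "f \<in> borel_measurable M" "g \<in> borel_measurable M"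
  shows "(\<lambda>w. inner_d d (f w) (g w)) \<in> borel_measurable M"
  unfolding inner_d_def
  by (intro borel_measurable_sum borel_measurable_times assms[THEN measurable_product_then_coordinatewise])

lemma borel_measurable_norm_d [measurable (raw)]:
  assumes "f \<in> borel_measurable M"
  shows "(\<lambda>w. norm_d d (f w)) \<in> borel_measurable M"
proof -
  have "(\<lambda>w. sqrt (inner_d d (f w) (f w))) \<in> borel_measurable M" using assms by measurable
  then show ?thesis by (simp flip: norm_d_power2)
qed

interpretation std_normal: real_distribution std_normal_distribution
  by (rule real_dist_normal_dist)

lemma measurable_extend_by_zero:
  fixes d :: nat
  shows "(\<lambda>x i. if i < d then x i else (0::real)) \<in> measurable (Pi\<^sub>M {..<d} (\<lambda>_. std_normal_distribution)) borel"
proof (rule measurable_coordinatewise_then_product)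
  fix i
  show "(\<lambda>x. if i < d then x i else 0) \<in> borel_measurable (Pi\<^sub>M {..<d} (\<lambda>_. std_normal_distribution))"
  proof (cases "i < d")
    case True
    then have "(\<lambda>x. x i) \<in> measurable (Pi\<^sub>M {..<d} (\<lambda>_. std_normal_distribution)) std_normal_distribution"
      by (intro measurable_component_singleton) auto
    with True show ?thesis by simp
  qed simp
qed

lemma sets_std_gaussian [simp, measurable_cong]: "sets (std_gaussian d) = sets borel"
  by (simp add: std_gaussian_def)

lemma space_std_gaussian [simp]: "space (std_gaussian d) = UNIV"
  by (simp add: std_gaussian_def)

lemma prob_space_std_gaussian: "prob_space (std_gaussian d)"
  unfolding std_gaussian_def
  by (intro prob_space.prob_space_distr measurable_extend_by_zero prob_space_PiM)
    (rule std_normal.prob_space_axioms)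

interpretation gauss: prob_space "std_gaussian d"
  by (rule prob_space_std_gaussian)

interpretation gauss2: pair_prob_space "std_gaussian d" "std_gaussian d'" ..

lemma nn_integral_std_gaussian_0:
  assumes [measurable]: "f \<in> borel_measurable borel"
  shows "(\<integral>\<^sup>+x. f x \<partial>std_gaussian 0) = f (\<lambda>_. 0)"
proof -
  interpret product_sigma_finite "\<lambda>_::nat. std_normal_distribution" ..
  show ?thesis
    unfolding std_gaussian_def
    by (subst nn_integral_distr[OF measurable_extend_by_zero])
      (simp_all add: PiM_empty nn_integral_count_space_finite)
qed

text \<open>Adding one coordinate at a time reduces rotation and shift formulas to real normal variables.\<close>

lemma nn_integral_std_gaussian_Suc:
  assumes [measurable]: "f \<in> borel_measurable borel"
  shows "(\<integral>\<^sup>+x. f x \<partial>std_gaussian (Suc d))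
       = (\<integral>\<^sup>+x. (\<integral>\<^sup>+t. f (x(d := t)) \<partial>std_normal_distribution) \<partial>std_gaussian d)"
proof -
  interpret product_sigma_finite "\<lambda>_::nat. std_normal_distribution" ..
  let ?N = "std_normal_distribution"
  let ?e = "\<lambda>d (x::nat \<Rightarrow> real) i. if i < d then x i else 0"
  note [measurable] = measurable_extend_by_zero
  have upd: "?e (Suc d) (x(d := t)) = (?e d x)(d := t)" for x t by auto
  have "(\<integral>\<^sup>+x. f x \<partial>std_gaussian (Suc d))
      = (\<integral>\<^sup>+x. f (?e (Suc d) x) \<partial>Pi\<^sub>M (insert d {..<d}) (\<lambda>_. ?N))"
    unfolding std_gaussian_def by (subst nn_integral_distr) (simp_all flip: lessThan_Suc)
  also have "\<dots> = (\<integral>\<^sup>+x. (\<integral>\<^sup>+t. f (?e (Suc d) (x(d := t))) \<partial>?N) \<partial>Pi\<^sub>M {..<d} (\<lambda>_. ?N))"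
    by (rule product_nn_integral_insert) (auto simp flip: lessThan_Suc)
  also have "\<dots> = (\<integral>\<^sup>+x. (\<integral>\<^sup>+t. f (x(d := t)) \<partial>?N) \<partial>std_gaussian d)"
    unfolding upd std_gaussian_def by (subst nn_integral_distr) auto
  finally show ?thesis .
qed

text \<open>Only one-dimensional affine substitutions are used: one in \<open>x\<close> for fixed \<open>y\<close>, then one in \<open>y\<close>
  for fixed \<open>x\<close>. Their factors \<open>1 / \<bar>c\<bar>\<close> and \<open>\<bar>c\<bar>\<close> cancel, and the joint density depends on
  \<open>x\<^sup>2 + y\<^sup>2\<close> alone.\<close>

lemma nn_integral_std_normal_rotation:
  fixes f :: "real \<Rightarrow> real \<Rightarrow> ennreal"
  assumes [measurable]: "case_prod f \<in> borel_measurable (borel \<Otimes>\<^sub>M borel)"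
    and cs: "c\<^sup>2 + s\<^sup>2 = 1" and c: "c \<noteq> 0"
  shows "(\<integral>\<^sup>+x. \<integral>\<^sup>+y. f (c * x - s * y) (s * x + c * y) \<partial>std_normal_distribution \<partial>std_normal_distribution)
       = (\<integral>\<^sup>+x. \<integral>\<^sup>+y. f x y \<partial>std_normal_distribution \<partial>std_normal_distribution)"
proof -
  let ?\<phi> = "\<lambda>x y. ennreal (exp (- (x\<^sup>2 + y\<^sup>2) / 2) / (2 * pi))"
  have dens: "ennreal (std_normal_density x) * ennreal (std_normal_density y) = ?\<phi> x y" for x y
  proof -
    have "std_normal_density x * std_normal_density y = exp (- (x\<^sup>2 + y\<^sup>2) / 2) / (2 * pi)"
      by (simp add: std_normal_density_def field_simps flip: exp_add)
    then show ?thesis by (simp flip: ennreal_mult)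
  qed
  have to_lborel: "(\<integral>\<^sup>+x. \<integral>\<^sup>+y. g x y \<partial>std_normal_distribution \<partial>std_normal_distribution)
      = (\<integral>\<^sup>+x. \<integral>\<^sup>+y. ?\<phi> x y * g x y \<partial>lborel \<partial>lborel)"
    if [measurable]: "case_prod g \<in> borel_measurable (borel \<Otimes>\<^sub>M borel)" for g
  proof -
    have "(\<integral>\<^sup>+x. \<integral>\<^sup>+y. g x y \<partial>std_normal_distribution \<partial>std_normal_distribution)
      = (\<integral>\<^sup>+x. ennreal (std_normal_density x) * (\<integral>\<^sup>+y. ennreal (std_normal_density y) * g x y \<partial>lborel) \<partial>lborel)"
      by (simp add: nn_integral_density)
    also have "\<dots> = (\<integral>\<^sup>+x. \<integral>\<^sup>+y. ?\<phi> x y * g x y \<partial>lborel \<partial>lborel)"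
      unfolding dens[symmetric] mult.assoc
      by (intro nn_integral_cong nn_integral_cmult[symmetric]) measurable
    finally show ?thesis .
  qed
  have "(\<integral>\<^sup>+x. \<integral>\<^sup>+y. f (c * x - s * y) (s * x + c * y) \<partial>std_normal_distribution \<partial>std_normal_distribution)
      = (\<integral>\<^sup>+x. \<integral>\<^sup>+y. ?\<phi> x y * f (c * x - s * y) (s * x + c * y) \<partial>lborel \<partial>lborel)"
    by (rule to_lborel) measurable
  also have "\<dots> = (\<integral>\<^sup>+y. \<integral>\<^sup>+x. ?\<phi> x y * f (c * x - s * y) (s * x + c * y) \<partial>lborel \<partial>lborel)"
    by (rule lborel_pair.Fubini') measurable
  also have "\<dots> = (\<integral>\<^sup>+y. ennreal (1 / \<bar>c\<bar>) * (\<integral>\<^sup>+x. ?\<phi> (s / c * y + 1 / c * x) y * f x ((s * x + y) / c) \<partial>lborel) \<partial>lborel)"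
  proof (rule nn_integral_cong)
    fix y :: real
    have *: "c * (s / c * y + 1 / c * x) - s * y = x"
      "s * (s / c * y + 1 / c * x) + c * y = (s * x + y) / c" for x
    proof -
      show "c * (s / c * y + 1 / c * x) - s * y = x" using c by (simp add: field_simps)
      have "s * (s / c * y + 1 / c * x) + c * y = (s * x + (c\<^sup>2 + s\<^sup>2) * y) / c"
        using c by (simp add: field_simps power2_eq_square)
      then show "s * (s / c * y + 1 / c * x) + c * y = (s * x + y) / c" by (simp add: cs)
    qed
    have "(\<integral>\<^sup>+x. ?\<phi> x y * f (c * x - s * y) (s * x + c * y) \<partial>lborel)
       = ennreal \<bar>1 / c\<bar> * (\<integral>\<^sup>+x. ?\<phi> (s / c * y + 1 / c * x) y *
           f (c * (s / c * y + 1 / c * x) - s * y) (s * (s / c * y + 1 / c * x) + c * y) \<partial>lborel)"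
      by (rule nn_integral_real_affine) (measurable, use c in simp)
    then show "(\<integral>\<^sup>+x. ?\<phi> x y * f (c * x - s * y) (s * x + c * y) \<partial>lborel)
       = ennreal (1 / \<bar>c\<bar>) * (\<integral>\<^sup>+x. ?\<phi> (s / c * y + 1 / c * x) y * f x ((s * x + y) / c) \<partial>lborel)"
      unfolding * by (simp only: abs_divide abs_one)
  qed
  also have "\<dots> = (\<integral>\<^sup>+y. \<integral>\<^sup>+x. ennreal (1 / \<bar>c\<bar>) * (?\<phi> (s / c * y + 1 / c * x) y * f x ((s * x + y) / c)) \<partial>lborel \<partial>lborel)"
    by (intro nn_integral_cong nn_integral_cmult[symmetric]) measurable
  also have "\<dots> = (\<integral>\<^sup>+x. \<integral>\<^sup>+y. ennreal (1 / \<bar>c\<bar>) * (?\<phi> (s / c * y + 1 / c * x) y * f x ((s * x + y) / c)) \<partial>lborel \<partial>lborel)"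
    by (rule lborel_pair.Fubini'[symmetric]) measurable
  also have "\<dots> = (\<integral>\<^sup>+x. \<integral>\<^sup>+y. ?\<phi> x y * f x y \<partial>lborel \<partial>lborel)"
  proof (rule nn_integral_cong)
    fix x :: real
    have 1: "(s * x + (- s * x + c * y)) / c = y" for y using c by simp
    have 2: "(s / c * (- s * x + c * y) + 1 / c * x)\<^sup>2 + (- s * x + c * y)\<^sup>2 = x\<^sup>2 + y\<^sup>2" for y
    proof -
      have "s / c * (- s * x + c * y) + 1 / c * x = ((c\<^sup>2 + s\<^sup>2) * x - s\<^sup>2 * x) / c + s * y"
        using c by (simp add: cs) (simp add: field_simps power2_eq_square)
      also have "\<dots> = c * x + s * y" using c by (simp add: algebra_simps power2_eq_square)
      finally have "s / c * (- s * x + c * y) + 1 / c * x = c * x + s * y" .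
      then have "(s / c * (- s * x + c * y) + 1 / c * x)\<^sup>2 + (- s * x + c * y)\<^sup>2
          = (c\<^sup>2 + s\<^sup>2) * (x\<^sup>2 + y\<^sup>2)"
        by (simp add: algebra_simps power2_eq_square)
      then show ?thesis by (simp add: cs)
    qed
    have "(\<integral>\<^sup>+y. ennreal (1 / \<bar>c\<bar>) * (?\<phi> (s / c * y + 1 / c * x) y * f x ((s * x + y) / c)) \<partial>lborel)
        = ennreal \<bar>c\<bar> * (\<integral>\<^sup>+y. ennreal (1 / \<bar>c\<bar>) *
            (?\<phi> (s / c * (- s * x + c * y) + 1 / c * x) (- s * x + c * y) *
              f x ((s * x + (- s * x + c * y)) / c)) \<partial>lborel)"
      by (rule nn_integral_real_affine) (measurable, use c in simp)
    also have "\<dots> = ennreal \<bar>c\<bar> * (\<integral>\<^sup>+y. ennreal (1 / \<bar>c\<bar>) * (?\<phi> x y * f x y) \<partial>lborel)"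
      unfolding 1 2 ..
    also have "\<dots> = (\<integral>\<^sup>+y. ?\<phi> x y * f x y \<partial>lborel)"
      by (subst nn_integral_cmult) (simp_all add: mult.assoc[symmetric] c flip: ennreal_mult)
    finally show "(\<integral>\<^sup>+y. ennreal (1 / \<bar>c\<bar>) * (?\<phi> (s / c * y + 1 / c * x) y * f x ((s * x + y) / c)) \<partial>lborel)
      = (\<integral>\<^sup>+y. ?\<phi> x y * f x y \<partial>lborel)" .
  qed
  also have "\<dots> = (\<integral>\<^sup>+x. \<integral>\<^sup>+y. f x y \<partial>std_normal_distribution \<partial>std_normal_distribution)"
    by (rule to_lborel[symmetric]) measurable
  finally show ?thesis .
qed

text \<open>The rotation acts on each pair of coordinates separately.\<close>

lemma nn_integral_std_gaussian_rotation:
  fixes f :: "(nat \<Rightarrow> real) \<Rightarrow> (nat \<Rightarrow> real) \<Rightarrow> ennreal"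
  assumes "case_prod f \<in> borel_measurable (borel \<Otimes>\<^sub>M borel)"
    and cs: "c\<^sup>2 + s\<^sup>2 = 1" and c: "c \<noteq> 0"
  shows "(\<integral>\<^sup>+x. \<integral>\<^sup>+y. f (lin c x (- s) y) (lin s x c y) \<partial>std_gaussian d \<partial>std_gaussian d)
       = (\<integral>\<^sup>+x. \<integral>\<^sup>+y. f x y \<partial>std_gaussian d \<partial>std_gaussian d)"
  using assms(1)
proof (induction d arbitrary: f)
  case (0 f)
  note [measurable] = 0
  have "lin c (\<lambda>_. 0) (- s) (\<lambda>_. 0) = (\<lambda>_. 0 :: real)" "lin s (\<lambda>_. 0) c (\<lambda>_. 0) = (\<lambda>_. 0)"
    by (auto simp: lin_def)
  then show ?case by (simp add: nn_integral_std_gaussian_0 del: lin_apply)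
next
  case (Suc d f)
  note [measurable] = Suc.prems
  let ?N = std_normal_distribution
  have split: "(\<integral>\<^sup>+x. \<integral>\<^sup>+y. g x y \<partial>std_gaussian (Suc d) \<partial>std_gaussian (Suc d))
     = (\<integral>\<^sup>+x. \<integral>\<^sup>+y. \<integral>\<^sup>+t. \<integral>\<^sup>+r. g (x(d := t)) (y(d := r)) \<partial>?N \<partial>?N \<partial>std_gaussian d \<partial>std_gaussian d)"
    if [measurable]: "case_prod g \<in> borel_measurable (borel \<Otimes>\<^sub>M borel)" for g
  proof -
    interpret p: pair_sigma_finite ?N "std_gaussian d" ..
    have "(\<integral>\<^sup>+x. \<integral>\<^sup>+y. g x y \<partial>std_gaussian (Suc d) \<partial>std_gaussian (Suc d))
      = (\<integral>\<^sup>+x. \<integral>\<^sup>+t. \<integral>\<^sup>+y. \<integral>\<^sup>+r. g (x(d := t)) (y(d := r)) \<partial>?N \<partial>std_gaussian d \<partial>?N \<partial>std_gaussian d)"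
      by (simp add: nn_integral_std_gaussian_Suc)
    also have "\<dots> = (\<integral>\<^sup>+x. \<integral>\<^sup>+y. \<integral>\<^sup>+t. \<integral>\<^sup>+r. g (x(d := t)) (y(d := r)) \<partial>?N \<partial>?N \<partial>std_gaussian d \<partial>std_gaussian d)"
      by (intro nn_integral_cong p.Fubini'[symmetric]) measurable
    finally show ?thesis .
  qed
  have upd: "lin a (x(d := t)) b (y(d := r)) = (lin a x b y)(d := a * t + b * r)" for a b x y t r
    by (auto simp: lin_def)
  define h where "h x y = (\<integral>\<^sup>+t. \<integral>\<^sup>+r. f (x(d := t)) (y(d := r)) \<partial>?N \<partial>?N)" for x y
  have [measurable]: "case_prod h \<in> borel_measurable (borel \<Otimes>\<^sub>M borel)"
    unfolding h_def by measurable
  have "(\<integral>\<^sup>+x. \<integral>\<^sup>+y. f (lin c x (- s) y) (lin s x c y) \<partial>std_gaussian (Suc d) \<partial>std_gaussian (Suc d))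
      = (\<integral>\<^sup>+x. \<integral>\<^sup>+y. h (lin c x (- s) y) (lin s x c y) \<partial>std_gaussian d \<partial>std_gaussian d)"
  proof (subst split, measurable, intro nn_integral_cong)
    fix x y :: "nat \<Rightarrow> real"
    show "(\<integral>\<^sup>+t. \<integral>\<^sup>+r. f (lin c (x(d := t)) (- s) (y(d := r))) (lin s (x(d := t)) c (y(d := r))) \<partial>?N \<partial>?N)
       = h (lin c x (- s) y) (lin s x c y)"
      unfolding upd h_def
      using nn_integral_std_normal_rotation[OF _ cs c,
          of "\<lambda>t r. f ((lin c x (- s) y)(d := t)) ((lin s x c y)(d := r))"]
      by simp
  qed
  also have "\<dots> = (\<integral>\<^sup>+x. \<integral>\<^sup>+y. h x y \<partial>std_gaussian d \<partial>std_gaussian d)"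
    by (rule Suc.IH) measurable
  also have "\<dots> = (\<integral>\<^sup>+x. \<integral>\<^sup>+y. f x y \<partial>std_gaussian (Suc d) \<partial>std_gaussian (Suc d))"
    unfolding h_def by (rule split[symmetric]) measurable
  finally show ?case .
qed

section \<open>Functions of controlled Gaussian growth\<close>

text \<open>Growth of order \<open>exp (\<rho> q)\<close>, up to an arbitrarily small loss in the exponent. The loss makes
  polynomials in the norm, and shifts of the argument, free of charge: they have order \<open>0\<close>, and
  orders add under products. Against the standard Gaussian, order below \<open>1/2\<close> in \<open>\<parallel>x\<parallel>\<^sup>2\<close> implies
  integrability.\<close>

definition tame :: "('a \<Rightarrow> real) \<Rightarrow> real \<Rightarrow> ('a \<Rightarrow> 'b::real_normed_vector) \<Rightarrow> bool" where
  "tame q \<rho> f \<longleftrightarrow> (\<forall>\<eta>>\<rho>. \<exists>K. \<forall>w. norm (f w) \<le> K * exp (\<eta> * q w))"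

lemma tameE:
  assumes "tame q \<rho> f" "\<rho> < \<eta>"
  obtains K where "0 \<le> K" "\<And>w. norm (f w) \<le> K * exp (\<eta> * q w)"
proof -
  obtain K where K: "\<And>w. norm (f w) \<le> K * exp (\<eta> * q w)" using assms by (auto simp: tame_def)
  have "norm (f w) \<le> max K 0 * exp (\<eta> * q w)" for w
    by (rule order_trans[OF K]) (simp add: mult_right_mono)
  then show ?thesis using that[of "max K 0"] by auto
qed

lemma tame_bound:
  assumes "tame q \<rho> f" "\<And>w. norm (g w) \<le> norm (f w)"
  shows "tame q \<rho> g"
  using assms unfolding tame_def by (meson order_trans)

lemma tame_const:
  assumes "\<And>w. 0 \<le> q w" "0 \<le> \<rho>" shows "tame q \<rho> (\<lambda>_. c)"
  unfolding tame_def
proof (intro allI impI exI)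
  fix \<eta> w assume "\<rho> < \<eta>"
  then have "1 \<le> exp (\<eta> * q w)" using assms by simp
  then show "norm c \<le> norm c * exp (\<eta> * q w)"
    by (simp add: mult_le_cancel_left1)
qed

lemma tame_add:
  assumes "tame q \<rho> f" "tame q \<rho> g" shows "tame q \<rho> (\<lambda>w. f w + g w)"
  unfolding tame_def
proof (intro allI impI)
  fix \<eta> assume "\<rho> < \<eta>"
  then obtain K L where "\<And>w. norm (f w) \<le> K * exp (\<eta> * q w)" "\<And>w. norm (g w) \<le> L * exp (\<eta> * q w)"
    using assms by (metis tameE)
  then have "norm (f w + g w) \<le> (K + L) * exp (\<eta> * q w)" for w
    by (metis add_mono distrib_right norm_triangle_le)
  then show "\<exists>K. \<forall>w. norm (f w + g w) \<le> K * exp (\<eta> * q w)" by blast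
qed

lemma tame_prod_bound_add:
  assumes f: "tame q \<rho> f" and g: "tame q \<sigma> g" and h: "\<And>w. norm (h w) \<le> norm (f w) * norm (g w)"
  shows "tame q (\<rho> + \<sigma>) h"
  unfolding tame_def
proof (intro allI impI)
  fix \<eta> assume \<eta>: "\<rho> + \<sigma> < \<eta>"
  define \<delta> where "\<delta> = (\<eta> - \<rho> - \<sigma>) / 2"
  have \<delta>: "0 < \<delta>" and \<eta>_eq: "\<eta> = (\<rho> + \<delta>) + (\<sigma> + \<delta>)" using \<eta> by (auto simp: \<delta>_def field_simps)
  obtain K where K: "0 \<le> K" "\<And>w. norm (f w) \<le> K * exp ((\<rho> + \<delta>) * q w)"
    using tameE[OF f, of "\<rho> + \<delta>"] \<delta> by auto
  obtain L where L: "0 \<le> L" "\<And>w. norm (g w) \<le> L * exp ((\<sigma> + \<delta>) * q w)"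
    using tameE[OF g, of "\<sigma> + \<delta>"] \<delta> by auto
  have "norm (h w) \<le> K * L * exp (\<eta> * q w)" for w
  proof -
    have "norm (f w) * norm (g w) \<le> (K * exp ((\<rho> + \<delta>) * q w)) * (L * exp ((\<sigma> + \<delta>) * q w))"
      using K L by (intro mult_mono) auto
    also have "\<dots> = K * L * exp (\<eta> * q w)"
      unfolding \<eta>_eq distrib_right[of "\<rho> + \<delta>"] exp_add by simp
    finally show ?thesis using h[of w] by linarith
  qed
  then show "\<exists>K. \<forall>w. norm (h w) \<le> K * exp (\<eta> * q w)" by blast
qed

lemma tame_prod_bound:
  assumes "tame q \<rho> f" "tame q 0 g" "\<And>w. norm (h w) \<le> norm (f w) * norm (g w)"
  shows "tame q \<rho> h"
  using tame_prod_bound_add[OF assms] by simp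

lemma tame_mult_left:
  fixes f g :: "'a \<Rightarrow> 'b::real_normed_algebra"
  shows "tame q 0 g \<Longrightarrow> tame q \<rho> f \<Longrightarrow> tame q \<rho> (\<lambda>w. g w * f w)"
  by (erule tame_prod_bound, assumption) (simp add: norm_mult_ineq mult.commute order_trans[OF norm_mult_ineq])

lemma tame_mult_right:
  fixes f g :: "'a \<Rightarrow> 'b::real_normed_algebra"
  shows "tame q \<rho> f \<Longrightarrow> tame q 0 g \<Longrightarrow> tame q \<rho> (\<lambda>w. f w * g w)"
  by (erule tame_prod_bound, assumption) (simp add: norm_mult_ineq)

lemma tame_scaleR: "tame q 0 g \<Longrightarrow> tame q \<rho> f \<Longrightarrow> tame q \<rho> (\<lambda>w. g w *\<^sub>R f w)"
  by (erule tame_prod_bound, assumption) simp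

lemma tame_norm: "tame q \<rho> f \<Longrightarrow> tame q \<rho> (\<lambda>w. norm (f w))"
  unfolding tame_def by simp

lemma tame_of_real: "tame q \<rho> f \<Longrightarrow> tame q \<rho> (\<lambda>w. of_real (f w) :: 'b::{real_normed_algebra_1})"
  unfolding tame_def by simp

lemma tame_linear: "0 \<le> c \<Longrightarrow> (\<And>w. norm (f w) \<le> c * (1 + q w)) \<Longrightarrow> (\<And>w. 0 \<le> q w) \<Longrightarrow> tame q 0 f"
  unfolding tame_def
proof (intro allI impI)
  fix \<eta> :: real
  assume c: "0 \<le> c" and f: "\<And>w. norm (f w) \<le> c * (1 + q w)" and q: "\<And>w. 0 \<le> q w" and \<eta>: "0 < \<eta>"
  have "norm (f w) \<le> c * (1 + 1 / \<eta>) * exp (\<eta> * q w)" for w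
  proof -
    have "1 \<le> exp (\<eta> * q w)" using \<eta> q by simp
    moreover have "q w \<le> 1 / \<eta> * exp (\<eta> * q w)"
    proof -
      have "\<eta> * q w \<le> exp (\<eta> * q w)" using exp_ge_add_one_self[of "\<eta> * q w"] by linarith
      then show ?thesis using \<eta> by (simp add: field_simps)
    qed
    ultimately have "1 + q w \<le> (1 + 1 / \<eta>) * exp (\<eta> * q w)" unfolding distrib_right by linarith
    then show ?thesis using mult_left_mono[OF _ c] f[of w] by (metis order_trans mult.assoc)
  qed
  then show "\<exists>K. \<forall>w. norm (f w) \<le> K * exp (\<eta> * q w)" by blast
qed

lemma tame_sqrt:
  fixes f :: "'a \<Rightarrow> 'b::real_normed_vector"
  assumes "\<And>w. (norm (f w))\<^sup>2 \<le> q w"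
  shows "tame q 0 f"
proof (rule tame_linear[of 1])
  fix w
  have "0 \<le> (norm (f w) - 1)\<^sup>2" by simp
  then have "2 * norm (f w) \<le> (norm (f w))\<^sup>2 + 1" unfolding power2_diff by simp
  then have "norm (f w) \<le> 1 + q w"
    using assms[of w] norm_ge_zero[of "f w"] by linarith
  then show "norm (f w) \<le> 1 * (1 + q w)" by simp
  show "0 \<le> q w" using assms[of w] by (meson order_trans zero_le_power2)
qed simp

lemma tame_exp: "(\<And>w. norm (f w) \<le> exp (\<rho> * q w)) \<Longrightarrow> (\<And>w. 0 \<le> q w) \<Longrightarrow> tame q \<rho> f"
  unfolding tame_def
  by (metis exp_le_cancel_iff less_imp_le mult_1 mult_right_mono order_trans)

text \<open>Completing the square: \<open>b sqrt q\<close> is at most \<open>\<eta> q + b\<^sup>2 / (4 \<eta>)\<close> for every positive \<open>\<eta>\<close>.\<close>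

lemma tame_exp_abs_norm:
  fixes f :: "'a \<Rightarrow> real"
  assumes "\<And>w. \<bar>f w\<bar> \<le> b * sqrt (q w) + b'" "0 \<le> b" and q: "\<And>w. 0 \<le> q w"
  shows "tame q 0 (\<lambda>w. exp \<bar>f w\<bar>)"
  unfolding tame_def
proof (intro allI impI)
  fix \<eta> :: real assume \<eta>: "0 < \<eta>"
  have "norm (exp \<bar>f w\<bar>) \<le> exp (b' + b\<^sup>2 / (4 * \<eta>)) * exp (\<eta> * q w)" for w
  proof -
    have "0 \<le> (2 * \<eta> * sqrt (q w) - b)\<^sup>2 / (4 * \<eta>)" using \<eta> by simp
    also have "\<dots> = \<eta> * (sqrt (q w))\<^sup>2 - b * sqrt (q w) + b\<^sup>2 / (4 * \<eta>)"
      using \<eta> by (simp add: power2_diff power_mult_distrib field_simps power2_eq_square)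
    also have "(sqrt (q w))\<^sup>2 = q w" using q by simp
    finally have "\<bar>f w\<bar> \<le> (b' + b\<^sup>2 / (4 * \<eta>)) + \<eta> * q w" using assms(1)[of w] by linarith
    then show ?thesis by (simp flip: exp_add)
  qed
  then show "\<exists>K. \<forall>w. norm (exp \<bar>f w\<bar>) \<le> K * exp (\<eta> * q w)" by blast
qed

abbreviation sq :: "nat \<Rightarrow> (nat \<Rightarrow> real) \<Rightarrow> real" where
  "sq d x \<equiv> (norm_d d x)\<^sup>2"

abbreviation sq2 :: "nat \<Rightarrow> (nat \<Rightarrow> real) \<times> (nat \<Rightarrow> real) \<Rightarrow> real" where
  "sq2 d w \<equiv> sq d (fst w) + sq d (snd w)"

text \<open>A rotated vector is no longer than the pair it is built from.\<close>

lemma tame_lin: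
  assumes f: "tame (sq d) \<rho> f" and \<rho>: "0 \<le> \<rho>" and ab: "a\<^sup>2 + b\<^sup>2 = 1"
  shows "tame (sq2 d) \<rho> (\<lambda>w. f (lin a (fst w) b (snd w)))"
  unfolding tame_def
proof (intro allI impI)
  fix \<eta> assume \<eta>: "\<rho> < \<eta>"
  then obtain K where K: "0 \<le> K" "\<And>w. norm (f w) \<le> K * exp (\<eta> * sq d w)" by (rule tameE[OF f]) auto
  have "norm (f (lin a (fst w) b (snd w))) \<le> K * exp (\<eta> * sq2 d w)" for w
    using K(1) \<rho> \<eta> by (intro order_trans[OF K(2)] mult_left_mono) (auto intro!: norm_d_rotation ab mult_left_mono)
  then show "\<exists>K. \<forall>w. norm (f (lin a (fst w) b (snd w))) \<le> K * exp (\<eta> * sq2 d w)" by blast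
qed

lemma tame_fst: "tame (sq d) \<rho> f \<Longrightarrow> 0 \<le> \<rho> \<Longrightarrow> tame (sq2 d) \<rho> (\<lambda>w. f (fst w))"
  using tame_lin[of d \<rho> f 1 0] by (simp add: lin_def)

lemma tame_snd: "tame (sq d) \<rho> f \<Longrightarrow> 0 \<le> \<rho> \<Longrightarrow> tame (sq2 d) \<rho> (\<lambda>w. f (snd w))"
  using tame_lin[of d \<rho> f 0 1] by (simp add: lin_def)

lemma tame_section:
  assumes f: "tame (sq2 d) \<rho> f"
  shows "tame (sq d) \<rho> (\<lambda>y. f (x, y))"
  unfolding tame_def
proof (intro allI impI)
  fix \<eta> assume \<eta>: "\<rho> < \<eta>"
  then obtain K where K: "0 \<le> K" "\<And>w. norm (f w) \<le> K * exp (\<eta> * sq2 d w)" by (rule tameE[OF f]) auto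
  have "norm (f (x, y)) \<le> (K * exp (\<eta> * sq d x)) * exp (\<eta> * sq d y)" for y
    using K(2)[of "(x, y)"] by (simp add: distrib_left exp_add mult.assoc)
  then show "\<exists>K. \<forall>w. norm (f (x, w)) \<le> K * exp (\<eta> * sq d w)" by blast
qed

lemma tame_norm_d: "tame (sq d) 0 (norm_d d)"
  by (rule tame_sqrt) simp

lemma tame_inner_d:
  assumes "tame q 0 (\<lambda>w. norm_d d (f w))" "tame q 0 (\<lambda>w. norm_d d (g w))"
  shows "tame q 0 (\<lambda>w. inner_d d (f w) (g w))"
  by (rule tame_prod_bound[OF assms]) (simp add: abs_inner_d_le)

lemma nn_integral_std_normal_exp_square:
  assumes "\<rho> < 1 / 2"
  shows "(\<integral>\<^sup>+t. ennreal (exp (\<rho> * t\<^sup>2)) \<partial>std_normal_distribution) = ennreal (1 / sqrt (1 - 2 * \<rho>))"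
proof -
  define \<sigma> where "\<sigma> = 1 / sqrt (1 - 2 * \<rho>)"
  have \<sigma>: "0 < \<sigma>" and \<sigma>2: "1 / \<sigma>\<^sup>2 = 1 - 2 * \<rho>" using assms by (auto simp: \<sigma>_def power_divide)
  have "std_normal_density t * exp (\<rho> * t\<^sup>2) = \<sigma> * normal_density 0 \<sigma> t" for t
  proof -
    have "\<rho> = (1 - 1 / \<sigma>\<^sup>2) / 2" using \<sigma>2 by simp
    then have "- t\<^sup>2 / 2 + \<rho> * t\<^sup>2 = - t\<^sup>2 / (2 * \<sigma>\<^sup>2)"
      by (simp add: diff_divide_distrib left_diff_distrib)
    then have "exp (- t\<^sup>2 / 2) * exp (\<rho> * t\<^sup>2) = exp (- t\<^sup>2 / (2 * \<sigma>\<^sup>2))"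
      by (simp flip: exp_add)
    then show ?thesis
      using \<sigma> by (simp add: normal_density_def real_sqrt_mult)
  qed
  then have "ennreal (std_normal_density t) * ennreal (exp (\<rho> * t\<^sup>2)) = ennreal \<sigma> * ennreal (normal_density 0 \<sigma> t)" for t
    using \<sigma> by (simp flip: ennreal_mult)
  then have "(\<integral>\<^sup>+t. ennreal (exp (\<rho> * t\<^sup>2)) \<partial>std_normal_distribution)
      = ennreal \<sigma> * (\<integral>\<^sup>+t. ennreal (normal_density 0 \<sigma> t) \<partial>lborel)"
    by (simp add: nn_integral_density nn_integral_cmult)
  also have "(\<integral>\<^sup>+t. ennreal (normal_density 0 \<sigma> t) \<partial>lborel) = 1"
    using prob_space.emeasure_space_1[OF prob_space_normal_density[OF \<sigma>, of 0]]
    by (simp add: emeasure_density)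
  finally show ?thesis by (simp add: \<sigma>_def)
qed

lemma norm_d_Suc_upd: "sq (Suc d) (x(d := t)) = sq d x + t\<^sup>2"
proof -
  have "(\<Sum>i<d. (x(d := t)) i * (x(d := t)) i) = (\<Sum>i<d. x i * x i)" by (rule sum.cong) auto
  then show ?thesis unfolding norm_d_power2 inner_d_def sum.lessThan_Suc by (simp add: power2_eq_square)
qed

lemma nn_integral_std_gaussian_exp_square:
  assumes "\<rho> < 1 / 2"
  shows "(\<integral>\<^sup>+x. ennreal (exp (\<rho> * sq d x)) \<partial>std_gaussian d) = ennreal (1 / sqrt (1 - 2 * \<rho>)) ^ d"
proof (induction d)
  case 0
  then show ?case by (subst nn_integral_std_gaussian_0) (simp_all add: norm_d_def)
next
  case (Suc d)
  have "(\<integral>\<^sup>+x. ennreal (exp (\<rho> * sq (Suc d) x)) \<partial>std_gaussian (Suc d))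
      = (\<integral>\<^sup>+x. ennreal (exp (\<rho> * sq d x)) * ennreal (1 / sqrt (1 - 2 * \<rho>)) \<partial>std_gaussian d)"
    using assms
    by (simp add: nn_integral_std_gaussian_Suc norm_d_Suc_upd distrib_left exp_add ennreal_mult
        nn_integral_cmult nn_integral_std_normal_exp_square)
  also have "\<dots> = ennreal (1 / sqrt (1 - 2 * \<rho>)) ^ Suc d"
    by (subst nn_integral_multc) (simp_all add: Suc.IH mult.commute)
  finally show ?case .
qed

lemma integrable_std_gaussian_exp_square: "\<rho> < 1 / 2 \<Longrightarrow> integrable (std_gaussian d) (\<lambda>x. exp (\<rho> * sq d x))"
  by (rule integrableI_nonneg) (simp_all add: nn_integral_std_gaussian_exp_square ennreal_power[symmetric] power_less_top_ennreal)

abbreviation gauss_pair :: "nat \<Rightarrow> ((nat \<Rightarrow> real) \<times> (nat \<Rightarrow> real)) measure" where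
  "gauss_pair d \<equiv> std_gaussian d \<Otimes>\<^sub>M std_gaussian d"

lemma integrable_gauss_pair_exp_square:
  assumes "\<rho> < 1 / 2" shows "integrable (gauss_pair d) (\<lambda>w. exp (\<rho> * sq2 d w))"
proof (rule integrableI_nonneg)
  have "(\<integral>\<^sup>+w. ennreal (exp (\<rho> * sq2 d w)) \<partial>gauss_pair d)
      = (\<integral>\<^sup>+x. ennreal (exp (\<rho> * sq d x)) * (\<integral>\<^sup>+y. ennreal (exp (\<rho> * sq d y)) \<partial>std_gaussian d) \<partial>std_gaussian d)"
    by (subst gauss.nn_integral_fst[symmetric])
      (simp_all add: distrib_left exp_add ennreal_mult nn_integral_cmult)
  also have "\<dots> < \<infinity>"
    using assms by (simp add: nn_integral_multc nn_integral_std_gaussian_exp_square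
      ennreal_mult_less_top power_less_top_ennreal)
  finally show "(\<integral>\<^sup>+w. ennreal (exp (\<rho> * sq2 d w)) \<partial>gauss_pair d) < \<infinity>" .
qed auto

lemma integrable_tame:
  fixes f :: "(nat \<Rightarrow> real) \<Rightarrow> 'b::{banach, second_countable_topology}"
  assumes "tame (sq d) \<rho> f" "\<rho> < 1 / 2" and [measurable]: "f \<in> borel_measurable borel"
  shows "integrable (std_gaussian d) f"
proof -
  obtain K where K: "0 \<le> K" "\<And>w. norm (f w) \<le> K * exp ((\<rho> + 1 / 2) / 2 * sq d w)"
    using tameE[OF assms(1), of "(\<rho> + 1 / 2) / 2"] assms(2) by auto
  show ?thesis
    by (rule Bochner_Integration.integrable_bound[OF integrable_mult_right[OF integrable_std_gaussian_exp_square[of "(\<rho> + 1 / 2) / 2"]], of K])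
      (use K assms(2) in auto)
qed

lemma integrable_tame2:
  fixes f :: "(nat \<Rightarrow> real) \<times> (nat \<Rightarrow> real) \<Rightarrow> 'b::{banach, second_countable_topology}"
  assumes "tame (sq2 d) \<rho> f" "\<rho> < 1 / 2" and [measurable]: "f \<in> borel_measurable (borel \<Otimes>\<^sub>M borel)"
  shows "integrable (gauss_pair d) f"
proof -
  obtain K where K: "0 \<le> K" "\<And>w. norm (f w) \<le> K * exp ((\<rho> + 1 / 2) / 2 * sq2 d w)"
    using tameE[OF assms(1), of "(\<rho> + 1 / 2) / 2"] assms(2) by auto
  show ?thesis
    by (rule Bochner_Integration.integrable_bound[OF integrable_mult_right[OF integrable_gauss_pair_exp_square[of "(\<rho> + 1 / 2) / 2"]], of K])
      (use K assms(2) in auto)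
qed

lemma tame_integral:
  fixes f :: "(nat \<Rightarrow> real) \<times> (nat \<Rightarrow> real) \<Rightarrow> 'b::{banach, second_countable_topology}"
  assumes f: "tame (sq2 d) \<rho> f" and \<rho>: "\<rho> < 1 / 2" and [measurable]: "f \<in> borel_measurable (borel \<Otimes>\<^sub>M borel)"
  shows "tame (sq d) \<rho> (\<lambda>x. \<integral>y. f (x, y) \<partial>std_gaussian d)"
  unfolding tame_def
proof (intro allI impI)
  fix \<eta>' assume "\<rho> < \<eta>'"
  \<comment> \<open>The inner integral converges only at rates below \<open>1/2\<close>.\<close>
  define \<eta> where "\<eta> = min \<eta>' ((\<rho> + 1 / 2) / 2)"
  have \<eta>: "\<rho> < \<eta>" "\<eta> < 1 / 2" "\<eta> \<le> \<eta>'" proof -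
    have "\<rho> < (\<rho> + 1 / 2) / 2" "(\<rho> + 1 / 2) / 2 < 1 / 2" using \<rho> by simp_all
    then show "\<rho> < \<eta>" "\<eta> < 1 / 2" "\<eta> \<le> \<eta>'"
      using \<open>\<rho> < \<eta>'\<close> unfolding \<eta>_def by linarith+
  qed
  obtain K where K: "0 \<le> K" "\<And>w. norm (f w) \<le> K * exp (\<eta> * sq2 d w)"
    using tameE[OF f \<eta>(1)] by auto
  define L where "L = (\<integral>y. exp (\<eta> * sq d y) \<partial>std_gaussian d)"
  have "norm (\<integral>y. f (x, y) \<partial>std_gaussian d) \<le> (K * L) * exp (\<eta>' * sq d x)" for x
  proof -
    have int: "integrable (std_gaussian d) (\<lambda>y. f (x, y))"
      by (rule integrable_tame[OF tame_section[OF f] \<rho>]) measurable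
    have "norm (\<integral>y. f (x, y) \<partial>std_gaussian d) \<le> (\<integral>y. norm (f (x, y)) \<partial>std_gaussian d)"
      by (rule integral_norm_bound)
    also have "\<dots> \<le> (\<integral>y. (K * exp (\<eta> * sq d x)) * exp (\<eta> * sq d y) \<partial>std_gaussian d)"
      using int K(2)[of "(x, _)"]
      by (intro integral_mono integrable_mult_right integrable_std_gaussian_exp_square integrable_norm \<eta>)
        (simp_all add: distrib_left exp_add mult.assoc)
    also have "\<dots> = K * L * exp (\<eta> * sq d x)" by (simp add: L_def)
    also have "\<dots> \<le> K * L * exp (\<eta>' * sq d x)"
      using K(1) \<eta> by (intro mult_left_mono) (auto simp: L_def mult_right_mono)
    finally show ?thesis .
  qed
  then show "\<exists>K. \<forall>x. norm (\<integral>y. f (x, y) \<partial>std_gaussian d) \<le> K * exp (\<eta>' * sq d x)" by blast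
qed

section \<open>Shifts and rotations of Gaussian integrals\<close>

lemma nn_integral_std_normal_shift:
  fixes f :: "real \<Rightarrow> ennreal"
  assumes [measurable]: "f \<in> borel_measurable borel"
  shows "(\<integral>\<^sup>+t. f (t + b) \<partial>std_normal_distribution)
       = (\<integral>\<^sup>+t. ennreal (exp (b * t - b\<^sup>2 / 2)) * f t \<partial>std_normal_distribution)"
proof -
  have dens: "ennreal (std_normal_density (- b + 1 * t)) = ennreal (std_normal_density t) * ennreal (exp (b * t - b\<^sup>2 / 2))" for t
  proof -
    have "- (- b + 1 * t)\<^sup>2 / 2 = - t\<^sup>2 / 2 + (b * t - b\<^sup>2 / 2)"
      by (simp add: power2_eq_square field_simps)
    then have "exp (- (- b + 1 * t)\<^sup>2 / 2) = exp (- t\<^sup>2 / 2) * exp (b * t - b\<^sup>2 / 2)"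
      by (simp only: exp_add)
    then show ?thesis
      unfolding std_normal_density_def by (simp flip: ennreal_mult)
  qed
  have "(\<integral>\<^sup>+t. f (t + b) \<partial>std_normal_distribution) = (\<integral>\<^sup>+t. ennreal (std_normal_density t) * f (t + b) \<partial>lborel)"
    by (simp add: nn_integral_density)
  also have "\<dots> = ennreal \<bar>1\<bar> * (\<integral>\<^sup>+t. ennreal (std_normal_density (- b + 1 * t)) * f (- b + 1 * t + b) \<partial>lborel)"
    by (rule nn_integral_real_affine) simp_all
  also have "\<dots> = (\<integral>\<^sup>+t. ennreal (exp (b * t - b\<^sup>2 / 2)) * f t \<partial>std_normal_distribution)"
    unfolding dens by (simp add: nn_integral_density mult.assoc)
  finally show ?thesis .
qed

text \<open>The Cameron-Martin formula. The shift has to vanish from coordinate \<open>d\<close> on, like all points of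
  the space that carries the measure.\<close>

lemma nn_integral_std_gaussian_shift:
  fixes f :: "(nat \<Rightarrow> real) \<Rightarrow> ennreal"
  assumes "f \<in> borel_measurable borel" and "\<And>i. d \<le> i \<Longrightarrow> v i = 0"
  shows "(\<integral>\<^sup>+x. f (lin 1 x 1 v) \<partial>std_gaussian d)
       = (\<integral>\<^sup>+x. ennreal (exp (inner_d d v x - sq d v / 2)) * f x \<partial>std_gaussian d)"
  using assms
proof (induction d arbitrary: f v)
  case (0 f v)
  note [measurable] = 0(1)
  have "v = (\<lambda>_. 0)" using 0(2) by auto
  then have "lin 1 (\<lambda>_. 0) 1 v = (\<lambda>_. 0)" by (simp add: lin_def)
  then show ?case by (subst (1 2) nn_integral_std_gaussian_0) (simp_all add: inner_d_def norm_d_def del: lin_apply)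
next
  case (Suc d f v)
  note [measurable] = Suc.prems(1)
  let ?N = std_normal_distribution
  define v' where "v' = v(d := 0)"
  have v': "v' i = 0" if "d \<le> i" for i using Suc.prems(2)[of i] that by (auto simp: v'_def)
  have v: "v = v'(d := v d)" by (auto simp: v'_def)
  have upd: "lin 1 (x(d := t)) 1 v = (lin 1 x 1 v')(d := t + v d)" for x t
    by (auto simp: v'_def)
  have inner: "inner_d (Suc d) v (x(d := t)) = inner_d d v' x + v d * t" for x t
  proof -
    have "(\<Sum>i<d. v i * (x(d := t)) i) = (\<Sum>i<d. v' i * x i)" by (rule sum.cong) (auto simp: v'_def)
    then show ?thesis unfolding inner_d_def sum.lessThan_Suc by simp
  qed
  have normv: "sq (Suc d) v = sq d v' + (v d)\<^sup>2"
    using norm_d_Suc_upd[of d v' "v d"] by (simp flip: v)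
  define h where "h x = (\<integral>\<^sup>+t. ennreal (exp (v d * t - (v d)\<^sup>2 / 2)) * f (x(d := t)) \<partial>?N)" for x
  have [measurable]: "h \<in> borel_measurable borel" unfolding h_def by measurable
  have "(\<integral>\<^sup>+x. f (lin 1 x 1 v) \<partial>std_gaussian (Suc d))
      = (\<integral>\<^sup>+x. (\<integral>\<^sup>+t. f ((lin 1 x 1 v')(d := t + v d)) \<partial>?N) \<partial>std_gaussian d)"
    by (subst nn_integral_std_gaussian_Suc) (simp_all only: upd, measurable)
  also have "\<dots> = (\<integral>\<^sup>+x. h (lin 1 x 1 v') \<partial>std_gaussian d)"
    unfolding h_def
    by (intro nn_integral_cong nn_integral_std_normal_shift[of "\<lambda>t. f ((lin 1 _ 1 v')(d := t))"]) measurable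
  also have "\<dots> = (\<integral>\<^sup>+x. ennreal (exp (inner_d d v' x - sq d v' / 2)) * h x \<partial>std_gaussian d)"
    by (rule Suc.IH) (auto simp: v')
  also have "\<dots> = (\<integral>\<^sup>+x. (\<integral>\<^sup>+t. ennreal (exp (inner_d (Suc d) v (x(d := t)) - sq (Suc d) v / 2)) * f (x(d := t)) \<partial>?N) \<partial>std_gaussian d)"
  proof (rule nn_integral_cong)
    fix x
    have "ennreal (exp (inner_d (Suc d) v (x(d := t)) - sq (Suc d) v / 2))
        = ennreal (exp (inner_d d v' x - sq d v' / 2)) * ennreal (exp (v d * t - (v d)\<^sup>2 / 2))" for t
      unfolding inner normv by (simp add: add_divide_distrib algebra_simps flip: ennreal_mult exp_add)
    then show "ennreal (exp (inner_d d v' x - sq d v' / 2)) * h x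
      = (\<integral>\<^sup>+t. ennreal (exp (inner_d (Suc d) v (x(d := t)) - sq (Suc d) v / 2)) * f (x(d := t)) \<partial>?N)"
      unfolding h_def by (subst nn_integral_cmult[symmetric]) (measurable, simp add: mult.assoc)
  qed
  also have "\<dots> = (\<integral>\<^sup>+x. ennreal (exp (inner_d (Suc d) v x - sq (Suc d) v / 2)) * f x \<partial>std_gaussian (Suc d))"
    by (subst nn_integral_std_gaussian_Suc) simp_all
  finally show ?case .
qed

lemma integral_std_gaussian_shift:
  fixes f :: "(nat \<Rightarrow> real) \<Rightarrow> 'b::{banach, second_countable_topology}"
  assumes [measurable]: "f \<in> borel_measurable borel" and v: "\<And>i. d \<le> i \<Longrightarrow> v i = 0"
  shows "(\<integral>x. f (lin 1 x 1 v) \<partial>std_gaussian d)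
       = (\<integral>x. exp (inner_d d v x - sq d v / 2) *\<^sub>R f x \<partial>std_gaussian d)"
proof -
  have "distr (std_gaussian d) borel (\<lambda>x. lin 1 x 1 v)
      = density (std_gaussian d) (\<lambda>x. ennreal (exp (inner_d d v x - sq d v / 2)))" (is "?L = ?R")
  proof (rule measure_eqI)
    fix A assume "A \<in> sets ?L"
    then have [measurable]: "A \<in> sets borel" by simp
    have "emeasure ?L A = (\<integral>\<^sup>+x. indicator A x \<partial>?L)" by simp
    also have "\<dots> = (\<integral>\<^sup>+x. indicator A (lin 1 x 1 v) \<partial>std_gaussian d)"
      by (rule nn_integral_distr) measurable
    also have "\<dots> = (\<integral>\<^sup>+x. ennreal (exp (inner_d d v x - sq d v / 2)) * indicator A x \<partial>std_gaussian d)"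
      using v by (intro nn_integral_std_gaussian_shift) auto
    also have "\<dots> = emeasure ?R A" by (simp add: emeasure_density)
    finally show "emeasure ?L A = emeasure ?R A" .
  qed simp
  then have "(\<integral>x. f x \<partial>?L) = (\<integral>x. f x \<partial>?R)" by simp
  then show ?thesis by (simp add: integral_distr integral_density)
qed

text \<open>Equality of measures, rather than of nonnegative integrals, transfers rotation invariance to
  vector-valued integrands.\<close>

lemma distr_gauss_pair_rotation:
  assumes "c\<^sup>2 + s\<^sup>2 = 1" "c \<noteq> 0"
  shows "distr (gauss_pair d) (borel \<Otimes>\<^sub>M borel) (\<lambda>w. (lin c (fst w) (- s) (snd w), lin s (fst w) c (snd w))) = gauss_pair d"
    (is "?L = ?R")
proof (rule measure_eqI)
  fix A assume "A \<in> sets ?L"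
  then have [measurable]: "A \<in> sets (borel \<Otimes>\<^sub>M borel)" by simp
  then have A: "A \<in> sets (gauss_pair d)" by (simp cong: sets_pair_measure_cong)
  define I :: "_ \<Rightarrow> ennreal" where "I = indicator A"
  have [measurable]: "I \<in> borel_measurable (borel \<Otimes>\<^sub>M borel)" unfolding I_def by measurable
  have "emeasure ?L A = (\<integral>\<^sup>+w. I w \<partial>?L)" by (simp add: I_def)
  also have "\<dots> = (\<integral>\<^sup>+w. I (lin c (fst w) (- s) (snd w), lin s (fst w) c (snd w)) \<partial>gauss_pair d)"
    by (rule nn_integral_distr) measurable
  also have "\<dots> = (\<integral>\<^sup>+x. \<integral>\<^sup>+y. I (lin c x (- s) y, lin s x c y) \<partial>std_gaussian d \<partial>std_gaussian d)"
    using gauss.nn_integral_fst[OF measurable_compose[of "\<lambda>w. (lin c (fst w) (- s) (snd w), lin s (fst w) c (snd w))"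
        "gauss_pair d" "borel \<Otimes>\<^sub>M borel" I borel]] by simp
  also have "\<dots> = (\<integral>\<^sup>+x. \<integral>\<^sup>+y. I (x, y) \<partial>std_gaussian d \<partial>std_gaussian d)"
    using assms by (intro nn_integral_std_gaussian_rotation) measurable
  also have "\<dots> = (\<integral>\<^sup>+w. I w \<partial>gauss_pair d)"
    by (rule gauss.nn_integral_fst) (use A in \<open>simp only: I_def borel_measurable_indicator\<close>)
  also have "\<dots> = emeasure ?R A" using A by (simp add: I_def)
  finally show "emeasure ?L A = emeasure ?R A" .
qed (simp cong: sets_pair_measure_cong)

lemma integral_gauss_pair_rotation:
  fixes f :: "(nat \<Rightarrow> real) \<times> (nat \<Rightarrow> real) \<Rightarrow> 'b::{banach, second_countable_topology}"
  assumes [measurable]: "f \<in> borel_measurable (borel \<Otimes>\<^sub>M borel)" and "c\<^sup>2 + s\<^sup>2 = 1" "c \<noteq> 0"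
  shows "(\<integral>w. f (lin c (fst w) (- s) (snd w), lin s (fst w) c (snd w)) \<partial>gauss_pair d) = (\<integral>w. f w \<partial>gauss_pair d)"
  by (subst (2) distr_gauss_pair_rotation[OF assms(2,3), symmetric])
    (rule integral_distr[symmetric], measurable)

lemma integral_gauss_pair_fst:
  fixes f :: "(nat \<Rightarrow> real) \<Rightarrow> 'b::{banach, second_countable_topology}"
  assumes [measurable]: "f \<in> borel_measurable borel"
  shows "(\<integral>w. f (fst w) \<partial>gauss_pair d) = (\<integral>x. f x \<partial>std_gaussian d)"
proof -
  have "(\<integral>w. f (fst w) \<partial>gauss_pair d) = (\<integral>x. f x \<partial>distr (gauss_pair d) (std_gaussian d) fst)"
    by (rule integral_distr[symmetric]) measurable
  also have "distr (gauss_pair d) (std_gaussian d) fst = std_gaussian d"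
    by (rule gauss.distr_pair_fst)
  finally show ?thesis .
qed

lemma integral_gauss_pair_lin:
  fixes f :: "(nat \<Rightarrow> real) \<Rightarrow> 'b::{banach, second_countable_topology}"
  assumes [measurable]: "f \<in> borel_measurable borel" and "a\<^sup>2 + b\<^sup>2 = 1" "a \<noteq> 0"
  shows "(\<integral>w. f (lin a (fst w) b (snd w)) \<partial>gauss_pair d) = (\<integral>x. f x \<partial>std_gaussian d)"
  using integral_gauss_pair_rotation[of "\<lambda>w. f (fst w)" a "- b" d] assms
  by (simp add: integral_gauss_pair_fst)

lemma abs_exp_minus_one_le: "\<bar>exp h - 1\<bar> \<le> \<bar>h\<bar> * exp \<bar>h\<bar>" for h :: real
proof (cases "0 \<le> h")
  case True
  have "exp h * (1 - h) \<le> exp h * exp (- h)"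
    using exp_ge_add_one_self[of "- h"] by (intro mult_left_mono) auto
  then have "exp h - 1 \<le> h * exp h" by (simp add: algebra_simps flip: exp_add)
  then show ?thesis using True by simp
next
  case False
  have "1 + h \<le> exp h" by (rule exp_ge_add_one_self)
  moreover have "exp h \<le> 1" using False by simp
  ultimately have "\<bar>exp h - 1\<bar> \<le> \<bar>h\<bar> * 1" using False by linarith
  also have "\<dots> \<le> \<bar>h\<bar> * exp \<bar>h\<bar>" by (rule mult_left_mono) auto
  finally show ?thesis .
qed

text \<open>Completing the square; the gap between the two rates absorbs the mixed term.\<close>

lemma shifted_square_bound:
  fixes \<theta> \<eta> n m :: real
  assumes "\<theta> < \<eta>"
  shows "\<theta> * (n + m)\<^sup>2 \<le> (\<theta> * m\<^sup>2 + \<theta>\<^sup>2 * m\<^sup>2 / (\<eta> - \<theta>)) + \<eta> * n\<^sup>2"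
proof -
  have "0 \<le> ((\<eta> - \<theta>) * n - \<theta> * m)\<^sup>2 / (\<eta> - \<theta>)" using assms by simp
  also have "\<dots> = (\<eta> - \<theta>) * n\<^sup>2 - 2 * \<theta> * n * m + \<theta>\<^sup>2 * m\<^sup>2 / (\<eta> - \<theta>)"
  proof -
    have "(k * n - \<theta> * m)\<^sup>2 / k = k * n\<^sup>2 - 2 * \<theta> * n * m + \<theta>\<^sup>2 * m\<^sup>2 / k" if "0 < k" for k :: real
      using that by (simp add: field_simps power2_eq_square)
    then show ?thesis using assms by simp
  qed
  finally show ?thesis by (simp add: algebra_simps power2_sum)
qed

lemma tame_shift:
  assumes f: "tame (sq d) \<rho> f" and \<rho>: "0 \<le> \<rho>"
  shows "tame (sq d) \<rho> (\<lambda>w. f (lin 1 w \<epsilon> v))"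
  unfolding tame_def
proof (intro allI impI)
  fix \<eta> assume \<eta>: "\<rho> < \<eta>"
  define \<theta> where "\<theta> = (\<rho> + \<eta>) / 2"
  have \<theta>: "\<rho> < \<theta>" "0 < \<theta>" "\<theta> < \<eta>" using \<eta> \<rho> by (auto simp: \<theta>_def field_simps)
  obtain K where K: "0 \<le> K" "\<And>w. norm (f w) \<le> K * exp (\<theta> * sq d w)" using tameE[OF f \<theta>(1)] by auto
  define m where "m = \<bar>\<epsilon>\<bar> * norm_d d v"
  define L where "L = \<theta> * m\<^sup>2 + \<theta>\<^sup>2 * m\<^sup>2 / (\<eta> - \<theta>)"
  have "norm (f (lin 1 w \<epsilon> v)) \<le> (K * exp L) * exp (\<eta> * sq d w)" for w
  proof -
    have "norm_d d (lin 1 w \<epsilon> v) \<le> norm_d d w + m"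
      using norm_d_lin_le[of d 1 w \<epsilon> v] by (simp add: m_def)
    then have "sq d (lin 1 w \<epsilon> v) \<le> (norm_d d w + m)\<^sup>2" by (intro power_mono) auto
    then have "\<theta> * sq d (lin 1 w \<epsilon> v) \<le> \<theta> * (norm_d d w + m)\<^sup>2" using \<theta> by (intro mult_left_mono) auto
    also have "\<dots> \<le> L + \<eta> * sq d w" unfolding L_def by (rule shifted_square_bound[OF \<theta>(3)])
    finally have "exp (\<theta> * sq d (lin 1 w \<epsilon> v)) \<le> exp L * exp (\<eta> * sq d w)" by (simp flip: exp_add)
    then show ?thesis using K(2)[of "lin 1 w \<epsilon> v"] mult_left_mono[OF _ K(1)]
      by (metis mult.assoc order_trans)
  qed
  then show "\<exists>K. \<forall>w. norm (f (lin 1 w \<epsilon> v)) \<le> K * exp (\<eta> * sq d w)" by blast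
qed

text \<open>Integration by parts in the direction \<open>v\<close>, with difference quotients in place of derivatives: the
  Cameron-Martin formula moves the shift to the density, whose difference quotients converge to
  \<open>\<langle>v, w\<rangle>\<close>. If \<open>a\<close> is differentiable, the left-hand side converges to the mean of its directional
  derivative; if it is Lipschitz, a bound on the left-hand side bounds the right-hand side.\<close>

lemma gaussian_shift_derivative:
  fixes a :: "(nat \<Rightarrow> real) \<Rightarrow> complex"
  assumes a [measurable]: "a \<in> borel_measurable borel" and tame: "tame (sq d) \<rho> a" and \<rho>0: "0 \<le> \<rho>" and \<rho>: "\<rho> < 1 / 2"
    and v: "\<And>i. d \<le> i \<Longrightarrow> v i = 0"
    and \<epsilon>: "\<epsilon> \<longlonglongrightarrow> 0" "\<And>n. \<epsilon> n \<noteq> 0" "\<And>n. \<bar>\<epsilon> n\<bar> \<le> 1"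
  shows "(\<lambda>n. \<integral>w. (a (lin 1 w (\<epsilon> n) v) - a w) /\<^sub>R \<epsilon> n \<partial>std_gaussian d)
      \<longlonglongrightarrow> (\<integral>w. inner_d d v w *\<^sub>R a w \<partial>std_gaussian d)"
proof -
  \<comment> \<open>Difference quotients of the density of the shifted measure.\<close>
  define e where "e n w = (exp (\<epsilon> n * inner_d d v w - (\<epsilon> n)\<^sup>2 * sq d v / 2) - 1) / \<epsilon> n" for n w
  define b where "b w = \<bar>inner_d d v w\<bar> + sq d v" for w
  have e_bound: "\<bar>e n w\<bar> \<le> b w * exp (b w)" for n w
  proof -
    let ?h = "\<epsilon> n * inner_d d v w - (\<epsilon> n)\<^sup>2 * sq d v / 2"
    have h: "\<bar>?h\<bar> \<le> \<bar>\<epsilon> n\<bar> * b w"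
    proof -
      have "\<bar>?h\<bar> \<le> \<bar>\<epsilon> n * inner_d d v w\<bar> + \<bar>(\<epsilon> n)\<^sup>2 * sq d v / 2\<bar>" by (rule abs_triangle_ineq4)
      also have "\<dots> = \<bar>\<epsilon> n\<bar> * (\<bar>inner_d d v w\<bar> + \<bar>\<epsilon> n\<bar> * (sq d v / 2))"
        by (simp add: abs_mult power2_eq_square algebra_simps)
      also have "\<bar>\<epsilon> n\<bar> * (sq d v / 2) \<le> 1 * sq d v"
        using \<epsilon>(3)[of n] by (intro mult_mono) auto
      finally show ?thesis unfolding b_def by (simp add: mult_left_mono)
    qed
    also have "\<dots> \<le> 1 * b w" using \<epsilon>(3)[of n] by (intro mult_right_mono) (auto simp: b_def)
    finally have h1: "\<bar>?h\<bar> \<le> b w" by simp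
    have "\<bar>e n w\<bar> = \<bar>exp ?h - 1\<bar> / \<bar>\<epsilon> n\<bar>" by (simp add: e_def)
    also have "\<dots> \<le> (\<bar>?h\<bar> * exp \<bar>?h\<bar>) / \<bar>\<epsilon> n\<bar>" by (intro divide_right_mono abs_exp_minus_one_le) auto
    also have "\<dots> \<le> (\<bar>\<epsilon> n\<bar> * b w * exp (b w)) / \<bar>\<epsilon> n\<bar>"
      using h h1 by (intro divide_right_mono mult_mono) (auto simp: b_def)
    also have "\<dots> = b w * exp (b w)" using \<epsilon>(2)[of n] by simp
    finally show ?thesis .
  qed
  have tame_exp_b: "tame (sq d) 0 (\<lambda>w. exp \<bar>b w\<bar>)"
  proof (rule tame_exp_abs_norm)
    show "\<bar>b w\<bar> \<le> norm_d d v * sqrt (sq d w) + sq d v" for w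
      using abs_inner_d_le[of d v w] by (simp add: b_def)
  qed auto
  have e_bound': "\<bar>e n w\<bar> \<le> exp \<bar>b w\<bar> * exp \<bar>b w\<bar>" for n w
  proof -
    have "b w \<le> exp \<bar>b w\<bar>" using exp_ge_add_one_self[of "\<bar>b w\<bar>"] by linarith
    then have "b w * exp (b w) \<le> exp \<bar>b w\<bar> * exp \<bar>b w\<bar>"
      by (intro mult_mono) auto
    with e_bound[of n w] show ?thesis by linarith
  qed
  have tame_e: "tame (sq d) 0 (e n)" for n
    by (rule tame_prod_bound[OF tame_exp_b tame_exp_b]) (use e_bound' in simp)
  have shift: "(\<integral>w. (a (lin 1 w (\<epsilon> n) v) - a w) /\<^sub>R \<epsilon> n \<partial>std_gaussian d) = (\<integral>w. e n w *\<^sub>R a w \<partial>std_gaussian d)" for n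
  proof -
    have lin: "lin 1 w 1 (lin (\<epsilon> n) v 0 v) = lin 1 w (\<epsilon> n) v" for w by (auto simp: lin_def)
    have exps: "exp (inner_d d (lin (\<epsilon> n) v 0 v) w - sq d (lin (\<epsilon> n) v 0 v) / 2) = 1 + \<epsilon> n * e n w" for w
    proof -
      have "inner_d d (lin (\<epsilon> n) v 0 v) w - sq d (lin (\<epsilon> n) v 0 v) / 2 = \<epsilon> n * inner_d d v w - (\<epsilon> n)\<^sup>2 * sq d v / 2"
        unfolding norm_d_power2 by (simp add: inner_d_lin_left inner_d_lin_right power2_eq_square)
      then show ?thesis using \<epsilon>(2)[of n] by (simp add: e_def)
    qed
    have [measurable]: "e n \<in> borel_measurable borel" unfolding e_def by measurable
    have int_a: "integrable (std_gaussian d) a" by (rule integrable_tame[OF tame \<rho>]) measurable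
    have int_ea: "integrable (std_gaussian d) (\<lambda>w. e n w *\<^sub>R a w)"
      by (rule integrable_tame[OF tame_scaleR[OF tame_e tame] \<rho>]) measurable
    have eq: "(\<integral>w. a (lin 1 w (\<epsilon> n) v) \<partial>std_gaussian d) = (\<integral>w. (1 + \<epsilon> n * e n w) *\<^sub>R a w \<partial>std_gaussian d)"
      using integral_std_gaussian_shift[OF a, of d "lin (\<epsilon> n) v 0 v"] v unfolding lin exps by simp
    have int1: "integrable (std_gaussian d) (\<lambda>w. a (lin 1 w (\<epsilon> n) v))"
      by (rule integrable_tame[OF tame_shift[OF tame \<rho>0] \<rho>]) measurable
    have "(\<integral>w. (a (lin 1 w (\<epsilon> n) v) - a w) /\<^sub>R \<epsilon> n \<partial>std_gaussian d)
        = ((\<integral>w. (1 + \<epsilon> n * e n w) *\<^sub>R a w \<partial>std_gaussian d) - (\<integral>w. a w \<partial>std_gaussian d)) /\<^sub>R \<epsilon> n"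
      using int1 int_a by (simp add: eq[symmetric] divideR_right)
    also have "(\<integral>w. (1 + \<epsilon> n * e n w) *\<^sub>R a w \<partial>std_gaussian d)
        = (\<integral>w. a w \<partial>std_gaussian d) + \<epsilon> n *\<^sub>R (\<integral>w. e n w *\<^sub>R a w \<partial>std_gaussian d)"
    proof -
      have "(1 + \<epsilon> n * e n w) *\<^sub>R a w = a w + \<epsilon> n *\<^sub>R (e n w *\<^sub>R a w)" for w
        by (simp add: scaleR_add_left)
      then show ?thesis using int_a int_ea by (simp del: scaleR_scaleR)
    qed
    also have "((\<integral>w. a w \<partial>std_gaussian d) + \<epsilon> n *\<^sub>R (\<integral>w. e n w *\<^sub>R a w \<partial>std_gaussian d) - (\<integral>w. a w \<partial>std_gaussian d)) /\<^sub>R \<epsilon> n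
        = (\<integral>w. e n w *\<^sub>R a w \<partial>std_gaussian d)"
      using \<epsilon>(2)[of n] by (simp only: add_diff_cancel_left' scaleR_scaleR left_inverse scaleR_one not_False_eq_True)
    finally show ?thesis .
  qed
  have "(\<lambda>n. \<integral>w. e n w *\<^sub>R a w \<partial>std_gaussian d) \<longlonglongrightarrow> (\<integral>w. inner_d d v w *\<^sub>R a w \<partial>std_gaussian d)"
  proof (rule integral_dominated_convergence)
    show "integrable (std_gaussian d) (\<lambda>w. (exp \<bar>b w\<bar> * exp \<bar>b w\<bar>) *\<^sub>R norm (a w))"
    proof (rule integrable_tame[OF _ \<rho>])
      show "tame (sq d) \<rho> (\<lambda>w. (exp \<bar>b w\<bar> * exp \<bar>b w\<bar>) *\<^sub>R norm (a w))"
        by (intro tame_scaleR tame_mult_left[OF tame_exp_b tame_exp_b] tame_norm tame)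
      have [measurable]: "b \<in> borel_measurable borel" unfolding b_def by measurable
      show "(\<lambda>w. (exp \<bar>b w\<bar> * exp \<bar>b w\<bar>) *\<^sub>R norm (a w)) \<in> borel_measurable borel" by measurable
    qed
    show "AE w in std_gaussian d. norm (e n w *\<^sub>R a w) \<le> (exp \<bar>b w\<bar> * exp \<bar>b w\<bar>) *\<^sub>R norm (a w)" for n
      using e_bound' by (intro always_eventually allI) (simp add: mult_right_mono del: abs_mult_self_eq)
    have "(\<lambda>n. e n w) \<longlonglongrightarrow> inner_d d v w" for w
    proof -
      have "((\<lambda>x. exp (x * inner_d d v w - x\<^sup>2 * sq d v / 2)) has_field_derivative inner_d d v w) (at 0)"
        by (auto intro!: derivative_eq_intros)
      then have "((\<lambda>h. (exp (h * inner_d d v w - h\<^sup>2 * sq d v / 2) - 1) / h) \<longlongrightarrow> inner_d d v w) (at 0)"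
        by (simp add: has_field_derivative_iff)
      moreover have "filterlim \<epsilon> (at 0) sequentially" using \<epsilon> by (simp add: filterlim_at)
      ultimately show ?thesis unfolding e_def by (rule filterlim_compose)
    qed
    then show "AE w in std_gaussian d. (\<lambda>n. e n w *\<^sub>R a w) \<longlonglongrightarrow> inner_d d v w *\<^sub>R a w"
      by (intro always_eventually allI tendsto_intros)
  qed (auto simp: e_def)
  then show ?thesis unfolding shift .
qed

section \<open>Interpolation between independent Gaussian vectors\<close>

lemma vector_mvt_bound:
  fixes f :: "real \<Rightarrow> 'b::real_normed_vector"
  assumes "convex S" "x \<in> S" "y \<in> S"
    and deriv: "\<And>s. s \<in> S \<Longrightarrow> (f has_vector_derivative f' s) (at s within S)"
    and bound: "\<And>s. s \<in> S \<Longrightarrow> norm (f' s) \<le> B"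
  shows "norm (f x - f y) \<le> B * \<bar>x - y\<bar>"
proof -
  have "norm (f x - f y) \<le> B * norm (x - y)"
  proof (rule differentiable_bound[OF assms(1)])
    show "(f has_derivative (\<lambda>h. h *\<^sub>R f' s)) (at s within S)" if "s \<in> S" for s
      using deriv[OF that] by (simp add: has_vector_derivative_def)
    show "onorm (\<lambda>h. h *\<^sub>R f' s) \<le> B" if "s \<in> S" for s
    proof (rule onorm_le)
      fix h :: real
      show "norm (h *\<^sub>R f' s) \<le> B * norm h"
        using mult_left_mono[OF bound[OF that], of "\<bar>h\<bar>"] by (simp add: mult.commute)
    qed
  qed (use assms in auto)
  then show ?thesis by simp
qed

text \<open>Dominated convergence for the normalized remainders, which the mean value inequality bounds by
  twice the majorant of the derivatives.\<close>

lemma has_vector_derivative_integral: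
  fixes f :: "real \<Rightarrow> 'a \<Rightarrow> 'b::{banach, second_countable_topology}"
  assumes t: "t \<in> {a<..<b}"
    and deriv: "\<And>s w. s \<in> {a<..<b} \<Longrightarrow> ((\<lambda>s. f s w) has_vector_derivative f' s w) (at s)"
    and bound: "\<And>s w. s \<in> {a<..<b} \<Longrightarrow> norm (f' s w) \<le> g w"
    and g: "integrable M g"
    and f: "\<And>s. s \<in> {a<..<b} \<Longrightarrow> integrable M (f s)"
    and f': "f' t \<in> borel_measurable M"
  shows "((\<lambda>s. \<integral>w. f s w \<partial>M) has_vector_derivative (\<integral>w. f' t w \<partial>M)) (at t)"
proof -
  have int_f': "integrable M (f' t)"
    by (rule Bochner_Integration.integrable_bound[OF g f'])
      (intro AE_I2, simp, rule order_trans[OF bound[OF t] abs_ge_self])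
  define e where "e s w = ((f s w - f t w) - (s - t) *\<^sub>R f' t w) /\<^sub>R norm (s - t)" for s w
  have e0: "((\<lambda>s. e s w) \<longlongrightarrow> 0) (at t)" for w
    using deriv[OF t, of w] by (simp add: has_vector_derivative_def has_derivative_def e_def)
  have e_bound: "norm (e s w) \<le> 2 * g w" if s: "s \<in> {a<..<b}" for s w
  proof (cases "s = t")
    case True
    then show ?thesis using order_trans[OF norm_ge_zero bound[OF t, of w]] by (simp add: e_def)
  next
    case False
    have "norm (f s w - f t w) \<le> g w * \<bar>s - t\<bar>"
      by (rule vector_mvt_bound[of "{a<..<b}"])
        (use s t bound deriv in \<open>auto intro: has_vector_derivative_at_within\<close>)
    moreover have "norm ((s - t) *\<^sub>R f' t w) \<le> g w * \<bar>s - t\<bar>"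
      using mult_left_mono[OF bound[OF t, of w], of "\<bar>s - t\<bar>"] by (simp add: mult.commute)
    ultimately have "norm ((f s w - f t w) - (s - t) *\<^sub>R f' t w) \<le> 2 * g w * \<bar>s - t\<bar>"
      using norm_triangle_ineq4[of "f s w - f t w" "(s - t) *\<^sub>R f' t w"] by linarith
    then show ?thesis using False by (simp add: e_def divide_inverse_commute[symmetric] pos_divide_le_eq)
  qed
  have "((\<lambda>s. \<integral>w. e s w \<partial>M) \<longlongrightarrow> (\<integral>w. 0 \<partial>M)) (at t)"
    unfolding tendsto_at_iff_sequentially
  proof (intro allI impI)
    fix X :: "nat \<Rightarrow> real" assume X: "\<forall>i. X i \<in> UNIV - {t}" "X \<longlonglongrightarrow> t"
    have "eventually (\<lambda>i. X i \<in> {a<..<b}) sequentially"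
      using X(2) t by (intro topological_tendstoD) auto
    then obtain N where "\<forall>n\<ge>N. X n \<in> {a<..<b}" unfolding eventually_sequentially ..
    then have N: "X (i + N) \<in> {a<..<b}" for i by simp
    have "(\<lambda>i. \<integral>w. e (X (i + N)) w \<partial>M) \<longlonglongrightarrow> (\<integral>w. 0 \<partial>M)"
    proof (rule integral_dominated_convergence)
      show "integrable M (\<lambda>w. 2 * g w)" using g by simp
      show "AE w in M. norm (e (X (i + N)) w) \<le> 2 * g w" for i using e_bound[OF N] by simp
      show "e (X (i + N)) \<in> borel_measurable M" for i
        using f[OF N, of i] f[OF t] f' unfolding e_def by measurable
      have "filterlim (\<lambda>i. X (i + N)) (at t) sequentially"
        using LIMSEQ_ignore_initial_segment[OF X(2)] X(1) by (simp add: filterlim_at)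
      then show "AE w in M. (\<lambda>i. e (X (i + N)) w) \<longlonglongrightarrow> 0"
        using filterlim_compose[OF e0] by (intro always_eventually allI)
    qed simp
    then show "((\<lambda>s. \<integral>w. e s w \<partial>M) \<circ> X) \<longlonglongrightarrow> (\<integral>w. 0 \<partial>M)"
      by (simp add: o_def) (rule LIMSEQ_offset)
  qed
  moreover have "eventually (\<lambda>s. (\<integral>w. e s w \<partial>M)
      = (((\<integral>w. f s w \<partial>M) - (\<integral>w. f t w \<partial>M)) - (s - t) *\<^sub>R (\<integral>w. f' t w \<partial>M)) /\<^sub>R norm (s - t)) (at t)"
  proof -
    have "eventually (\<lambda>s. s \<in> {a<..<b}) (at t)"
      using t by (intro eventually_at_in_open') auto
    then show ?thesis
      by eventually_elim (simp add: e_def f f[OF t] int_f')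
  qed
  ultimately have "((\<lambda>s. (((\<integral>w. f s w \<partial>M) - (\<integral>w. f t w \<partial>M)) - (s - t) *\<^sub>R (\<integral>w. f' t w \<partial>M)) /\<^sub>R norm (s - t)) \<longlongrightarrow> 0) (at t)"
    by (simp add: tendsto_cong)
  then show ?thesis
    by (simp add: has_vector_derivative_def has_derivative_def bounded_linear_scaleR_left)
qed

lemma has_vector_derivative_quotient_sequence:
  assumes "(f has_vector_derivative D) (at t)" "\<epsilon> \<longlonglongrightarrow> 0" "\<And>n. \<epsilon> n \<noteq> 0"
  shows "(\<lambda>n. (f (t + \<epsilon> n) - f t) /\<^sub>R \<epsilon> n) \<longlonglongrightarrow> D"
proof (rule LIM_zero_cancel, rule tendsto_norm_zero_cancel)
  have "(\<lambda>h. norm (f (t + h) - f t - h *\<^sub>R D) / norm h) \<midarrow>0\<rightarrow> 0"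
    using assms(1) by (simp add: has_vector_derivative_def has_derivative_at)
  moreover have "filterlim \<epsilon> (at 0) sequentially" using assms by (simp add: filterlim_at)
  ultimately have "(\<lambda>n. norm (f (t + \<epsilon> n) - f t - \<epsilon> n *\<^sub>R D) / norm (\<epsilon> n)) \<longlonglongrightarrow> 0"
    by (rule filterlim_compose)
  moreover have "norm (f (t + \<epsilon> n) - f t - \<epsilon> n *\<^sub>R D) / norm (\<epsilon> n) = norm ((f (t + \<epsilon> n) - f t) /\<^sub>R \<epsilon> n - D)" for n
  proof -
    have "(f (t + \<epsilon> n) - f t) /\<^sub>R \<epsilon> n - D = (f (t + \<epsilon> n) - f t - \<epsilon> n *\<^sub>R D) /\<^sub>R \<epsilon> n"
      using assms(3)[of n] by (simp add: scaleR_diff_right)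
    then show ?thesis by (simp add: divide_inverse_commute)
  qed
  ultimately show "(\<lambda>n. norm ((f (t + \<epsilon> n) - f t) /\<^sub>R \<epsilon> n - D)) \<longlonglongrightarrow> 0" by simp
qed

text \<open>A continuously differentiable function of the value \<open>F x\<close>. The growth bound concerns the half-line
  where \<open>F\<close> takes its values. The two instances are the identity and \<open>exp (z t)\<close>; they produce the
  variance, the transform, and their covariance from one interpolation formula.\<close>

definition profile :: "real \<Rightarrow> (real \<Rightarrow> complex) \<Rightarrow> (real \<Rightarrow> complex) \<Rightarrow> bool" where
  "profile r \<phi> \<phi>' \<longleftrightarrow> 0 \<le> r \<and> (\<forall>t. (\<phi> has_vector_derivative \<phi>' t) (at t)) \<and>
     continuous_on UNIV \<phi>' \<and> (\<exists>K\<ge>0. \<forall>t\<ge>0. norm (\<phi>' t) \<le> K * exp (r * t))"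

lemma profile_of_real: "profile 0 of_real (\<lambda>_. 1)"
  unfolding profile_def
  by (auto intro!: exI[of _ 1] has_vector_derivative_of_real derivative_eq_intros)

lemma profile_exp:
  assumes "Re z \<le> r" "0 \<le> r"
  shows "profile r (\<lambda>t. exp (z * of_real t)) (\<lambda>t. z * exp (z * of_real t))"
  unfolding profile_def
proof (intro conjI allI exI[of _ "norm z"] impI)
  fix t
  have "((\<lambda>w. exp (z * w)) has_field_derivative z * exp (z * of_real t)) (at (of_real t))"
    by (auto intro!: derivative_eq_intros)
  then show "((\<lambda>t. exp (z * of_real t)) has_vector_derivative z * exp (z * of_real t)) (at t)"
    by (rule has_vector_derivative_real_field)
next
  fix t :: real assume "0 \<le> t"
  then show "norm (z * exp (z * of_real t)) \<le> norm z * exp (r * t)"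
    using assms by (simp add: norm_mult mult_left_mono mult_right_mono)
qed (use assms in \<open>auto intro!: continuous_intros\<close>)

lemma profile_measurable:
  assumes "profile r \<phi> \<phi>'"
  shows "\<phi> \<in> borel_measurable borel" "\<phi>' \<in> borel_measurable borel"
proof -
  have "continuous_on UNIV \<phi>"
    using assms by (auto simp: profile_def continuous_on_eq_continuous_at intro: has_vector_derivative_continuous)
  then show "\<phi> \<in> borel_measurable borel" by (rule borel_measurable_continuous_onI)
  show "\<phi>' \<in> borel_measurable borel"
    using assms by (intro borel_measurable_continuous_onI) (auto simp: profile_def)
qed

text \<open>The last property is the mean value inequality on \<open>[0, m]\<close>.\<close>

lemma profileE:
  assumes "profile r \<phi> \<phi>'"
  obtains K where "0 \<le> K" "\<And>t. 0 \<le> t \<Longrightarrow> norm (\<phi>' t) \<le> K * exp (r * t)"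
    "\<And>s t m. 0 \<le> s \<Longrightarrow> 0 \<le> t \<Longrightarrow> s \<le> m \<Longrightarrow> t \<le> m \<Longrightarrow> norm (\<phi> s - \<phi> t) \<le> K * exp (r * m) * \<bar>s - t\<bar>"
proof -
  obtain K where K: "0 \<le> K" "\<And>t. 0 \<le> t \<Longrightarrow> norm (\<phi>' t) \<le> K * exp (r * t)" and r: "0 \<le> r"
    and deriv: "\<And>t. (\<phi> has_vector_derivative \<phi>' t) (at t)"
    using assms by (auto simp: profile_def)
  have "norm (\<phi> s - \<phi> t) \<le> K * exp (r * m) * \<bar>s - t\<bar>" if "0 \<le> s" "0 \<le> t" "s \<le> m" "t \<le> m" for s t m
  proof (rule vector_mvt_bound[of "{0..m}"])
    fix x assume x: "x \<in> {0..m}"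
    show "(\<phi> has_vector_derivative \<phi>' x) (at x within {0..m})"
      by (rule has_vector_derivative_at_within[OF deriv])
    have "K * exp (r * x) \<le> K * exp (r * m)" using x K(1) r by (intro mult_left_mono) (auto intro: mult_left_mono)
    then show "norm (\<phi>' x) \<le> K * exp (r * m)" using K(2)[of x] x by auto
  qed (use that in auto)
  with K that show ?thesis by blast
qed

context convex_cone
begin

lemma borel_measurable_F [measurable]: "F \<in> borel_measurable borel"
  unfolding F_def by measurable

lemma tame_norm_P: "tame (sq d) 0 (\<lambda>x. norm_d d (P x))"
  by (rule tame_sqrt) (use F_le in \<open>simp add: F_def\<close>)

lemma tame_F: "tame (sq d) 0 F"
  by (rule tame_linear[of 1]) (use F_le in \<open>auto simp: add_increasing\<close>)

lemma tame_profile':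
  assumes "profile r \<phi> \<phi>'" shows "tame (sq d) r (\<lambda>x. \<phi>' (F x))"
proof -
  obtain K where K: "0 \<le> K" "\<And>t. 0 \<le> t \<Longrightarrow> norm (\<phi>' t) \<le> K * exp (r * t)" using assms by (rule profileE) auto
  have r: "0 \<le> r" using assms by (simp add: profile_def)
  have "tame (sq d) r (\<lambda>x. exp (r * sq d x))" by (rule tame_exp) auto
  then have "tame (sq d) r (\<lambda>x. K * exp (r * sq d x))" by (intro tame_mult_left tame_const) auto
  then show ?thesis
  proof (rule tame_bound)
    fix w
    have "norm (\<phi>' (F w)) \<le> K * exp (r * F w)" by (rule K) simp
    also have "\<dots> \<le> K * exp (r * sq d w)" using K(1) r F_le[of w] by (intro mult_left_mono) (auto intro: mult_left_mono)
    finally show "norm (\<phi>' (F w)) \<le> norm (K * exp (r * sq d w))" using K(1) by simp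
  qed
qed

lemma tame_profile:
  assumes "profile r \<phi> \<phi>'" shows "tame (sq d) r (\<lambda>x. \<phi> (F x))"
proof -
  obtain K where K: "0 \<le> K" "\<And>s t m. 0 \<le> s \<Longrightarrow> 0 \<le> t \<Longrightarrow> s \<le> m \<Longrightarrow> t \<le> m \<Longrightarrow> norm (\<phi> s - \<phi> t) \<le> K * exp (r * m) * \<bar>s - t\<bar>"
    using assms by (rule profileE) auto
  have r: "0 \<le> r" using assms by (simp add: profile_def)
  have "tame (sq d) r (\<lambda>x. exp (r * sq d x))" by (rule tame_exp) auto
  then have "tame (sq d) r (\<lambda>x. (norm (\<phi> 0) + K * F x) * exp (r * sq d x))"
    by (intro tame_mult_left tame_add tame_const tame_F) auto
  then show ?thesis
  proof (rule tame_bound)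
    fix w
    have e: "exp (r * F w) \<le> exp (r * sq d w)" using r F_le[of w] by (auto intro: mult_left_mono)
    have 1: "1 \<le> exp (r * sq d w)" using r by simp
    have "norm (\<phi> (F w) - \<phi> 0) \<le> K * exp (r * F w) * \<bar>F w - 0\<bar>" by (rule K) auto
    then have "norm (\<phi> (F w) - \<phi> 0) \<le> K * exp (r * F w) * F w" by simp
    moreover have "K * exp (r * F w) * F w \<le> K * exp (r * sq d w) * F w"
      by (intro mult_right_mono mult_left_mono e K(1)) simp
    moreover have "norm (\<phi> 0) * 1 \<le> norm (\<phi> 0) * exp (r * sq d w)" by (intro mult_left_mono 1) simp
    moreover have "norm (\<phi> (F w)) \<le> norm (\<phi> 0) + norm (\<phi> (F w) - \<phi> 0)" by norm
    ultimately have "norm (\<phi> (F w)) \<le> (norm (\<phi> 0) + K * F w) * exp (r * sq d w)"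
      by (simp add: algebra_simps)
    then show "norm (\<phi> (F w)) \<le> norm ((norm (\<phi> 0) + K * F w) * exp (r * sq d w))" using K(1) by simp
  qed
qed

text \<open>The two tangent inequalities squeeze the remainder of \<open>F\<close> below a function with a double zero.\<close>

lemma F_along_curve:
  assumes \<gamma>: "\<And>i. i < d \<Longrightarrow> ((\<lambda>s. \<gamma> s i) has_real_derivative \<gamma>' i) (at t)"
  shows "((\<lambda>s. F (\<gamma> s)) has_real_derivative 2 * inner_d d (P (\<gamma> t)) \<gamma>') (at t)"
proof -
  define R where "R s = F (\<gamma> s) - F (\<gamma> t) - 2 * inner_d d (P (\<gamma> t)) (lin 1 (\<gamma> s) (-1) (\<gamma> t))" for s
  define q where "q s = 2 * inner_d d (lin 1 (\<gamma> s) (-1) (\<gamma> t)) (lin 1 (\<gamma> s) (-1) (\<gamma> t))" for s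
  have "(q has_real_derivative 0) (at t)"
    unfolding q_def inner_d_def by (auto intro!: derivative_eq_intros \<gamma>)
  moreover have [simp]: "q t = 0" by (simp add: q_def inner_d_def)
  ultimately have q: "((\<lambda>h. q (t + h) / h) \<longlongrightarrow> 0) (at 0)" by (simp add: DERIV_def)
  have [simp]: "R t = 0" by (simp add: R_def inner_d_def)
  have R: "norm (R s) \<le> norm (q s)" for s
    using F_above_tangent[of "\<gamma> t" "\<gamma> s"] F_below_tangent[of "\<gamma> s" "\<gamma> t"]
    unfolding R_def q_def norm_d_power2 by simp
  have "((\<lambda>h. R (t + h) / h) \<longlongrightarrow> 0) (at 0)"
  proof (rule Lim_null_comparison)
    show "\<forall>\<^sub>F h in at 0. norm (R (t + h) / h) \<le> norm (q (t + h) / h)"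
      using R by (intro always_eventually allI) (simp add: divide_right_mono)
    show "((\<lambda>h. norm (q (t + h) / h)) \<longlongrightarrow> 0) (at 0)" using tendsto_norm[OF q] by simp
  qed
  then have R': "(R has_real_derivative 0) (at t)" by (simp add: DERIV_def)
  have "((\<lambda>s. F (\<gamma> t) + 2 * inner_d d (P (\<gamma> t)) (lin 1 (\<gamma> s) (-1) (\<gamma> t)) + R s) has_real_derivative
      0 + 2 * inner_d d (P (\<gamma> t)) \<gamma>' + 0) (at t)"
    by (intro DERIV_add R' DERIV_const) (auto simp: inner_d_def mult.commute[of _ "P _ _"] intro!: derivative_eq_intros \<gamma>)
  then show ?thesis by (simp add: R_def)
qed

text \<open>Differentiation of \<open>E A(g) \<phi>(F(g\<^sub>\<theta>))\<close> under the integral sign; the derivative of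
  \<open>g\<^sub>\<theta> = cos \<theta> g + sin \<theta> y\<close> is \<open>- sin \<theta> g + cos \<theta> y\<close>.\<close>

lemma interpolation_derivative:
  assumes A [measurable]: "A \<in> borel_measurable borel" and tame: "tame (sq d) \<rho> A"
    and \<phi>: "profile r \<phi> \<phi>'" and \<rho>: "0 \<le> \<rho>" "\<rho> + r < 1 / 2"
  shows "((\<lambda>\<theta>. \<integral>w. A (fst w) * \<phi> (F (lin (cos \<theta>) (fst w) (sin \<theta>) (snd w))) \<partial>gauss_pair d)
      has_vector_derivative
      (\<integral>w. A (fst w) * (2 * inner_d d (P (lin (cos \<theta>) (fst w) (sin \<theta>) (snd w))) (lin (- sin \<theta>) (fst w) (cos \<theta>) (snd w)))
         *\<^sub>R \<phi>' (F (lin (cos \<theta>) (fst w) (sin \<theta>) (snd w))) \<partial>gauss_pair d)) (at \<theta>)"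
proof -
  note [measurable] = profile_measurable[OF \<phi>]
  let ?g = "\<lambda>\<theta> w. lin (cos \<theta>) (fst w) (sin \<theta>) (snd w)"
  let ?g' = "\<lambda>\<theta> w. lin (- sin \<theta>) (fst w) (cos \<theta>) (snd w)"
  obtain K where K: "0 \<le> K" "\<And>t. 0 \<le> t \<Longrightarrow> norm (\<phi>' t) \<le> K * exp (r * t)" using \<phi> by (rule profileE) auto
  have r: "0 \<le> r" and \<phi>_deriv: "\<And>t. (\<phi> has_vector_derivative \<phi>' t) (at t)" using \<phi> by (auto simp: profile_def)
  have gs: "sq d (?g s w) \<le> sq2 d w" "sq d (?g' s w) \<le> sq2 d w" for s w
    by (auto intro!: norm_d_rotation)
  show ?thesis
  proof (rule has_vector_derivative_integral[where a = "\<theta> - 1" and b = "\<theta> + 1"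
        and g = "\<lambda>w. norm (A (fst w)) * (2 * sq2 d w * (K * exp (r * sq2 d w)))"])
    fix s w
    have "((\<lambda>s. F (?g s w)) has_real_derivative 2 * inner_d d (P (?g s w)) (?g' s w)) (at s)"
      by (rule F_along_curve) (auto intro!: derivative_eq_intros)
    then have "((\<lambda>s. F (?g s w)) has_vector_derivative 2 * inner_d d (P (?g s w)) (?g' s w)) (at s)"
      by (simp add: has_real_derivative_iff_has_vector_derivative)
    from has_vector_derivative_mult_right[OF vector_diff_chain_at[OF this \<phi>_deriv], of "A (fst w)"]
    show "((\<lambda>s. A (fst w) * \<phi> (F (?g s w))) has_vector_derivative
       A (fst w) * (2 * inner_d d (P (?g s w)) (?g' s w)) *\<^sub>R \<phi>' (F (?g s w))) (at s)"
      by (simp add: o_def)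
    have "\<bar>inner_d d (P (?g s w)) (?g' s w)\<bar> \<le> norm_d d (?g s w) * norm_d d (?g' s w)"
      by (rule order_trans[OF abs_inner_d_le] mult_right_mono P_norm_le norm_d_nonneg)+
    also have "\<dots> \<le> sqrt (sq2 d w) * sqrt (sq2 d w)"
      using gs by (intro mult_mono real_le_rsqrt) auto
    finally have i: "\<bar>inner_d d (P (?g s w)) (?g' s w)\<bar> \<le> sq2 d w" by simp
    have "norm (\<phi>' (F (?g s w))) \<le> K * exp (r * F (?g s w))" by (rule K) simp
    also have "\<dots> \<le> K * exp (r * sq2 d w)"
      using r K(1) order_trans[OF F_le gs(1)] by (intro mult_left_mono) (auto intro: mult_left_mono)
    finally have e: "norm (\<phi>' (F (?g s w))) \<le> K * exp (r * sq2 d w)" .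
    show "norm (A (fst w) * (2 * inner_d d (P (?g s w)) (?g' s w)) *\<^sub>R \<phi>' (F (?g s w)))
      \<le> norm (A (fst w)) * (2 * sq2 d w * (K * exp (r * sq2 d w)))"
      unfolding norm_mult norm_scaleR using i e K(1)
      by (intro mult_left_mono mult_mono) (auto simp: abs_mult)
  next
    have "tame (sq2 d) r (\<lambda>w. exp (r * sq2 d w))" by (rule tame_exp) auto
    then have "tame (sq2 d) r (\<lambda>w. 2 * sq2 d w * (K * exp (r * sq2 d w)))"
      by (intro tame_mult_left tame_const tame_linear[of 1]) auto
    then have "tame (sq2 d) (\<rho> + r) (\<lambda>w. norm (A (fst w)) * (2 * sq2 d w * (K * exp (r * sq2 d w))))"
      by (rule tame_prod_bound_add[OF tame_fst[OF tame \<rho>(1)]]) (simp add: abs_mult)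
    then show "integrable (gauss_pair d) (\<lambda>w. norm (A (fst w)) * (2 * sq2 d w * (K * exp (r * sq2 d w))))"
      using \<rho>(2) by (rule integrable_tame2) measurable
  next
    fix s
    have "tame (sq2 d) r (\<lambda>w. \<phi> (F (?g s w)))"
      by (rule tame_lin[OF tame_profile[OF \<phi>] r]) simp
    then have "tame (sq2 d) (\<rho> + r) (\<lambda>w. A (fst w) * \<phi> (F (?g s w)))"
      by (rule tame_prod_bound_add[OF tame_fst[OF tame \<rho>(1)]]) (simp add: norm_mult)
    then show "integrable (gauss_pair d) (\<lambda>w. A (fst w) * \<phi> (F (?g s w)))"
      using \<rho>(2) by (rule integrable_tame2) measurable
  qed (simp, measurable)
qed

end

section \<open>Gaussian integration by parts along the interpolation\<close>

lemma tame_exp_shifted_square: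
  "tame (sq d) r (\<lambda>w. exp (r * (norm_d d w + m)\<^sup>2))"
  unfolding tame_def
proof (intro allI impI)
  fix \<eta> assume "r < \<eta>"
  then have "norm (exp (r * (norm_d d w + m)\<^sup>2)) \<le> exp (r * m\<^sup>2 + r\<^sup>2 * m\<^sup>2 / (\<eta> - r)) * exp (\<eta> * sq d w)" for w
    using shifted_square_bound[of r \<eta> "norm_d d w" m] by (simp flip: exp_add)
  then show "\<exists>K. \<forall>w. norm (exp (r * (norm_d d w + m)\<^sup>2)) \<le> K * exp (\<eta> * sq d w)" by blast
qed

lemma lin_lin_rotation:
  assumes "c\<^sup>2 + s\<^sup>2 = 1" shows "lin c (lin c x s y) (- s) (lin (- s) x c y) = x"
proof
  fix i
  have "lin c (lin c x s y) (- s) (lin (- s) x c y) i = (c\<^sup>2 + s\<^sup>2) * x i"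
    by (simp add: algebra_simps power2_eq_square)
  then show "lin c (lin c x s y) (- s) (lin (- s) x c y) i = x i" by (simp add: assms)
qed

lemma lin_shift: "lin c u (- s) (lin 1 w e v) = lin 1 (lin c u (- s) w) (- s * e) v"
  by (auto simp: lin_def algebra_simps)

context convex_cone
begin

text \<open>The vectors \<open>g\<^sub>\<theta>\<close> and its derivative are again independent standard Gaussians. In these coordinates
  \<open>(u, w)\<close> the original vector is \<open>cos \<theta> u - sin \<theta> w\<close>, and the derivative of the interpolation becomes
  the mean over \<open>u\<close> of \<open>2 \<phi>'(F u)\<close> times this inner mean over \<open>w\<close>, which has the form treated by
  Gaussian integration by parts.\<close>

definition J :: "((nat \<Rightarrow> real) \<Rightarrow> complex) \<Rightarrow> real \<Rightarrow> real \<Rightarrow> (nat \<Rightarrow> real) \<Rightarrow> complex" where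
  "J A c s u = (\<integral>w. inner_d d (P u) w *\<^sub>R A (lin c u (- s) w) \<partial>std_gaussian d)"

lemma interpolation_derivative_J:
  assumes A [measurable]: "A \<in> borel_measurable borel" and tame: "tame (sq d) \<rho> A"
    and \<phi>: "profile r \<phi> \<phi>'" and \<rho>: "0 \<le> \<rho>" "\<rho> + r < 1 / 2" and cos: "cos \<theta> \<noteq> 0"
  shows "integrable (std_gaussian d) (\<lambda>u. 2 * \<phi>' (F u) * J A (cos \<theta>) (sin \<theta>) u)"
    "((\<lambda>\<theta>. \<integral>w. A (fst w) * \<phi> (F (lin (cos \<theta>) (fst w) (sin \<theta>) (snd w))) \<partial>gauss_pair d)
      has_vector_derivative (\<integral>u. 2 * \<phi>' (F u) * J A (cos \<theta>) (sin \<theta>) u \<partial>std_gaussian d)) (at \<theta>)"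
proof -
  note [measurable] = profile_measurable[OF \<phi>]
  define c s where "c = cos \<theta>" and "s = sin \<theta>"
  have cs: "c\<^sup>2 + (- s)\<^sup>2 = 1" "c\<^sup>2 + s\<^sup>2 = 1" "c \<noteq> 0" using cos by (auto simp: c_def s_def)
  define \<Phi> where "\<Phi> w = A (lin c (fst w) (- s) (snd w)) * (2 * inner_d d (P (fst w)) (snd w)) *\<^sub>R \<phi>' (F (fst w))" for w
  have [measurable]: "\<Phi> \<in> borel_measurable (borel \<Otimes>\<^sub>M borel)" unfolding \<Phi>_def by measurable
  have r: "0 \<le> r" using \<phi> by (simp add: profile_def)
  have "tame (sq2 d) (\<rho> + r) \<Phi>"
  proof (rule tame_prod_bound_add)
    show "tame (sq2 d) \<rho> (\<lambda>w. A (lin c (fst w) (- s) (snd w)))" by (rule tame_lin[OF tame \<rho>(1) cs(1)])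
    show "tame (sq2 d) r (\<lambda>w. (2 * inner_d d (P (fst w)) (snd w)) *\<^sub>R \<phi>' (F (fst w)))"
      by (intro tame_scaleR tame_mult_left tame_const tame_inner_d tame_fst[OF tame_norm_P]
          tame_snd[OF tame_norm_d] tame_fst[OF tame_profile'[OF \<phi>]] r) auto
  qed (simp add: \<Phi>_def norm_mult)
  then have int: "integrable (gauss_pair d) \<Phi>" using \<rho>(2) by (rule integrable_tame2) measurable
  have inner: "(\<integral>w. \<Phi> (u, w) \<partial>std_gaussian d) = 2 * \<phi>' (F u) * J A c s u" for u
  proof -
    have "(\<integral>w. \<Phi> (u, w) \<partial>std_gaussian d)
        = (\<integral>w. (2 * \<phi>' (F u)) * (inner_d d (P u) w *\<^sub>R A (lin c u (- s) w)) \<partial>std_gaussian d)"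
      by (rule Bochner_Integration.integral_cong) (simp_all add: \<Phi>_def scaleR_conv_of_real mult_ac)
    also have "\<dots> = 2 * \<phi>' (F u) * J A c s u" unfolding J_def by (rule integral_mult_right_zero)
    finally show ?thesis .
  qed
  show "integrable (std_gaussian d) (\<lambda>u. 2 * \<phi>' (F u) * J A (cos \<theta>) (sin \<theta>) u)"
    using gauss2.integrable_fst'[OF int] by (simp only: inner flip: c_def s_def)
  have "(\<integral>w. \<Phi> w \<partial>gauss_pair d)
      = (\<integral>w. \<Phi> (lin c (fst w) (- (- s)) (snd w), lin (- s) (fst w) c (snd w)) \<partial>gauss_pair d)"
    by (rule integral_gauss_pair_rotation[symmetric, OF _ cs(1,3)]) measurable
  also have "\<dots> = (\<integral>w. A (fst w) * (2 * inner_d d (P (lin c (fst w) s (snd w))) (lin (- s) (fst w) c (snd w)))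
         *\<^sub>R \<phi>' (F (lin c (fst w) s (snd w))) \<partial>gauss_pair d)"
    unfolding \<Phi>_def fst_conv snd_conv minus_minus lin_lin_rotation[OF cs(2)] ..
  finally have rot: "(\<integral>w. A (fst w) * (2 * inner_d d (P (lin c (fst w) s (snd w))) (lin (- s) (fst w) c (snd w)))
         *\<^sub>R \<phi>' (F (lin c (fst w) s (snd w))) \<partial>gauss_pair d) = (\<integral>u. 2 * \<phi>' (F u) * J A c s u \<partial>std_gaussian d)"
    by (simp flip: inner add: gauss2.integral_fst'[OF int])
  show "((\<lambda>\<theta>. \<integral>w. A (fst w) * \<phi> (F (lin (cos \<theta>) (fst w) (sin \<theta>) (snd w))) \<partial>gauss_pair d)
      has_vector_derivative (\<integral>u. 2 * \<phi>' (F u) * J A (cos \<theta>) (sin \<theta>) u \<partial>std_gaussian d)) (at \<theta>)"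
    using interpolation_derivative[OF A tame \<phi> \<rho>, of \<theta>] unfolding c_def[symmetric] s_def[symmetric] rot .
qed

lemma F_shift_le: "F (lin 1 x h v) \<le> (norm_d d x + \<bar>h\<bar> * norm_d d v)\<^sup>2"
  using norm_d_lin_le[of d 1 x h v] by (intro order_trans[OF F_le] power_mono) auto

lemma F_shift_diff: "\<bar>F (lin 1 x h v) - F x\<bar> \<le> 2 * \<bar>h\<bar> * norm_d d v * (norm_d d x + \<bar>h\<bar> * norm_d d v)"
proof -
  have eq: "lin 1 (lin 1 x h v) (-1) x = lin h v 0 v" by (auto simp: lin_def)
  have n: "norm_d d (lin h v 0 v) \<le> \<bar>h\<bar> * norm_d d v" using norm_d_lin_le[of d h v 0 v] by simp
  have "\<bar>inner_d d (P x) (lin h v 0 v)\<bar> \<le> norm_d d x * (\<bar>h\<bar> * norm_d d v)"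
    by (rule order_trans[OF abs_inner_d_le]) (intro mult_mono P_norm_le n; simp)
  moreover have "(norm_d d (lin h v 0 v))\<^sup>2 \<le> (\<bar>h\<bar> * norm_d d v)\<^sup>2" by (intro power_mono n) simp
  ultimately show ?thesis
    using F_above_tangent[of x "lin 1 x h v"] F_below_tangent[of "lin 1 x h v" x]
    unfolding eq by (simp add: algebra_simps power2_eq_square abs_le_iff)
qed

text \<open>Integration by parts in \<open>w\<close> in the direction \<open>P u\<close>. Both sides are limits of the same difference
  quotients: one through the shifted density, the other through the gradient \<open>2 P\<close> of \<open>F\<close>.\<close>

lemma J_profile:
  assumes \<alpha>: "profile r \<alpha> \<alpha>'" and r: "r < 1 / 2" and cs: "c\<^sup>2 + s\<^sup>2 = 1"
  shows "J (\<lambda>x. \<alpha> (F x)) c s u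
    = (\<integral>w. (- (2 * s) * inner_d d (P u) (P (lin c u (- s) w))) *\<^sub>R \<alpha>' (F (lin c u (- s) w)) \<partial>std_gaussian d)"
proof -
  note [measurable] = profile_measurable[OF \<alpha>]
  obtain K where K: "0 \<le> K" "\<And>s t m. 0 \<le> s \<Longrightarrow> 0 \<le> t \<Longrightarrow> s \<le> m \<Longrightarrow> t \<le> m \<Longrightarrow> norm (\<alpha> s - \<alpha> t) \<le> K * exp (r * m) * \<bar>s - t\<bar>"
    using \<alpha> by (rule profileE) auto
  have r0: "0 \<le> r" and \<alpha>_deriv: "\<And>t. (\<alpha> has_vector_derivative \<alpha>' t) (at t)" using \<alpha> by (auto simp: profile_def)
  have cs': "c\<^sup>2 + (- s)\<^sup>2 = 1" using cs by simp
  have c1: "\<bar>c\<bar> \<le> 1" and s1: "\<bar>s\<bar> \<le> 1"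
  proof -
    have "c\<^sup>2 \<le> 1" "s\<^sup>2 \<le> 1" using cs zero_le_power2[of c] zero_le_power2[of s] by linarith+
    then show "\<bar>c\<bar> \<le> 1" "\<bar>s\<bar> \<le> 1" by (simp_all add: abs_square_le_1)
  qed
  let ?X = "\<lambda>w. lin c u (- s) w"
  let ?v = "P u"
  define a where "a w = \<alpha> (F (?X w))" for w
  define \<epsilon> :: "nat \<Rightarrow> real" where "\<epsilon> n = 1 / real (Suc n)" for n
  have \<epsilon>: "\<epsilon> \<longlonglongrightarrow> 0" "\<And>n. \<epsilon> n \<noteq> 0" "\<And>n. \<bar>\<epsilon> n\<bar> \<le> 1"
    unfolding \<epsilon>_def using LIMSEQ_Suc[OF lim_1_over_n[where 'a = real]] by (auto simp: field_simps)
  define m where "m = norm_d d u + norm_d d ?v"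
  have m: "0 \<le> m" by (simp add: m_def)
  have X_le: "norm_d d (?X w) + norm_d d ?v \<le> norm_d d w + m" for w
  proof -
    have "norm_d d (?X w) \<le> \<bar>c\<bar> * norm_d d u + \<bar>s\<bar> * norm_d d w" using norm_d_lin_le[of d c u "- s" w] by simp
    also have "\<dots> \<le> 1 * norm_d d u + 1 * norm_d d w" by (intro add_mono mult_right_mono c1 s1) auto
    finally show ?thesis by (simp add: m_def)
  qed
  have "tame (sq2 d) r (\<lambda>w. \<alpha> (F (lin c (fst w) (- s) (snd w))))"
    by (rule tame_lin[OF tame_profile[OF \<alpha>] r0 cs'])
  from tame_section[OF this, of u] have tame_a: "tame (sq d) r a" by (simp add: a_def[abs_def])
  have [measurable]: "a \<in> borel_measurable borel" unfolding a_def by measurable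
  have lim1: "(\<lambda>n. \<integral>w. (a (lin 1 w (\<epsilon> n) ?v) - a w) /\<^sub>R \<epsilon> n \<partial>std_gaussian d) \<longlonglongrightarrow> J (\<lambda>x. \<alpha> (F x)) c s u"
    unfolding J_def using gaussian_shift_derivative[OF _ tame_a r0 r P_beyond \<epsilon>] by (simp add: a_def)
  \<comment> \<open>Majorant of the difference quotients, from the mean value inequality for \<open>\<alpha>\<close> and the tangent inequalities for \<open>F\<close>.\<close>
  define G where "G w = K * exp (r * (norm_d d w + m)\<^sup>2) * (2 * (norm_d d w + m)\<^sup>2)" for w
  have lim2: "(\<lambda>n. \<integral>w. (a (lin 1 w (\<epsilon> n) ?v) - a w) /\<^sub>R \<epsilon> n \<partial>std_gaussian d)
     \<longlonglongrightarrow> (\<integral>w. (- (2 * s) * inner_d d ?v (P (?X w))) *\<^sub>R \<alpha>' (F (?X w)) \<partial>std_gaussian d)"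
  proof (rule integral_dominated_convergence[where w = G])
    have "tame (sq d) 0 (\<lambda>w. 2 * ((norm_d d w + m) * (norm_d d w + m)))"
      by (intro tame_mult_left tame_const tame_add tame_norm_d) auto
    then have "tame (sq d) 0 (\<lambda>w. 2 * (norm_d d w + m)\<^sup>2)"
      by (simp only: power2_eq_square[of "norm_d d _ + m"])
    from tame_mult_right[OF tame_mult_left[OF _ tame_exp_shifted_square] this]
    have "tame (sq d) r G" unfolding G_def[abs_def] by (simp add: tame_const)
    then show "integrable (std_gaussian d) G"
      using r by (rule integrable_tame) (unfold G_def, measurable)
    show "AE w in std_gaussian d. norm ((a (lin 1 w (\<epsilon> n) ?v) - a w) /\<^sub>R \<epsilon> n) \<le> G w" for n
    proof (rule AE_I2)
      fix w
      let ?x = "?X w" and ?h = "- s * \<epsilon> n" and ?N = "norm_d d w + m"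
      have h: "\<bar>?h\<bar> \<le> \<bar>\<epsilon> n\<bar>" "\<bar>?h\<bar> \<le> 1"
      proof -
        show "\<bar>?h\<bar> \<le> \<bar>\<epsilon> n\<bar>" using mult_right_mono[OF s1, of "\<bar>\<epsilon> n\<bar>"] by (simp add: abs_mult)
        then show "\<bar>?h\<bar> \<le> 1" using \<epsilon>(3)[of n] by simp
      qed
      have xh: "norm_d d ?x + \<bar>?h\<bar> * norm_d d ?v \<le> ?N"
        using mult_right_mono[OF h(2) norm_d_nonneg[of d ?v]] X_le[of w] by simp
      have F1: "F (lin 1 ?x ?h ?v) \<le> ?N\<^sup>2"
        by (rule order_trans[OF F_shift_le]) (intro power_mono xh; simp)
      have F2: "F ?x \<le> ?N\<^sup>2"
        by (rule order_trans[OF F_le], intro power_mono) (use X_le[of w] norm_d_nonneg[of d ?v] in linarith, simp)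
      have "norm (a (lin 1 w (\<epsilon> n) ?v) - a w) \<le> K * exp (r * ?N\<^sup>2) * \<bar>F (lin 1 ?x ?h ?v) - F ?x\<bar>"
        unfolding a_def lin_shift by (intro K F1 F2) auto
      also have "\<dots> \<le> K * exp (r * ?N\<^sup>2) * (2 * \<bar>?h\<bar> * norm_d d ?v * (norm_d d ?x + \<bar>?h\<bar> * norm_d d ?v))"
        using K(1) by (intro mult_left_mono F_shift_diff) auto
      also have "\<dots> \<le> K * exp (r * ?N\<^sup>2) * (2 * \<bar>\<epsilon> n\<bar> * ?N * ?N)"
      proof (rule mult_left_mono)
        have N0: "0 \<le> ?N" using m by simp
        have vN: "norm_d d ?v \<le> ?N" using X_le[of w] norm_d_nonneg[of d ?x] by linarith
        show "2 * \<bar>?h\<bar> * norm_d d ?v * (norm_d d ?x + \<bar>?h\<bar> * norm_d d ?v) \<le> 2 * \<bar>\<epsilon> n\<bar> * ?N * ?N"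
          using h(1) N0 m by (intro mult_mono xh vN mult_left_mono mult_nonneg_nonneg add_nonneg_nonneg) auto
      qed (use K(1) in simp)
      also have "\<dots> = G w * \<bar>\<epsilon> n\<bar>" by (simp add: G_def power2_eq_square)
      finally have "norm (a (lin 1 w (\<epsilon> n) ?v) - a w) \<le> G w * \<bar>\<epsilon> n\<bar>" .
      then show "norm ((a (lin 1 w (\<epsilon> n) ?v) - a w) /\<^sub>R \<epsilon> n) \<le> G w"
        using \<epsilon>(2)[of n] by (simp add: divide_inverse_commute[symmetric] pos_divide_le_eq)
    qed
    show "AE w in std_gaussian d. (\<lambda>n. (a (lin 1 w (\<epsilon> n) ?v) - a w) /\<^sub>R \<epsilon> n)
        \<longlonglongrightarrow> (- (2 * s) * inner_d d ?v (P (?X w))) *\<^sub>R \<alpha>' (F (?X w))"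
    proof (rule AE_I2)
      fix w
      let ?\<gamma> = "\<lambda>h. lin 1 (?X w) (- s * h) ?v"
      have \<gamma>0: "?\<gamma> 0 = ?X w" by (auto simp: lin_def)
      have "((\<lambda>h. F (?\<gamma> h)) has_real_derivative 2 * inner_d d (P (?\<gamma> 0)) (lin (- s) ?v 0 ?v)) (at 0)"
        by (rule F_along_curve) (auto intro!: derivative_eq_intros)
      then have "((\<lambda>h. F (?\<gamma> h)) has_vector_derivative - (2 * s) * inner_d d ?v (P (?X w))) (at 0)"
        unfolding \<gamma>0 has_real_derivative_iff_has_vector_derivative
        by (simp add: inner_d_lin_right inner_d_commute[of d ?v] mult.assoc)
      from has_vector_derivative_quotient_sequence[OF vector_diff_chain_at[OF this \<alpha>_deriv] \<epsilon>(1,2)]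
      show "(\<lambda>n. (a (lin 1 w (\<epsilon> n) ?v) - a w) /\<^sub>R \<epsilon> n)
        \<longlonglongrightarrow> (- (2 * s) * inner_d d ?v (P (?X w))) *\<^sub>R \<alpha>' (F (?X w))"
        unfolding o_def \<gamma>0 a_def lin_shift by simp
    qed
  qed measurable
  show ?thesis by (rule LIMSEQ_unique[OF lim1 lim2])
qed

text \<open>Here \<open>A\<close> is only locally Lipschitz, so the difference quotients are merely bounded; the second
  summand of the local Lipschitz constant disappears in the limit.\<close>

lemma J_lipschitz:
  assumes A [measurable]: "A \<in> borel_measurable borel" and tame: "tame (sq d) 0 A"
    and lp [measurable]: "lp \<in> borel_measurable borel" and tame_lp: "tame (sq d) 0 lp"
    and lip: "\<And>x h v. norm (A (lin 1 x h v) - A x) \<le> \<bar>h\<bar> * norm_d d v * (lp x + \<bar>h\<bar> * norm_d d v)"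
    and cs: "c\<^sup>2 + s\<^sup>2 = 1"
  shows "norm (J A c s u) \<le> \<bar>s\<bar> * norm_d d (P u) * (\<integral>w. lp (lin c u (- s) w) \<partial>std_gaussian d)"
proof -
  let ?X = "\<lambda>w. lin c u (- s) w"
  let ?v = "P u"
  have cs': "c\<^sup>2 + (- s)\<^sup>2 = 1" using cs by simp
  define a where "a w = A (?X w)" for w
  define \<epsilon> :: "nat \<Rightarrow> real" where "\<epsilon> n = 1 / real (Suc n)" for n
  have \<epsilon>: "\<epsilon> \<longlonglongrightarrow> 0" "\<And>n. \<epsilon> n \<noteq> 0" "\<And>n. \<bar>\<epsilon> n\<bar> \<le> 1"
    unfolding \<epsilon>_def using LIMSEQ_Suc[OF lim_1_over_n[where 'a = real]] by (auto simp: field_simps)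
  have [measurable]: "a \<in> borel_measurable borel" unfolding a_def by measurable
  from tame_section[OF tame_lin[OF tame order_refl cs'], of u] have tame_a: "tame (sq d) 0 a" by (simp add: a_def[abs_def])
  have int_a: "integrable (std_gaussian d) a" by (rule integrable_tame[OF tame_a]) auto
  have int_a': "integrable (std_gaussian d) (\<lambda>w. a (lin 1 w (\<epsilon> n) ?v))" for n
    by (rule integrable_tame[OF tame_shift[OF tame_a]]) auto
  from tame_section[OF tame_lin[OF tame_lp order_refl cs'], of u]
  have int_lp: "integrable (std_gaussian d) (\<lambda>w. lp (?X w))"
    by (intro integrable_tame[of d 0]) auto
  define L where "L = (\<integral>w. lp (?X w) \<partial>std_gaussian d)"
  have lim1: "(\<lambda>n. \<integral>w. (a (lin 1 w (\<epsilon> n) ?v) - a w) /\<^sub>R \<epsilon> n \<partial>std_gaussian d) \<longlonglongrightarrow> J A c s u"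
    unfolding J_def using gaussian_shift_derivative[OF _ tame_a _ _ P_beyond \<epsilon>] by (simp add: a_def)
  have "norm (\<integral>w. (a (lin 1 w (\<epsilon> n) ?v) - a w) /\<^sub>R \<epsilon> n \<partial>std_gaussian d)
      \<le> \<bar>s\<bar> * norm_d d ?v * (L + \<bar>s * \<epsilon> n\<bar> * norm_d d ?v)" for n
  proof -
    have "norm (\<integral>w. (a (lin 1 w (\<epsilon> n) ?v) - a w) /\<^sub>R \<epsilon> n \<partial>std_gaussian d)
      \<le> (\<integral>w. norm ((a (lin 1 w (\<epsilon> n) ?v) - a w) /\<^sub>R \<epsilon> n) \<partial>std_gaussian d)"
      by (rule integral_norm_bound)
    also have "\<dots> \<le> (\<integral>w. \<bar>s\<bar> * norm_d d ?v * (lp (?X w) + \<bar>s * \<epsilon> n\<bar> * norm_d d ?v) \<partial>std_gaussian d)"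
    proof (rule integral_mono)
      show "integrable (std_gaussian d) (\<lambda>w. norm ((a (lin 1 w (\<epsilon> n) ?v) - a w) /\<^sub>R \<epsilon> n))"
        by (intro integrable_norm integrable_scaleR_right Bochner_Integration.integrable_diff int_a' int_a)
      show "integrable (std_gaussian d) (\<lambda>w. \<bar>s\<bar> * norm_d d ?v * (lp (?X w) + \<bar>s * \<epsilon> n\<bar> * norm_d d ?v))"
        by (intro integrable_mult_right Bochner_Integration.integrable_add int_lp) simp
      fix w
      have "norm (a (lin 1 w (\<epsilon> n) ?v) - a w)
          \<le> \<bar>- s * \<epsilon> n\<bar> * norm_d d ?v * (lp (?X w) + \<bar>- s * \<epsilon> n\<bar> * norm_d d ?v)"
        unfolding a_def lin_shift by (rule lip)
      also have "\<dots> = (\<bar>s\<bar> * norm_d d ?v * (lp (?X w) + \<bar>s * \<epsilon> n\<bar> * norm_d d ?v)) * \<bar>\<epsilon> n\<bar>"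
        by (simp add: abs_mult)
      finally show "norm ((a (lin 1 w (\<epsilon> n) ?v) - a w) /\<^sub>R \<epsilon> n)
          \<le> \<bar>s\<bar> * norm_d d ?v * (lp (?X w) + \<bar>s * \<epsilon> n\<bar> * norm_d d ?v)"
        using \<epsilon>(2)[of n] by (simp add: divide_inverse_commute[symmetric] pos_divide_le_eq)
    qed
    also have "\<dots> = \<bar>s\<bar> * norm_d d ?v * (L + \<bar>s * \<epsilon> n\<bar> * norm_d d ?v)"
      using int_lp gauss.prob_space by (simp add: L_def)
    finally show ?thesis .
  qed
  moreover have "(\<lambda>n. \<bar>s\<bar> * norm_d d ?v * (L + \<bar>s * \<epsilon> n\<bar> * norm_d d ?v)) \<longlonglongrightarrow> \<bar>s\<bar> * norm_d d ?v * (L + \<bar>s * 0\<bar> * norm_d d ?v)"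
    by (intro tendsto_intros \<epsilon>)
  ultimately have "norm (J A c s u) \<le> \<bar>s\<bar> * norm_d d ?v * (L + \<bar>s * 0\<bar> * norm_d d ?v)"
    by (intro LIMSEQ_le[OF tendsto_norm[OF lim1]]) auto
  then show ?thesis by (simp add: L_def)
qed

end

section \<open>Covariances as integrals over the interpolation\<close>

context convex_cone
begin

text \<open>After the integration by parts the coordinates are rotated back to \<open>(g, y)\<close>.\<close>

lemma interpolation_derivative_profile:
  assumes \<alpha>: "profile \<rho> \<alpha> \<alpha>'" and \<phi>: "profile r \<phi> \<phi>'" and \<rho>: "\<rho> + r < 1 / 2" and cos: "cos \<theta> \<noteq> 0"
  shows "((\<lambda>\<theta>. \<integral>w. \<alpha> (F (fst w)) * \<phi> (F (lin (cos \<theta>) (fst w) (sin \<theta>) (snd w))) \<partial>gauss_pair d)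
      has_vector_derivative (- (4 * sin \<theta>)) *\<^sub>R
       (\<integral>w. inner_d d (P (lin (cos \<theta>) (fst w) (sin \<theta>) (snd w))) (P (fst w)) *\<^sub>R
          (\<phi>' (F (lin (cos \<theta>) (fst w) (sin \<theta>) (snd w))) * \<alpha>' (F (fst w))) \<partial>gauss_pair d)) (at \<theta>)"
proof -
  note [measurable] = profile_measurable[OF \<phi>] profile_measurable[OF \<alpha>]
  define c s where "c = cos \<theta>" and "s = sin \<theta>"
  have cs: "c\<^sup>2 + (- s)\<^sup>2 = 1" "c\<^sup>2 + s\<^sup>2 = 1" "c \<noteq> 0" using cos by (auto simp: c_def s_def)
  have r: "0 \<le> r" "0 \<le> \<rho>" using \<phi> \<alpha> by (auto simp: profile_def)
  then have \<rho>': "\<rho> < 1 / 2" using \<rho> by linarith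
  define \<Phi> where "\<Phi> w = inner_d d (P (fst w)) (P (lin c (fst w) (- s) (snd w))) *\<^sub>R
     (\<phi>' (F (fst w)) * \<alpha>' (F (lin c (fst w) (- s) (snd w))))" for w
  have [measurable]: "\<Phi> \<in> borel_measurable (borel \<Otimes>\<^sub>M borel)" unfolding \<Phi>_def by measurable
  have "tame (sq2 d) (\<rho> + r) \<Phi>"
  proof (rule tame_prod_bound_add)
    show "tame (sq2 d) \<rho> (\<lambda>w. \<alpha>' (F (lin c (fst w) (- s) (snd w))))"
      by (rule tame_lin[OF tame_profile'[OF \<alpha>] r(2) cs(1)])
    show "tame (sq2 d) r (\<lambda>w. inner_d d (P (fst w)) (P (lin c (fst w) (- s) (snd w))) *\<^sub>R \<phi>' (F (fst w)))"
      by (intro tame_scaleR tame_inner_d tame_fst[OF tame_norm_P] tame_lin[OF tame_norm_P _ cs(1)]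
          tame_fst[OF tame_profile'[OF \<phi>]] r) auto
  qed (simp add: \<Phi>_def norm_mult)
  then have int: "integrable (gauss_pair d) \<Phi>" using \<rho> by (rule integrable_tame2) measurable
  have inner: "2 * \<phi>' (F u) * J (\<lambda>x. \<alpha> (F x)) c s u = (- (4 * s)) *\<^sub>R (\<integral>w. \<Phi> (u, w) \<partial>std_gaussian d)" for u
  proof -
    have "J (\<lambda>x. \<alpha> (F x)) c s u = (- (2 * s)) *\<^sub>R (\<integral>w. inner_d d (P u) (P (lin c u (- s) w)) *\<^sub>R \<alpha>' (F (lin c u (- s) w)) \<partial>std_gaussian d)"
      unfolding J_profile[OF \<alpha> \<rho>' cs(2)] scaleR_scaleR[symmetric] by (rule integral_scaleR_right)
    moreover have "(\<integral>w. \<Phi> (u, w) \<partial>std_gaussian d)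
        = \<phi>' (F u) * (\<integral>w. inner_d d (P u) (P (lin c u (- s) w)) *\<^sub>R \<alpha>' (F (lin c u (- s) w)) \<partial>std_gaussian d)"
      by (subst integral_mult_right_zero[symmetric]) (simp add: \<Phi>_def)
    ultimately show ?thesis by (simp add: scaleR_conv_of_real)
  qed
  have "(\<integral>w. \<Phi> w \<partial>gauss_pair d)
      = (\<integral>w. \<Phi> (lin c (fst w) (- (- s)) (snd w), lin (- s) (fst w) c (snd w)) \<partial>gauss_pair d)"
    by (rule integral_gauss_pair_rotation[symmetric, OF _ cs(1,3)]) measurable
  also have "\<dots> = (\<integral>w. inner_d d (P (lin c (fst w) s (snd w))) (P (fst w)) *\<^sub>R
          (\<phi>' (F (lin c (fst w) s (snd w))) * \<alpha>' (F (fst w))) \<partial>gauss_pair d)"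
    unfolding \<Phi>_def fst_conv snd_conv minus_minus lin_lin_rotation[OF cs(2)] ..
  finally have rot: "(\<integral>w. inner_d d (P (lin c (fst w) s (snd w))) (P (fst w)) *\<^sub>R
          (\<phi>' (F (lin c (fst w) s (snd w))) * \<alpha>' (F (fst w))) \<partial>gauss_pair d) = (\<integral>w. \<Phi> w \<partial>gauss_pair d)" ..
  have "(\<integral>u. 2 * \<phi>' (F u) * J (\<lambda>x. \<alpha> (F x)) c s u \<partial>std_gaussian d) = (- (4 * s)) *\<^sub>R (\<integral>w. \<Phi> w \<partial>gauss_pair d)"
    unfolding inner gauss2.integral_fst'[OF int, symmetric] by (rule integral_scaleR_right)
  moreover have "(\<lambda>x. \<alpha> (F x)) \<in> borel_measurable borel" by measurable
  ultimately show ?thesis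
    using interpolation_derivative_J(2)[OF _ tame_profile[OF \<alpha>] \<phi> r(2) \<rho> cos]
    unfolding c_def[symmetric] s_def[symmetric] rot by simp
qed

lemma interpolation_continuous:
  assumes [measurable]: "A \<in> borel_measurable borel" and "tame (sq d) \<rho> A"
    and "profile r \<phi> \<phi>'" and "0 \<le> \<rho>" "\<rho> + r < 1 / 2"
  shows "continuous_on S (\<lambda>\<theta>. \<integral>w. A (fst w) * \<phi> (F (lin (cos \<theta>) (fst w) (sin \<theta>) (snd w))) \<partial>gauss_pair d)"
  by (intro continuous_at_imp_continuous_on ballI
      has_vector_derivative_continuous[OF interpolation_derivative[OF assms]])

lemma interpolation_start:
  fixes A :: "(nat \<Rightarrow> real) \<Rightarrow> complex"
  assumes [measurable]: "A \<in> borel_measurable borel" "(\<lambda>x. \<phi> (F x)) \<in> borel_measurable borel"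
  shows "(\<integral>w. A (fst w) * \<phi> (F (lin (cos 0) (fst w) (sin 0) (snd w))) \<partial>gauss_pair d) = (\<integral>x. A x * \<phi> (F x) \<partial>std_gaussian d)"
proof -
  have "lin 1 x 0 y = x" for x y by (auto simp: lin_def)
  then show ?thesis using integral_gauss_pair_fst[of "\<lambda>x. A x * \<phi> (F x)"] by simp
qed

lemma interpolation_end:
  fixes A :: "(nat \<Rightarrow> real) \<Rightarrow> complex"
  assumes [measurable]: "A \<in> borel_measurable borel" and "tame (sq d) \<rho> A"
    and \<phi>: "profile r \<phi> \<phi>'" and "0 \<le> \<rho>" "\<rho> + r < 1 / 2"
  shows "(\<integral>w. A (fst w) * \<phi> (F (lin (cos (pi/2)) (fst w) (sin (pi/2)) (snd w))) \<partial>gauss_pair d)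
     = (\<integral>x. A x \<partial>std_gaussian d) * (\<integral>x. \<phi> (F x) \<partial>std_gaussian d)"
proof -
  note [measurable] = profile_measurable[OF \<phi>]
  have lin: "lin 0 x 1 y = y" for x y by (auto simp: lin_def)
  have r: "0 \<le> r" using \<phi> by (simp add: profile_def)
  have "tame (sq2 d) (\<rho> + r) (\<lambda>w. A (fst w) * \<phi> (F (snd w)))"
    by (rule tame_prod_bound_add[OF tame_fst[OF assms(2,4)] tame_snd[OF tame_profile[OF \<phi>] r]]) (simp add: norm_mult)
  then have "integrable (gauss_pair d) (\<lambda>w. A (fst w) * \<phi> (F (snd w)))"
    using assms(5) by (rule integrable_tame2) measurable
  from gauss2.integral_fst'[OF this] show ?thesis by (simp add: lin)
qed

text \<open>The integral of \<open>sin\<close> over \<open>[0, \<pi>/2]\<close> is \<open>1\<close>.\<close>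

lemma interpolation_mean_value:
  fixes f :: "real \<Rightarrow> complex"
  assumes "continuous_on {0..pi/2} f"
    and "\<And>\<theta>. 0 < \<theta> \<Longrightarrow> \<theta> < pi / 2 \<Longrightarrow> (f has_vector_derivative f' \<theta>) (at \<theta>)"
    and "\<And>\<theta>. 0 < \<theta> \<Longrightarrow> \<theta> < pi / 2 \<Longrightarrow> norm (f' \<theta>) \<le> B * sin \<theta>"
  shows "norm (f 0 - f (pi/2)) \<le> B"
proof -
  have "norm (f (pi/2) - f 0) \<le> (- B * cos (pi/2)) - (- B * cos 0)"
  proof (rule differentiable_bound_general[where f' = f' and \<phi>' = "\<lambda>\<theta>. B * sin \<theta>"])
    show "((\<lambda>\<theta>. - B * cos \<theta>) has_vector_derivative B * sin \<theta>) (at \<theta>)" for \<theta>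
      unfolding has_real_derivative_iff_has_vector_derivative[symmetric]
      by (auto intro!: derivative_eq_intros)
  qed (use assms in \<open>auto intro!: continuous_intros\<close>)
  then show ?thesis by (simp add: norm_minus_commute)
qed

section \<open>The transform of the squared projection norm\<close>

text \<open>The \<open>k\<close>-th derivative of the transform \<open>E exp (z F(g))\<close>; \<open>m\<close> below is its restriction to the
  real axis.\<close>

definition M :: "nat \<Rightarrow> complex \<Rightarrow> complex" where
  "M k z = (\<integral>x. (F x) ^ k *\<^sub>R exp (z * of_real (F x)) \<partial>std_gaussian d)"

definition m :: "nat \<Rightarrow> real \<Rightarrow> real" where
  "m k r = (\<integral>x. (F x) ^ k * exp (r * F x) \<partial>std_gaussian d)"

definition \<delta> :: real where "\<delta> = (\<integral>x. F x \<partial>std_gaussian d)"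

definition \<sigma>2 :: real where "\<sigma>2 = gauss.variance d F"

lemma tame_F_power: "tame (sq d) 0 (\<lambda>x. F x ^ k)"
proof (induction k)
  case (Suc k)
  then show ?case by (simp add: tame_mult_left tame_F)
qed (simp add: tame_const)

lemma tame_exp_F:
  assumes "Re z \<le> r" "0 \<le> r"
  shows "tame (sq d) r (\<lambda>x. exp (z * of_real (F x)))"
  by (rule tame_profile[OF profile_exp[OF assms]])

lemma tame_exp_F_real: "0 \<le> r \<Longrightarrow> tame (sq d) r (\<lambda>x. exp (r * F x))"
  by (rule tame_bound[OF tame_exp_F[of "of_real r" r]]) auto

lemma integrable_M: "Re z < 1 / 2 \<Longrightarrow> integrable (std_gaussian d) (\<lambda>x. (F x) ^ k *\<^sub>R exp (z * of_real (F x)))"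
  by (rule integrable_tame[OF tame_scaleR[OF tame_F_power tame_exp_F[of z "max 0 (Re z)"]]]) auto

lemma integrable_m: "0 \<le> r \<Longrightarrow> r < 1 / 2 \<Longrightarrow> integrable (std_gaussian d) (\<lambda>x. (F x) ^ k * exp (r * F x))"
  by (rule integrable_tame[OF tame_mult_left[OF tame_F_power tame_exp_F_real]]) auto

lemma integrable_F_power: "integrable (std_gaussian d) (\<lambda>x. F x ^ k)"
  using integrable_m[of 0 k] by simp

lemma integrable_F: "integrable (std_gaussian d) F"
  using integrable_F_power[of 1] by simp

lemma M_of_real: "M k (of_real r) = of_real (m k r)"
  unfolding M_def m_def
  by (subst integral_complex_of_real[symmetric], rule Bochner_Integration.integral_cong)
    (simp_all add: scaleR_conv_of_real flip: exp_of_real)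

lemma M_0_0: "M 0 0 = 1" and M_1_0: "M 1 0 = of_real \<delta>"
  using M_of_real[of 0 0] M_of_real[of 1 0] gauss.prob_space by (simp_all add: m_def \<delta>_def)

lemma m_nonneg: "0 \<le> m k r"
  unfolding m_def by (intro integral_nonneg_AE AE_I2) auto

lemma \<delta>_nonneg: "0 \<le> \<delta>"
  unfolding \<delta>_def by (intro integral_nonneg_AE AE_I2) auto

lemma \<sigma>2_eq: "\<sigma>2 = (\<integral>x. (F x)\<^sup>2 \<partial>std_gaussian d) - \<delta>\<^sup>2"
  unfolding \<sigma>2_def \<delta>_def by (rule gauss.variance_eq) (use integrable_F integrable_F_power in auto)

text \<open>The conditional mean of \<open>\<langle>P g\<^sub>\<theta>, P g\<rangle>\<close> given \<open>g = x\<close>.\<close>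

definition Q :: "real \<Rightarrow> (nat \<Rightarrow> real) \<Rightarrow> real" where
  "Q \<theta> x = (\<integral>y. inner_d d (P (lin (cos \<theta>) x (sin \<theta>) y)) (P x) \<partial>std_gaussian d)"

definition q :: "real \<Rightarrow> complex \<Rightarrow> complex" where
  "q \<theta> z = (\<integral>w. inner_d d (P (lin (cos \<theta>) (fst w) (sin \<theta>) (snd w))) (P (fst w)) *\<^sub>R exp (z * of_real (F (fst w))) \<partial>gauss_pair d)"

text \<open>Mixed products are controlled by the diagonal ones, whose means under two different Gaussian
  vectors of the same law agree.\<close>

lemma F_exp_cross: "0 \<le> r \<Longrightarrow> F y * exp (r * F x) \<le> F x * exp (r * F x) + F y * exp (r * F y)"
proof (cases "F x \<le> F y")
  case True
  assume "0 \<le> r"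
  with True have "F y * exp (r * F x) \<le> F y * exp (r * F y)" by (auto intro!: mult_left_mono)
  moreover have "0 \<le> F x * exp (r * F x)" by simp
  ultimately show ?thesis by linarith
next
  case False
  then have "F y * exp (r * F x) \<le> F x * exp (r * F x)" by (intro mult_right_mono) auto
  moreover have "0 \<le> F y * exp (r * F y)" by simp
  ultimately show ?thesis by linarith
qed

lemma abs_inner_P_le: "\<bar>inner_d d (P x) (P y)\<bar> \<le> (F x + F y) / 2"
proof -
  have "0 \<le> (norm_d d (P x) - norm_d d (P y))\<^sup>2" by simp
  then have "norm_d d (P x) * norm_d d (P y) \<le> (F x + F y) / 2" by (simp add: F_def power2_diff)
  then show ?thesis using abs_inner_d_le[of d "P x" "P y"] by linarith
qed

lemma integrable_lin:
  fixes f :: "_ \<Rightarrow> 'b::{banach, second_countable_topology}"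
  assumes "tame (sq d) \<rho> f" "0 \<le> \<rho>" "\<rho> < 1 / 2" and [measurable]: "f \<in> borel_measurable borel" and "a\<^sup>2 + b\<^sup>2 = 1"
  shows "integrable (gauss_pair d) (\<lambda>w. f (lin a (fst w) b (snd w)))"
  by (rule integrable_tame2[OF tame_lin[OF assms(1,2,5)] assms(3)]) measurable

lemma q_bound:
  assumes "cos \<theta> \<noteq> 0" "0 \<le> Re z" "Re z < 1 / 2"
  shows "norm (q \<theta> z) \<le> 3 / 2 * m 1 (Re z)"
    "norm (q \<theta> 0) \<le> \<delta>"
proof -
  let ?g = "\<lambda>w. lin (cos \<theta>) (fst w) (sin \<theta>) (snd w)"
  let ?r = "Re z"
  define H where "H x = F x * exp (?r * F x)" for x
  have [measurable]: "H \<in> borel_measurable borel" unfolding H_def by measurable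
  have tame_H: "tame (sq d) ?r H" unfolding H_def using assms by (intro tame_mult_left tame_F tame_exp_F_real)
  have fst: "lin 1 x 0 y = x" for x y by (auto simp: lin_def)
  have int: "integrable (gauss_pair d) (\<lambda>w. H (?g w))" "integrable (gauss_pair d) (\<lambda>w. H (fst w))"
    using integrable_lin[OF tame_H, of "cos \<theta>" "sin \<theta>"] integrable_lin[OF tame_H, of 1 0] assms by (simp_all add: fst)
  have H_int: "(\<integral>x. H x \<partial>std_gaussian d) = m 1 ?r" by (simp add: H_def m_def)
  have "norm (q \<theta> z) \<le> (\<integral>w. norm (inner_d d (P (?g w)) (P (fst w)) *\<^sub>R exp (z * of_real (F (fst w)))) \<partial>gauss_pair d)"
    unfolding q_def by (rule integral_norm_bound)
  also have "\<dots> \<le> (\<integral>w. (1 / 2) * H (?g w) + H (fst w) \<partial>gauss_pair d)"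
  proof (rule integral_mono')
    show "integrable (gauss_pair d) (\<lambda>w. (1 / 2) * H (?g w) + H (fst w))"
      by (intro Bochner_Integration.integrable_add integrable_mult_right int)
    fix w
    have "\<bar>inner_d d (P (?g w)) (P (fst w))\<bar> * exp (?r * F (fst w)) \<le> (F (?g w) + F (fst w)) / 2 * exp (?r * F (fst w))"
      by (intro mult_right_mono abs_inner_P_le) simp
    also have "\<dots> \<le> (1 / 2) * H (?g w) + H (fst w)"
      using F_exp_cross[OF assms(2), of "?g w" "fst w"] by (simp add: H_def algebra_simps add_divide_distrib)
    finally show "norm (inner_d d (P (?g w)) (P (fst w)) *\<^sub>R exp (z * of_real (F (fst w)))) \<le> (1 / 2) * H (?g w) + H (fst w)"
      by simp
  qed (simp add: H_def)
  also have "\<dots> = (1 / 2) * (\<integral>w. H (?g w) \<partial>gauss_pair d) + (\<integral>w. H (fst w) \<partial>gauss_pair d)"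
    using int by simp
  also have "\<dots> = (1 / 2) * m 1 ?r + m 1 ?r"
    using assms by (subst integral_gauss_pair_lin) (simp_all add: integral_gauss_pair_fst H_int)
  finally show "norm (q \<theta> z) \<le> 3 / 2 * m 1 (Re z)" by simp
  have intF: "integrable (gauss_pair d) (\<lambda>w. F (?g w))" "integrable (gauss_pair d) (\<lambda>w. F (fst w))"
    using integrable_lin[OF tame_F, of "cos \<theta>" "sin \<theta>"] integrable_lin[OF tame_F, of 1 0] by (simp_all add: fst)
  have "norm (q \<theta> 0) \<le> (\<integral>w. norm (inner_d d (P (?g w)) (P (fst w)) *\<^sub>R (1::complex)) \<partial>gauss_pair d)"
    unfolding q_def by (simp only: mult_zero_left exp_zero) (rule integral_norm_bound)
  also have "\<dots> \<le> (\<integral>w. (1 / 2) * F (?g w) + (1 / 2) * F (fst w) \<partial>gauss_pair d)"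
    using abs_inner_P_le
    by (intro integral_mono' Bochner_Integration.integrable_add integrable_mult_right intF) (auto simp: add_divide_distrib)
  also have "\<dots> = (1 / 2) * (\<integral>w. F (?g w) \<partial>gauss_pair d) + (1 / 2) * (\<integral>w. F (fst w) \<partial>gauss_pair d)"
    using intF by simp
  also have "\<dots> = (1 / 2) * \<delta> + (1 / 2) * \<delta>"
    using assms by (subst integral_gauss_pair_lin) (simp_all add: integral_gauss_pair_fst \<delta>_def)
  finally show "norm (q \<theta> 0) \<le> \<delta>" by simp
qed

end

section \<open>Decoupling of the projection correlation\<close>

context convex_cone
begin

text \<open>A local Lipschitz constant of \<open>Q \<theta>\<close>: by nonexpansiveness, a shift by a small vector changes
  each of the two projections in the inner product by at most the length of the shift.\<close>

definition Q_slope :: "real \<Rightarrow> (nat \<Rightarrow> real) \<Rightarrow> real" where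
  "Q_slope \<theta> x = norm_d d (P x) + (\<integral>y. norm_d d (P (lin (cos \<theta>) x (sin \<theta>) y)) \<partial>std_gaussian d)"

lemma borel_measurable_Q [measurable]: "Q \<theta> \<in> borel_measurable borel"
  unfolding Q_def by measurable

lemma borel_measurable_Q_slope [measurable]: "Q_slope \<theta> \<in> borel_measurable borel"
  unfolding Q_slope_def by measurable

lemma tame_Q_integrand:
  "tame (sq2 d) 0 (\<lambda>w. inner_d d (P (lin (cos \<theta>) (fst w) (sin \<theta>) (snd w))) (P (fst w)))"
  by (intro tame_inner_d tame_lin[OF tame_norm_P] tame_fst[OF tame_norm_P]) auto

lemma tame_Q: "tame (sq d) 0 (Q \<theta>)"
  unfolding Q_def[abs_def] using tame_integral[OF tame_Q_integrand[of \<theta>]] by simp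

lemma tame_Q_slope: "tame (sq d) 0 (Q_slope \<theta>)"
proof -
  have "tame (sq2 d) 0 (\<lambda>w. norm_d d (P (lin (cos \<theta>) (fst w) (sin \<theta>) (snd w))))"
    by (intro tame_lin[OF tame_norm_P]) auto
  from tame_integral[OF this] have "tame (sq d) 0 (\<lambda>x. \<integral>y. norm_d d (P (lin (cos \<theta>) x (sin \<theta>) y)) \<partial>std_gaussian d)"
    by simp
  then show ?thesis unfolding Q_slope_def[abs_def] by (intro tame_add tame_norm_P)
qed

lemma Q_lipschitz: "\<bar>Q \<theta> (lin 1 x h v) - Q \<theta> x\<bar> \<le> \<bar>h\<bar> * norm_d d v * (Q_slope \<theta> x + \<bar>h\<bar> * norm_d d v)"
proof -
  let ?x' = "lin 1 x h v" and ?k = "\<bar>h\<bar> * norm_d d v"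
  let ?g = "\<lambda>x y. lin (cos \<theta>) x (sin \<theta>) y"
  have k: "norm_d d (lin a v 0 v) \<le> \<bar>a\<bar> * norm_d d v" for a using norm_d_lin_le[of d a v 0 v] by simp
  have eqx: "lin 1 ?x' (-1) x = lin h v 0 v" by (auto simp: lin_def)
  have eqg: "lin 1 (?g ?x' y) (-1) (?g x y) = lin (cos \<theta> * h) v 0 v" for y by (auto simp: lin_def algebra_simps)
  have dx: "norm_d d (lin 1 (P ?x') (-1) (P x)) \<le> ?k"
    using P_nonexpansive[of ?x' x] k[of h] unfolding eqx by linarith
  have dg: "norm_d d (lin 1 (P (?g ?x' y)) (-1) (P (?g x y))) \<le> ?k" for y
  proof -
    have "norm_d d (lin 1 (P (?g ?x' y)) (-1) (P (?g x y))) \<le> \<bar>cos \<theta>\<bar> * ?k"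
      using P_nonexpansive[of "?g ?x' y" "?g x y"] k[of "cos \<theta> * h"] unfolding eqg by (simp add: abs_mult mult.assoc)
    also have "\<dots> \<le> 1 * ?k" by (intro mult_right_mono) auto
    finally show ?thesis by simp
  qed
  have Px': "norm_d d (P ?x') \<le> norm_d d (P x) + ?k"
  proof -
    have "P ?x' = lin 1 (P x) 1 (lin 1 (P ?x') (-1) (P x))" by (auto simp: lin_def)
    then have "norm_d d (P ?x') \<le> 1 * norm_d d (P x) + 1 * norm_d d (lin 1 (P ?x') (-1) (P x))"
      by (metis norm_d_lin_le abs_one)
    with dx show ?thesis by simp
  qed
  have int: "integrable (std_gaussian d) (\<lambda>y. inner_d d (P (?g x y)) (P x))" for x
    using tame_section[OF tame_Q_integrand[of \<theta>], of x] by (intro integrable_tame[of d 0]) auto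
  have int_N: "integrable (std_gaussian d) (\<lambda>y. norm_d d (P (?g x y)))"
  proof -
    have "tame (sq2 d) 0 (\<lambda>w. norm_d d (P (?g (fst w) (snd w))))"
      by (intro tame_lin[OF tame_norm_P]) auto
    from tame_section[OF this, of x] show ?thesis by (intro integrable_tame[of d 0]) auto
  qed
  have "\<bar>Q \<theta> ?x' - Q \<theta> x\<bar> = \<bar>\<integral>y. inner_d d (P (?g ?x' y)) (P ?x') - inner_d d (P (?g x y)) (P x) \<partial>std_gaussian d\<bar>"
    unfolding Q_def using int by (simp del: lin_apply)
  also have "\<dots> \<le> (\<integral>y. \<bar>inner_d d (P (?g ?x' y)) (P ?x') - inner_d d (P (?g x y)) (P x)\<bar> \<partial>std_gaussian d)"
    by (rule integral_abs_bound)
  also have "\<dots> \<le> (\<integral>y. ?k * (norm_d d (P x) + ?k) + ?k * norm_d d (P (?g x y)) \<partial>std_gaussian d)"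
  proof (rule integral_mono)
    show "integrable (std_gaussian d) (\<lambda>y. \<bar>inner_d d (P (?g ?x' y)) (P ?x') - inner_d d (P (?g x y)) (P x)\<bar>)"
      by (intro integrable_abs Bochner_Integration.integrable_diff int)
    show "integrable (std_gaussian d) (\<lambda>y. ?k * (norm_d d (P x) + ?k) + ?k * norm_d d (P (?g x y)))"
      by (intro Bochner_Integration.integrable_add integrable_mult_right[OF int_N] gauss.integrable_const)
    fix y
    have eq: "inner_d d (P (?g ?x' y)) (P ?x') - inner_d d (P (?g x y)) (P x)
      = inner_d d (lin 1 (P (?g ?x' y)) (-1) (P (?g x y))) (P ?x') + inner_d d (P (?g x y)) (lin 1 (P ?x') (-1) (P x))"
      by (simp add: inner_d_lin_left inner_d_lin_right del: lin_apply)
    have "\<bar>inner_d d (P (?g ?x' y)) (P ?x') - inner_d d (P (?g x y)) (P x)\<bar> \<le> norm_d d (lin 1 (P (?g ?x' y)) (-1) (P (?g x y))) * norm_d d (P ?x')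
        + norm_d d (P (?g x y)) * norm_d d (lin 1 (P ?x') (-1) (P x))"
      unfolding eq by (rule order_trans[OF abs_triangle_ineq]) (rule add_mono[OF abs_inner_d_le abs_inner_d_le])
    also have "\<dots> \<le> ?k * (norm_d d (P x) + ?k) + norm_d d (P (?g x y)) * ?k"
    proof (rule add_mono)
      have k0: "0 \<le> ?k" by simp
      show "norm_d d (lin 1 (P (?g ?x' y)) (-1) (P (?g x y))) * norm_d d (P ?x') \<le> ?k * (norm_d d (P x) + ?k)"
        by (rule mult_mono[OF dg Px' k0 norm_d_nonneg])
      show "norm_d d (P (?g x y)) * norm_d d (lin 1 (P ?x') (-1) (P x)) \<le> norm_d d (P (?g x y)) * ?k"
        by (rule mult_left_mono[OF dx norm_d_nonneg])
    qed
    finally show "\<bar>inner_d d (P (?g ?x' y)) (P ?x') - inner_d d (P (?g x y)) (P x)\<bar>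
      \<le> ?k * (norm_d d (P x) + ?k) + ?k * norm_d d (P (?g x y))" by (simp only: mult.commute[of _ ?k])
  qed
  also have "\<dots> = ?k * (Q_slope \<theta> x + ?k)"
    using int_N gauss.prob_space by (simp add: Q_slope_def algebra_simps)
  finally show ?thesis .
qed

lemma q_eq_Q: 
  assumes "0 \<le> Re z" "Re z < 1 / 2"
  shows "q \<theta> z = (\<integral>x. of_real (Q \<theta> x) * exp (z * of_real (F x)) \<partial>std_gaussian d)"
proof -
  let ?f = "\<lambda>w. inner_d d (P (lin (cos \<theta>) (fst w) (sin \<theta>) (snd w))) (P (fst w)) *\<^sub>R exp (z * complex_of_real (F (fst w)))"
  have "tame (sq2 d) (Re z) ?f"
    using assms by (intro tame_scaleR tame_Q_integrand tame_fst[OF tame_exp_F]) auto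
  then have int: "integrable (gauss_pair d) ?f"
    using assms(2) by (rule integrable_tame2) measurable
  have "(\<integral>y. ?f (x, y) \<partial>std_gaussian d) = of_real (Q \<theta> x) * exp (z * of_real (F x))" for x
  proof -
    have "integrable (std_gaussian d) (\<lambda>y. inner_d d (P (lin (cos \<theta>) x (sin \<theta>) y)) (P x))"
      using tame_section[OF tame_Q_integrand[of \<theta>], of x] by (intro integrable_tame[of d 0]) auto
    then have "(\<integral>y. ?f (x, y) \<partial>std_gaussian d) = Q \<theta> x *\<^sub>R exp (z * of_real (F x))"
      unfolding Q_def fst_conv snd_conv by (intro integral_scaleR_left) 
    then show ?thesis by (simp add: scaleR_conv_of_real)
  qed
  then show ?thesis unfolding q_def gauss2.integral_fst'[OF int, symmetric] by simp
qed

text \<open>The difference is the covariance of \<open>Q \<theta>\<close> and \<open>exp (z F)\<close> under the Gaussian measure. A second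
  interpolation, with the Lipschitz form of integration by parts, gains the factor \<open>\<bar>z\<bar>\<close> from the
  derivative of \<open>exp (z F)\<close>.\<close>

lemma q_decouple:
  assumes \<theta>: "cos \<theta> \<noteq> 0" and z: "0 \<le> Re z" "Re z < 1 / 2"
  shows "norm (q \<theta> z - q \<theta> 0 * M 0 z) \<le> 6 * norm z * m 1 (Re z)"
proof -
  let ?r = "Re z"
  define A where "A x = complex_of_real (Q \<theta> x)" for x
  define H where "H x = F x * exp (?r * F x)" for x
  \<comment> \<open>Together with \<open>H\<close> this bounds \<open>exp (r F u) \<parallel>P u\<parallel> Q_slope \<theta> x\<close>; its mean is \<open>2 m\<^sub>1\<close>, whence the constant \<open>6 = 2 (2 + 1)\<close>.\<close>
  define \<Psi> where "\<Psi> x = H x + (\<integral>y. H (lin (cos \<theta>) x (sin \<theta>) y) \<partial>std_gaussian d)" for x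
  have [measurable]: "A \<in> borel_measurable borel" unfolding A_def[abs_def] by measurable
  have [measurable]: "H \<in> borel_measurable borel" unfolding H_def by measurable
  have [measurable]: "\<Psi> \<in> borel_measurable borel" unfolding \<Psi>_def by measurable
  have tame_A: "tame (sq d) 0 A" unfolding A_def[abs_def] by (rule tame_of_real[OF tame_Q])
  have H0: "0 \<le> H x" for x by (simp add: H_def)
  have tame_H: "tame (sq d) ?r H" unfolding H_def[abs_def] using z by (intro tame_mult_left tame_F tame_exp_F_real)
  have int_H: "integrable (std_gaussian d) H" by (rule integrable_tame[OF tame_H z(2)]) measurable
  have H_int: "(\<integral>x. H x \<partial>std_gaussian d) = m 1 ?r" by (simp add: H_def m_def)
  have tame_Hg: "tame (sq2 d) ?r (\<lambda>w. H (lin (cos \<theta>) (fst w) (sin \<theta>) (snd w)))"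
    by (rule tame_lin[OF tame_H z(1)]) simp
  have int_Hg: "integrable (gauss_pair d) (\<lambda>w. H (lin (cos \<theta>) (fst w) (sin \<theta>) (snd w)))"
    by (rule integrable_tame2[OF tame_Hg z(2)]) measurable
  have int_Hgx: "integrable (std_gaussian d) (\<lambda>y. H (lin (cos \<theta>) x (sin \<theta>) y))" for x
    using tame_section[OF tame_Hg, of x] z(2) by (intro integrable_tame[of d ?r]) auto
  have tame_\<Psi>: "tame (sq d) ?r \<Psi>"
    using tame_integral[OF tame_Hg z(2)] unfolding \<Psi>_def[abs_def] by (intro tame_add tame_H) simp
  have \<Psi>_int: "(\<integral>x. \<Psi> x \<partial>std_gaussian d) = 2 * m 1 ?r"
  proof -
    have "integrable (std_gaussian d) (\<lambda>x. \<integral>y. H (lin (cos \<theta>) x (sin \<theta>) y) \<partial>std_gaussian d)"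
      using gauss2.integrable_fst'[OF int_Hg] by simp
    moreover have "(\<integral>x. (\<integral>y. H (lin (cos \<theta>) x (sin \<theta>) y) \<partial>std_gaussian d) \<partial>std_gaussian d) = m 1 ?r"
      using gauss2.integral_fst'[OF int_Hg] \<theta> by (subst (asm) integral_gauss_pair_lin) (simp_all add: H_int)
    ultimately show ?thesis unfolding \<Psi>_def using int_H by (simp add: H_int)
  qed
  have point: "exp (?r * F u) * norm_d d (P u) * Q_slope \<theta> x \<le> 2 * H u + \<Psi> x / 2" for u x
  proof -
    let ?e = "exp (?r * F u)" and ?n = "norm_d d (P u)"
    let ?g = "\<lambda>y. lin (cos \<theta>) x (sin \<theta>) y"
    have pw: "?e * ?n * norm_d d (P y) \<le> H u + H y / 2" for y
    proof -
      have "0 \<le> (?n - norm_d d (P y))\<^sup>2" by simp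
      then have "?n * norm_d d (P y) \<le> (F u + F y) / 2" by (simp add: F_def power2_diff)
      then have "?e * (?n * norm_d d (P y)) \<le> ?e * ((F u + F y) / 2)" by (intro mult_left_mono) auto
      also have "\<dots> \<le> H u + H y / 2"
        using F_exp_cross[OF z(1), of y u] by (simp add: H_def algebra_simps add_divide_distrib)
      finally show ?thesis by (simp add: mult.assoc)
    qed
    have int_N: "integrable (std_gaussian d) (\<lambda>y. norm_d d (P (?g y)))"
    proof -
      have "tame (sq2 d) 0 (\<lambda>w. norm_d d (P (lin (cos \<theta>) (fst w) (sin \<theta>) (snd w))))"
        by (intro tame_lin[OF tame_norm_P]) auto
      from tame_section[OF this, of x] show ?thesis by (intro integrable_tame[of d 0]) auto
    qed
    have "?e * ?n * (\<integral>y. norm_d d (P (?g y)) \<partial>std_gaussian d) = (\<integral>y. ?e * ?n * norm_d d (P (?g y)) \<partial>std_gaussian d)"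
      by (rule integral_mult_right_zero[symmetric])
    also have "\<dots> \<le> (\<integral>y. H u + (1 / 2) * H (?g y) \<partial>std_gaussian d)"
      by (rule integral_mono)
        (use pw in \<open>auto intro!: integrable_mult_right int_N int_Hgx Bochner_Integration.integrable_add\<close>)
    also have "\<dots> = H u + (1 / 2) * (\<integral>y. H (?g y) \<partial>std_gaussian d)"
      using int_Hgx gauss.prob_space by simp
    finally have "?e * ?n * (\<integral>y. norm_d d (P (?g y)) \<partial>std_gaussian d) \<le> H u + (1 / 2) * (\<integral>y. H (?g y) \<partial>std_gaussian d)" .
    with pw[of x] show ?thesis unfolding Q_slope_def \<Psi>_def by (simp add: distrib_left add_divide_distrib)
  qed
  let ?\<phi> = "\<lambda>t. exp (z * complex_of_real t)" and ?\<phi>' = "\<lambda>t. z * exp (z * complex_of_real t)"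
  have \<phi>: "profile ?r ?\<phi> ?\<phi>'" by (rule profile_exp) (use z in auto)
  note [measurable] = profile_measurable[OF \<phi>]
  define e where "e \<psi> = (\<integral>w. A (fst w) * ?\<phi> (F (lin (cos \<psi>) (fst w) (sin \<psi>) (snd w))) \<partial>gauss_pair d)" for \<psi>
  have "norm (e 0 - e (pi / 2)) \<le> 6 * norm z * m 1 ?r"
  proof (rule interpolation_mean_value)
    show "continuous_on {0..pi/2} e"
      unfolding e_def by (rule interpolation_continuous[OF _ tame_A \<phi>]) (use z in auto)
    fix \<psi> assume \<psi>: "0 < \<psi>" "\<psi> < pi / 2"
    then have cos: "cos \<psi> \<noteq> 0" and sin: "0 \<le> sin \<psi>" using cos_gt_zero[of \<psi>] sin_gt_zero[of \<psi>] by auto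
    have cs: "(cos \<psi>)\<^sup>2 + (sin \<psi>)\<^sup>2 = 1" "(cos \<psi>)\<^sup>2 + (- sin \<psi>)\<^sup>2 = 1" by auto
    let ?D = "\<lambda>u. 2 * ?\<phi>' (F u) * J A (cos \<psi>) (sin \<psi>) u"
    have int_D: "integrable (std_gaussian d) ?D"
      by (rule interpolation_derivative_J(1)[OF _ tame_A \<phi> order_refl _ cos]) (use z in auto)
    show "(e has_vector_derivative (\<integral>u. ?D u \<partial>std_gaussian d)) (at \<psi>)"
      unfolding e_def by (rule interpolation_derivative_J(2)[OF _ tame_A \<phi> order_refl _ cos]) (use z in auto)
    let ?X = "\<lambda>u w. lin (cos \<psi>) u (- sin \<psi>) w"
    have int_\<Psi>X: "integrable (gauss_pair d) (\<lambda>w. \<Psi> (?X (fst w) (snd w)))"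
      by (rule integrable_tame2[OF tame_lin[OF tame_\<Psi> z(1) cs(2)] z(2)]) measurable
    have int_\<Psi>Xu: "integrable (std_gaussian d) (\<lambda>w. \<Psi> (?X u w))" for u
      using tame_section[OF tame_lin[OF tame_\<Psi> z(1) cs(2)], of u] z(2) by (intro integrable_tame[of d ?r]) auto
    have int_LXu: "integrable (std_gaussian d) (\<lambda>w. Q_slope \<theta> (?X u w))" for u
      using tame_section[OF tame_lin[OF tame_Q_slope[of \<theta>] order_refl cs(2)], of u] by (intro integrable_tame[of d 0]) auto
    have bound: "norm (?D u) \<le> 2 * norm z * sin \<psi> * (2 * H u + (1 / 2) * (\<integral>w. \<Psi> (?X u w) \<partial>std_gaussian d))" for u
    proof -
      have "norm (J A (cos \<psi>) (sin \<psi>) u) \<le> \<bar>sin \<psi>\<bar> * norm_d d (P u) * (\<integral>w. Q_slope \<theta> (?X u w) \<partial>std_gaussian d)"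
      proof (rule J_lipschitz[OF _ tame_A _ tame_Q_slope _ cs(1)])
        show "norm (A (lin 1 x h v) - A x) \<le> \<bar>h\<bar> * norm_d d v * (Q_slope \<theta> x + \<bar>h\<bar> * norm_d d v)" for x h v
          using Q_lipschitz[of \<theta> x h v] by (simp add: A_def del: lin_apply flip: of_real_diff)
      qed measurable
      then have "norm (?D u) \<le> 2 * (norm z * exp (?r * F u)) * (sin \<psi> * norm_d d (P u) * (\<integral>w. Q_slope \<theta> (?X u w) \<partial>std_gaussian d))"
        using sin by (simp add: norm_mult mult_left_mono)
      also have "\<dots> = 2 * norm z * sin \<psi> * (exp (?r * F u) * norm_d d (P u) * (\<integral>w. Q_slope \<theta> (?X u w) \<partial>std_gaussian d))"
        by (simp add: mult_ac)
      also have "exp (?r * F u) * norm_d d (P u) * (\<integral>w. Q_slope \<theta> (?X u w) \<partial>std_gaussian d)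
          = (\<integral>w. exp (?r * F u) * norm_d d (P u) * Q_slope \<theta> (?X u w) \<partial>std_gaussian d)"
        by (rule integral_mult_right_zero[symmetric])
      also have "\<dots> \<le> (\<integral>w. 2 * H u + (1 / 2) * \<Psi> (?X u w) \<partial>std_gaussian d)"
        by (rule integral_mono)
          (use point in \<open>auto intro!: integrable_mult_right int_LXu int_\<Psi>Xu Bochner_Integration.integrable_add\<close>)
      also have "\<dots> = 2 * H u + (1 / 2) * (\<integral>w. \<Psi> (?X u w) \<partial>std_gaussian d)"
        using int_\<Psi>Xu gauss.prob_space by simp
      finally show ?thesis using sin by (simp add: mult_left_mono)
    qed
    have int_bound: "integrable (std_gaussian d) (\<lambda>u. 2 * norm z * sin \<psi> * (2 * H u + (1 / 2) * (\<integral>w. \<Psi> (?X u w) \<partial>std_gaussian d)))"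
      using gauss2.integrable_fst'[OF int_\<Psi>X]
      by (intro integrable_mult_right Bochner_Integration.integrable_add int_H) simp
    have "norm (\<integral>u. ?D u \<partial>std_gaussian d) \<le> (\<integral>u. norm (?D u) \<partial>std_gaussian d)" by (rule integral_norm_bound)
    also have "\<dots> \<le> (\<integral>u. 2 * norm z * sin \<psi> * (2 * H u + (1 / 2) * (\<integral>w. \<Psi> (?X u w) \<partial>std_gaussian d)) \<partial>std_gaussian d)"
      by (rule integral_mono[OF integrable_norm[OF int_D] int_bound bound])
    also have "\<dots> = 2 * norm z * sin \<psi> * (2 * m 1 ?r + (1 / 2) * (2 * m 1 ?r))"
    proof -
      have "(\<integral>u. (\<integral>w. \<Psi> (?X u w) \<partial>std_gaussian d) \<partial>std_gaussian d) = 2 * m 1 ?r"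
        using gauss2.integral_fst'[OF int_\<Psi>X] cos by (subst (asm) integral_gauss_pair_lin) (simp_all add: \<Psi>_int)
      then show ?thesis using gauss2.integrable_fst'[OF int_\<Psi>X] int_H by (simp add: H_int)
    qed
    finally show "norm (\<integral>u. ?D u \<partial>std_gaussian d) \<le> 6 * norm z * m 1 ?r * sin \<psi>" by (simp add: algebra_simps)
  qed
  moreover have "e 0 = q \<theta> z"
    unfolding e_def q_eq_Q[OF z] A_def[symmetric] by (rule interpolation_start) measurable
  moreover have "e (pi / 2) = q \<theta> 0 * M 0 z"
  proof -
    have "q \<theta> 0 = (\<integral>x. A x \<partial>std_gaussian d)" using q_eq_Q[of 0 \<theta>] by (simp add: A_def)
    moreover have "e (pi / 2) = (\<integral>x. A x \<partial>std_gaussian d) * (\<integral>x. ?\<phi> (F x) \<partial>std_gaussian d)"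
      unfolding e_def by (rule interpolation_end[OF _ tame_A \<phi>]) (use z in auto)
    ultimately show ?thesis by (simp add: M_def)
  qed
  ultimately show ?thesis by simp
qed

section \<open>The differential inequality for the transform\<close>

lemma covariance_interpolation:
  assumes z: "Re z \<le> r" "0 \<le> r" "r < 1 / 2"
  defines "c \<equiv> \<lambda>\<theta>. \<integral>w. exp (z * of_real (F (fst w))) * complex_of_real (F (lin (cos \<theta>) (fst w) (sin \<theta>) (snd w))) \<partial>gauss_pair d"
  shows "continuous_on S c" "c 0 = M 1 z" "c (pi / 2) = M 0 z * of_real \<delta>"
    "cos \<theta> \<noteq> 0 \<Longrightarrow> (c has_vector_derivative (- (4 * sin \<theta>)) *\<^sub>R (z * q \<theta> z)) (at \<theta>)"
proof -
  let ?A = "\<lambda>x. exp (z * complex_of_real (F x))"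
  have \<alpha>: "profile r (\<lambda>t. exp (z * of_real t)) (\<lambda>t. z * exp (z * complex_of_real t))" by (rule profile_exp) (use z in auto)
  have [measurable]: "?A \<in> borel_measurable borel" by measurable
  have tame: "tame (sq d) r ?A" by (rule tame_exp_F) (use z in auto)
  show "continuous_on S c"
    unfolding c_def by (rule interpolation_continuous[OF _ tame profile_of_real]) (use z in auto)
  have "c 0 = (\<integral>x. ?A x * complex_of_real (F x) \<partial>std_gaussian d)"
    unfolding c_def by (rule interpolation_start) measurable
  then show "c 0 = M 1 z" by (simp add: M_def scaleR_conv_of_real mult.commute)
  have "c (pi / 2) = (\<integral>x. ?A x \<partial>std_gaussian d) * (\<integral>x. complex_of_real (F x) \<partial>std_gaussian d)"
    unfolding c_def by (rule interpolation_end[OF _ tame profile_of_real]) (use z in auto)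
  then show "c (pi / 2) = M 0 z * of_real \<delta>" by (simp add: M_def \<delta>_def)
  assume "cos \<theta> \<noteq> 0"
  from interpolation_derivative_profile[OF \<alpha> profile_of_real _ this] z
  have "(c has_vector_derivative (- (4 * sin \<theta>)) *\<^sub>R
       (\<integral>w. inner_d d (P (lin (cos \<theta>) (fst w) (sin \<theta>) (snd w))) (P (fst w)) *\<^sub>R
          (1 * (z * exp (z * of_real (F (fst w))))) \<partial>gauss_pair d)) (at \<theta>)"
    unfolding c_def by simp
  moreover have "(\<integral>w. inner_d d (P (lin (cos \<theta>) (fst w) (sin \<theta>) (snd w))) (P (fst w)) *\<^sub>R
          (1 * (z * exp (z * of_real (F (fst w))))) \<partial>gauss_pair d) = z * q \<theta> z"
    unfolding q_def by (subst integral_mult_right_zero[symmetric]) simp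
  ultimately show "(c has_vector_derivative (- (4 * sin \<theta>)) *\<^sub>R (z * q \<theta> z)) (at \<theta>)" by simp
qed

lemma variance_interpolation:
  defines "c \<equiv> \<lambda>\<theta>. \<integral>w. complex_of_real (F (fst w)) * complex_of_real (F (lin (cos \<theta>) (fst w) (sin \<theta>) (snd w))) \<partial>gauss_pair d"
  shows "continuous_on S c" "c 0 - c (pi / 2) = of_real \<sigma>2"
    "cos \<theta> \<noteq> 0 \<Longrightarrow> (c has_vector_derivative (- (4 * sin \<theta>)) *\<^sub>R q \<theta> 0) (at \<theta>)"
proof -
  let ?A = "\<lambda>x. complex_of_real (F x)"
  have tame: "tame (sq d) 0 ?A" by (rule tame_of_real[OF tame_F])
  show "continuous_on S c"
    unfolding c_def by (rule interpolation_continuous[OF _ tame profile_of_real]) auto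
  have "c 0 = (\<integral>x. ?A x * complex_of_real (F x) \<partial>std_gaussian d)"
    unfolding c_def by (rule interpolation_start) measurable
  also have "\<dots> = of_real (\<integral>x. (F x)\<^sup>2 \<partial>std_gaussian d)"
    by (simp add: power2_eq_square flip: integral_complex_of_real of_real_mult)
  finally have 1: "c 0 = of_real (\<integral>x. (F x)\<^sup>2 \<partial>std_gaussian d)" .
  have "c (pi / 2) = (\<integral>x. ?A x \<partial>std_gaussian d) * (\<integral>x. complex_of_real (F x) \<partial>std_gaussian d)"
    unfolding c_def by (rule interpolation_end[OF _ tame profile_of_real]) auto
  with 1 show "c 0 - c (pi / 2) = of_real \<sigma>2" by (simp add: \<sigma>2_eq \<delta>_def power2_eq_square)
  assume "cos \<theta> \<noteq> 0"
  from interpolation_derivative_profile[OF profile_of_real profile_of_real _ this]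
  show "(c has_vector_derivative (- (4 * sin \<theta>)) *\<^sub>R q \<theta> 0) (at \<theta>)"
    unfolding c_def q_def by simp
qed

text \<open>The integrand is at most \<open>4 \<delta> sin \<theta>\<close> by Cauchy-Schwarz.\<close>

lemma \<sigma>2_le: "\<sigma>2 \<le> 4 * \<delta>"
proof -
  let ?c = "\<lambda>\<theta>. \<integral>w. complex_of_real (F (fst w)) * complex_of_real (F (lin (cos \<theta>) (fst w) (sin \<theta>) (snd w))) \<partial>gauss_pair d"
  have "norm (?c 0 - ?c (pi / 2)) \<le> 4 * \<delta>"
  proof (rule interpolation_mean_value)
    fix \<theta> :: real assume \<theta>: "0 < \<theta>" "\<theta> < pi / 2"
    then have cos: "cos \<theta> \<noteq> 0" and sin: "0 \<le> sin \<theta>" using cos_gt_zero[of \<theta>] sin_gt_zero[of \<theta>] by auto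
    show "(?c has_vector_derivative (- (4 * sin \<theta>)) *\<^sub>R q \<theta> 0) (at \<theta>)" by (rule variance_interpolation(3)[OF cos])
    show "norm ((- (4 * sin \<theta>)) *\<^sub>R q \<theta> 0) \<le> 4 * \<delta> * sin \<theta>"
      using mult_left_mono[OF q_bound(2)[OF cos, of 0] sin] sin by (simp add: abs_mult mult.commute)
  qed (rule variance_interpolation(1))
  then show ?thesis unfolding variance_interpolation(2) by simp
qed

text \<open>For real \<open>z\<close> the covariance bound contains the quantity to be bounded with a small factor,
  which can be absorbed.\<close>

lemma m1_le:
  assumes "0 \<le> r" "r \<le> 1 / 12"
  shows "m 1 r \<le> 2 * \<delta> * m 0 r"
proof -
  let ?z = "complex_of_real r"
  let ?c = "\<lambda>\<theta>. \<integral>w. exp (?z * of_real (F (fst w))) * complex_of_real (F (lin (cos \<theta>) (fst w) (sin \<theta>) (snd w))) \<partial>gauss_pair d"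
  have z: "Re ?z \<le> r" "0 \<le> r" "r < 1 / 2" using assms by auto
  note c = covariance_interpolation[OF z]
  have "norm (?c 0 - ?c (pi / 2)) \<le> 6 * r * m 1 r"
  proof (rule interpolation_mean_value)
    fix \<theta> :: real assume \<theta>: "0 < \<theta>" "\<theta> < pi / 2"
    then have cos: "cos \<theta> \<noteq> 0" and sin: "0 \<le> sin \<theta>" using cos_gt_zero[of \<theta>] sin_gt_zero[of \<theta>] by auto
    show "(?c has_vector_derivative (- (4 * sin \<theta>)) *\<^sub>R (?z * q \<theta> ?z)) (at \<theta>)" by (rule c(4)[OF cos])
    have "norm (q \<theta> ?z) \<le> 3 / 2 * m 1 r" using q_bound(1)[OF cos, of ?z] assms by simp
    from mult_left_mono[OF this, of "4 * sin \<theta> * r"]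
    show "norm ((- (4 * sin \<theta>)) *\<^sub>R (?z * q \<theta> ?z)) \<le> 6 * r * m 1 r * sin \<theta>"
      using sin assms(1) by (simp add: abs_mult norm_mult mult_ac)
  qed (rule c(1))
  then have "norm (complex_of_real (m 1 r - m 0 r * \<delta>)) \<le> 6 * r * m 1 r"
    unfolding c(2,3) M_of_real by simp
  then have "\<bar>m 1 r - m 0 r * \<delta>\<bar> \<le> 6 * r * m 1 r" by (simp only: norm_of_real)
  \<comment> \<open>The range \<open>r \<le> 1 / 12\<close> is the one that permits this absorption.\<close>
  moreover have "6 * r * m 1 r \<le> (1 / 2) * m 1 r" using assms m_nonneg[of 1 r] by (intro mult_right_mono) auto
  ultimately have "m 1 r - m 0 r * \<delta> \<le> (1 / 2) * m 1 r" by linarith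
  then show ?thesis by (simp add: algebra_simps)
qed

text \<open>Subtracting \<open>z M z\<close> times the variance interpolation from the covariance interpolation leaves
  the decoupling error \<open>q(\<theta>, z) - q(\<theta>, 0) M z\<close>, which is of first order in \<open>z\<close>.\<close>

lemma M_differential_inequality:
  fixes z :: complex
  assumes z: "0 \<le> Re z" "Re z \<le> 1 / 12"
  shows "norm (M 1 z - (\<delta> + z * \<sigma>2) * M 0 z) \<le> 48 * (norm z)\<^sup>2 * \<delta> * m 0 (Re z)"
proof -
  let ?r = "Re z"
  let ?c = "\<lambda>\<theta>. \<integral>w. exp (z * of_real (F (fst w))) * complex_of_real (F (lin (cos \<theta>) (fst w) (sin \<theta>) (snd w))) \<partial>gauss_pair d"
  let ?v = "\<lambda>\<theta>. \<integral>w. complex_of_real (F (fst w)) * complex_of_real (F (lin (cos \<theta>) (fst w) (sin \<theta>) (snd w))) \<partial>gauss_pair d"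
  have z': "Re z \<le> ?r" "0 \<le> ?r" "?r < 1 / 2" using z by auto
  note c = covariance_interpolation[OF z']
  let ?f = "\<lambda>\<theta>. ?c \<theta> - (z * M 0 z) * ?v \<theta>"
  have "norm (?f 0 - ?f (pi / 2)) \<le> 24 * (norm z)\<^sup>2 * m 1 ?r"
  proof (rule interpolation_mean_value)
    fix \<theta> :: real assume \<theta>: "0 < \<theta>" "\<theta> < pi / 2"
    then have cos: "cos \<theta> \<noteq> 0" and sin: "0 \<le> sin \<theta>" using cos_gt_zero[of \<theta>] sin_gt_zero[of \<theta>] by auto
    show "(?f has_vector_derivative (- (4 * sin \<theta>)) *\<^sub>R (z * q \<theta> z) - (z * M 0 z) * ((- (4 * sin \<theta>)) *\<^sub>R q \<theta> 0)) (at \<theta>)"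
      by (intro has_vector_derivative_diff has_vector_derivative_mult_right c(4)[OF cos] variance_interpolation(3)[OF cos])
    have eq: "(- (4 * sin \<theta>)) *\<^sub>R (z * q \<theta> z) - (z * M 0 z) * ((- (4 * sin \<theta>)) *\<^sub>R q \<theta> 0)
        = (- (4 * sin \<theta>)) *\<^sub>R (z * (q \<theta> z - q \<theta> 0 * M 0 z))"
      by (simp add: scaleR_conv_of_real algebra_simps)
    have "norm (q \<theta> z - q \<theta> 0 * M 0 z) \<le> 6 * norm z * m 1 ?r" using q_decouple[OF cos] z by simp
    from mult_left_mono[OF this, of "4 * sin \<theta> * norm z"]
    show "norm ((- (4 * sin \<theta>)) *\<^sub>R (z * q \<theta> z) - (z * M 0 z) * ((- (4 * sin \<theta>)) *\<^sub>R q \<theta> 0))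
        \<le> 24 * (norm z)\<^sup>2 * m 1 ?r * sin \<theta>"
      unfolding eq using sin by (simp add: abs_mult norm_mult mult_ac power2_eq_square)
  qed (intro continuous_intros c(1) variance_interpolation(1))
  moreover have "?f 0 - ?f (pi / 2) = M 1 z - (\<delta> + z * \<sigma>2) * M 0 z"
  proof -
    have "?f 0 - ?f (pi / 2) = (?c 0 - ?c (pi / 2)) - (z * M 0 z) * (?v 0 - ?v (pi / 2))"
      by (simp only: right_diff_distrib) simp
    then show ?thesis unfolding c(2,3) variance_interpolation(2) by (simp add: algebra_simps)
  qed
  moreover have "24 * (norm z)\<^sup>2 * m 1 ?r \<le> 24 * (norm z)\<^sup>2 * (2 * \<delta> * m 0 ?r)"
    using z by (intro mult_left_mono m1_le) auto
  ultimately have "norm (M 1 z - (\<delta> + z * \<sigma>2) * M 0 z) \<le> 24 * (norm z)\<^sup>2 * (2 * \<delta> * m 0 ?r)"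
    by (simp only:)
  then show ?thesis by (simp add: mult_ac)
qed

lemma M_along_path:
  assumes t: "t \<in> {a<..<b}"
    and z: "\<And>s. s \<in> {a<..<b} \<Longrightarrow> (z has_vector_derivative z' s) (at s)"
    and Re: "\<And>s. s \<in> {a<..<b} \<Longrightarrow> Re (z s) \<le> 1 / 4"
    and B: "\<And>s. s \<in> {a<..<b} \<Longrightarrow> norm (z' s) \<le> B"
  shows "((\<lambda>s. M k (z s)) has_vector_derivative z' t * M (Suc k) (z t)) (at t)"
proof -
  have B0: "0 \<le> B" using order_trans[OF norm_ge_zero B[OF t]] .
  have "((\<lambda>s. \<integral>x. (F x) ^ k *\<^sub>R exp (z s * of_real (F x)) \<partial>std_gaussian d) has_vector_derivative
     (\<integral>x. z' t * (F x ^ Suc k *\<^sub>R exp (z t * of_real (F x))) \<partial>std_gaussian d)) (at t)"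
  proof (rule has_vector_derivative_integral[OF t, where g = "\<lambda>x. B * (F x ^ Suc k * exp ((1 / 4) * F x))"])
    show "integrable (std_gaussian d) (\<lambda>x. B * (F x ^ Suc k * exp ((1 / 4) * F x)))"
      by (intro integrable_mult_right integrable_m) auto
    fix s assume s: "s \<in> {a<..<b}"
    show "integrable (std_gaussian d) (\<lambda>x. (F x) ^ k *\<^sub>R exp (z s * of_real (F x)))"
      by (rule integrable_M) (use Re[OF s] in simp)
    fix x
    have "((\<lambda>s. z s * of_real (F x)) has_vector_derivative z' s * of_real (F x)) (at s)"
      by (intro has_vector_derivative_mult_left z s)
    moreover have "(exp has_field_derivative exp (z s * of_real (F x))) (at (z s * of_real (F x)))" by (rule DERIV_exp)
    ultimately have "((exp \<circ> (\<lambda>s. z s * of_real (F x))) has_vector_derivative (z' s * of_real (F x)) * exp (z s * of_real (F x))) (at s)"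
      by (rule field_vector_diff_chain_at)
    then have "((\<lambda>s. F x ^ k *\<^sub>R exp (z s * of_real (F x))) has_vector_derivative
        F x ^ k *\<^sub>R ((z' s * of_real (F x)) * exp (z s * of_real (F x)))) (at s)"
      unfolding o_def by (intro bounded_linear.has_vector_derivative[OF bounded_linear_scaleR_right])
    then show "((\<lambda>s. F x ^ k *\<^sub>R exp (z s * of_real (F x))) has_vector_derivative
        z' s * (F x ^ Suc k *\<^sub>R exp (z s * of_real (F x)))) (at s)"
      by (simp add: scaleR_conv_of_real mult_ac)
    have "exp (Re (z s) * F x) \<le> exp ((1 / 4) * F x)"
      using mult_right_mono[OF Re[OF s] F_nonneg[of x]] by simp
    then have "norm (z' s) * (F x ^ Suc k * exp (Re (z s) * F x)) \<le> B * (F x ^ Suc k * exp ((1 / 4) * F x))"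
      using B0 by (intro mult_mono B s mult_left_mono) auto
    then show "norm (z' s * (F x ^ Suc k *\<^sub>R exp (z s * of_real (F x)))) \<le> B * (F x ^ Suc k * exp ((1 / 4) * F x))"
      by (simp add: norm_mult abs_mult mult_ac)
  qed measurable
  then show ?thesis unfolding M_def integral_mult_right_zero .
qed

text \<open>Gronwall's inequality for \<open>m\<^sub>0' = m\<^sub>1 \<le> 2 \<delta> m\<^sub>0\<close>.\<close>

lemma m0_le:
  assumes "0 \<le> r" "r \<le> 1 / 12"
  shows "m 0 r \<le> exp (2 * \<delta> * r)"
proof -
  have deriv: "((m 0) has_real_derivative m 1 t) (at t)" if "t < 1 / 4" for t
  proof -
    have "((\<lambda>s. M 0 (complex_of_real s)) has_vector_derivative 1 * M (Suc 0) (of_real t)) (at t)"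
      by (rule M_along_path[where a = "t - 1" and b = "1 / 4" and B = 1])
        (use that in \<open>auto intro!: has_vector_derivative_of_real derivative_eq_intros\<close>)
    from bounded_linear.has_vector_derivative[OF bounded_linear_Re this]
    show ?thesis by (simp add: M_of_real has_real_derivative_iff_has_vector_derivative)
  qed
  have "m 0 r * exp (- 2 * \<delta> * r) \<le> m 0 0 * exp (- 2 * \<delta> * 0)"
  proof (rule DERIV_nonpos_imp_nonincreasing[OF assms(1), of "\<lambda>t. m 0 t * exp (- 2 * \<delta> * t)"])
    fix t assume t: "0 \<le> t" "t \<le> r"
    have "((\<lambda>t. m 0 t * exp (- 2 * \<delta> * t)) has_real_derivative
      m 1 t * exp (- 2 * \<delta> * t) + exp (- 2 * \<delta> * t) * (- 2 * \<delta>) * m 0 t) (at t)"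
      using t assms(2) by (auto intro!: derivative_eq_intros deriv)
    moreover have "m 1 t * exp (- 2 * \<delta> * t) + exp (- 2 * \<delta> * t) * (- 2 * \<delta>) * m 0 t \<le> 0"
      using mult_right_mono[OF m1_le[of t], of "exp (- 2 * \<delta> * t)"] t assms(2) by (simp add: algebra_simps)
    ultimately show "\<exists>y. ((\<lambda>t. m 0 t * exp (- 2 * \<delta> * t)) has_real_derivative y) (at t) \<and> y \<le> 0" by blast
  qed
  also have "m 0 0 = 1" using gauss.prob_space by (simp add: m_def)
  finally show ?thesis by (simp add: exp_minus field_simps)
qed

lemma M_ode:
  fixes z :: complex
  assumes z: "0 \<le> Re z" "Re z \<le> 1 / 12"
  shows "norm (M 1 z - (\<delta> + z * \<sigma>2) * M 0 z) \<le> 48 * (norm z)\<^sup>2 * \<delta> * exp (2 * \<delta> * Re z)"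
  by (rule order_trans[OF M_differential_inequality[OF z]])
    (use m0_le[OF z] \<delta>_nonneg in \<open>auto intro!: mult_left_mono\<close>)

end

section \<open>The Fejer kernel\<close>

text \<open>Uniform law on \<open>[0, 1]\<close>. As a probability measure it allows Fubini's theorem for
  pairs of probability spaces.\<close>

definition unif :: "real measure" where "unif = uniform_measure lborel {0..1}"

text \<open>The Fejer kernel up to a constant factor. As a Fourier integral of a function supported in
  \<open>[-1, 1]\<close> it sees characteristic functions on a bounded interval only; it is nonnegative and
  integrable because it equals \<open>(1 - cos x) / x\<^sup>2\<close>.\<close>

definition fejer :: "real \<Rightarrow> real" where "fejer x = (\<integral>t. (1 - t) * cos (t * x) \<partial>unif)"

lemma sets_unif [simp, measurable_cong]: "sets unif = sets borel"
  by (simp add: unif_def)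

lemma prob_space_unif: "prob_space unif"
  unfolding unif_def by (intro prob_space_uniform_measure) auto

interpretation unif: prob_space unif
  by (rule prob_space_unif)

lemma AE_unif: "AE t in unif. 0 \<le> t \<and> t \<le> 1"
  unfolding unif_def by (rule AE_uniform_measureI) auto

lemma borel_measurable_fejer [measurable]: "fejer \<in> borel_measurable borel"
  unfolding fejer_def by measurable

lemma integrable_fejer_integrand: "integrable unif (\<lambda>t. (1 - t) * cos (t * x))"
proof (rule unif.integrable_const_bound[of _ 1])
  show "AE t in unif. norm ((1 - t) * cos (t * x)) \<le> 1"
    using AE_unif by eventually_elim (simp add: abs_mult mult_le_one)
qed simp

lemma abs_fejer_le_1: "\<bar>fejer x\<bar> \<le> 1"
proof -
  have "norm (fejer x) \<le> (\<integral>t. norm ((1 - t) * cos (t * x)) \<partial>unif)"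
    unfolding fejer_def by (rule integral_norm_bound)
  also have "\<dots> \<le> (\<integral>t. 1 \<partial>unif)"
  proof (rule integral_mono_AE)
    show "AE t in unif. norm ((1 - t) * cos (t * x)) \<le> 1"
      using AE_unif by eventually_elim (simp add: abs_mult mult_le_one)
  qed (intro integrable_norm integrable_fejer_integrand, simp)
  finally have "norm (fejer x) \<le> (\<integral>t. 1 \<partial>unif)" .
  then show ?thesis by (simp add: unif.prob_space)
qed

lemma integral_unif:
  fixes f :: "real \<Rightarrow> real"
  assumes [measurable]: "f \<in> borel_measurable borel"
  shows "(\<integral>t. f t \<partial>unif) = (\<integral>t. f t * indicator {0..1} t \<partial>lborel)"
proof -
  have "unif = density lborel (\<lambda>t. ennreal (indicator {0..1} t))"
    unfolding unif_def uniform_measure_def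
    by (intro density_cong) (auto split: split_indicator)
  then have "(\<integral>t. f t \<partial>unif) = (\<integral>t. f t \<partial>density lborel (\<lambda>t. ennreal (indicator {0..1} t)))" by (rule arg_cong)
  also have "\<dots> = (\<integral>t. indicator {0..1} t *\<^sub>R f t \<partial>lborel)" by (rule integral_density) auto
  finally show ?thesis by (simp add: mult.commute)
qed

lemma fejer_eq: "x \<noteq> 0 \<Longrightarrow> fejer x = (1 - cos x) / x\<^sup>2"
proof -
  assume x: "x \<noteq> 0"
  have "(\<integral>t. ((1 - t) * cos (t * x)) * indicator {0..1} t \<partial>lborel)
     = ((1 - 1) * sin (1 * x) / x - cos (1 * x) / x\<^sup>2) - ((1 - 0) * sin (0 * x) / x - cos (0 * x) / x\<^sup>2)"
  proof (rule integral_FTC_Icc_real)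
    fix t :: real
    show "((\<lambda>t. (1 - t) * sin (t * x) / x - cos (t * x) / x\<^sup>2) has_real_derivative (1 - t) * cos (t * x)) (at t)"
      using x by (auto intro!: derivative_eq_intros simp: field_simps power2_eq_square)
  qed auto
  then show ?thesis unfolding fejer_def using x
    by (subst integral_unif) (simp_all add: diff_divide_distrib)
qed

lemma fejer_nonneg: "0 \<le> fejer x"
proof (cases "x = 0")
  case True
  have "0 \<le> (\<integral>t. (1 - t) * cos (t * 0) \<partial>unif)"
    by (rule integral_nonneg_AE) (use AE_unif in eventually_elim, simp)
  with True show ?thesis by (simp add: fejer_def)
next
  case False
  then show ?thesis by (simp add: fejer_eq)
qed

lemma fejer_le: "x \<noteq> 0 \<Longrightarrow> fejer x \<le> 2 / x\<^sup>2"
  using cos_ge_minus_one[of x] by (simp add: fejer_eq divide_right_mono)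

lemma integrable_fejer: "integrable lborel fejer"
proof (rule Bochner_Integration.integrable_bound)
  show "integrable lborel (\<lambda>x::real. 4 * inverse (1 + x\<^sup>2))"
    using integrable_inverse_1_plus_square by (simp add: set_integrable_def)
  show "AE x in lborel. norm (fejer x) \<le> norm (4 * inverse (1 + x\<^sup>2))"
  proof (rule AE_I2)
    fix x :: real
    have pos: "0 < 1 + x\<^sup>2" by (simp add: add_pos_nonneg)
    show "norm (fejer x) \<le> norm (4 * inverse (1 + x\<^sup>2))"
    proof (cases "\<bar>x\<bar> \<le> 1")
      case True
      then have "x\<^sup>2 \<le> 1" by (simp add: abs_square_le_1)
      then have "1 \<le> 4 * inverse (1 + x\<^sup>2)" using pos by (simp add: field_simps)
      then show ?thesis using abs_fejer_le_1[of x] by simp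
    next
      case False
      then have "1 \<le> x\<^sup>2" "x \<noteq> 0" using abs_square_le_1[of x] by auto
      then have "2 / x\<^sup>2 \<le> 4 * inverse (1 + x\<^sup>2)" using pos by (simp add: field_simps)
      then show ?thesis using fejer_le[OF \<open>x \<noteq> 0\<close>] fejer_nonneg[of x] by simp
    qed
  qed
qed simp

definition fejer_mass :: real where "fejer_mass = (\<integral>x. fejer x \<partial>lborel)"

lemma fejer_mass_pos: "0 < fejer_mass"
proof (rule ccontr)
  assume "\<not> ?thesis"
  moreover have "0 \<le> fejer_mass" unfolding fejer_mass_def by (intro integral_nonneg_AE AE_I2 fejer_nonneg)
  ultimately have "(\<integral>x. fejer x \<partial>lborel) = 0" by (simp add: fejer_mass_def)
  then have "AE x in lborel. fejer x = 0"
    using integral_nonneg_eq_0_iff_AE[OF integrable_fejer] fejer_nonneg by auto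
  moreover have "fejer x \<noteq> 0" if "0 < x" "x < 1" for x
  proof -
    have "cos x < cos 0" using that pi_gt3 by (intro cos_monotone_0_pi) auto
    then show ?thesis using that by (simp add: fejer_eq)
  qed
  ultimately have "AE x in lborel. x \<notin> {0<..<1::real}" by (auto elim!: eventually_mono)
  then have "emeasure lborel {0<..<1::real} = 0" by (subst (asm) AE_iff_measurable[of "{0<..<1}"]) auto
  then show False by simp
qed

lemma fejer_tail_small: "0 < e \<Longrightarrow> \<exists>B>0. (\<integral>x. fejer x * indicator {x. B < \<bar>x\<bar>} x \<partial>lborel) \<le> e"
proof -
  assume e: "0 < e"
  have "(\<lambda>n. \<integral>x. fejer x * indicator {x. real (Suc n) < \<bar>x\<bar>} x \<partial>lborel) \<longlonglongrightarrow> integral\<^sup>L lborel (\<lambda>x::real. 0::real)"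
  proof (rule integral_dominated_convergence[where w = fejer])
    show "AE x in lborel. (\<lambda>n. fejer x * indicator {x. real (Suc n) < \<bar>x\<bar>} x) \<longlonglongrightarrow> 0"
    proof (rule AE_I2)
      fix x :: real
      obtain N where "\<bar>x\<bar> \<le> real N" using real_arch_simple by blast
      then have "eventually (\<lambda>n. fejer x * indicator {x. real (Suc n) < \<bar>x\<bar>} x = 0) sequentially"
        by (intro eventually_sequentiallyI[of N]) auto
      then show "(\<lambda>n. fejer x * indicator {x. real (Suc n) < \<bar>x\<bar>} x) \<longlonglongrightarrow> 0" by (rule tendsto_eventually)
    qed
    show "AE x in lborel. norm (fejer x * indicator {x. real (Suc n) < \<bar>x\<bar>} x) \<le> fejer x" for n
      using fejer_nonneg by (auto split: split_indicator)
  qed (auto simp: integrable_fejer)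
  then have "eventually (\<lambda>n. (\<integral>x. fejer x * indicator {x. real (Suc n) < \<bar>x\<bar>} x \<partial>lborel) < e) sequentially"
    using e by (intro order_tendstoD(2)[where a = e]) auto
  then obtain n where "(\<integral>x. fejer x * indicator {x. real (Suc n) < \<bar>x\<bar>} x \<partial>lborel) < e"
    by (auto simp: eventually_sequentially)
  then show ?thesis by (intro exI[of _ "real (Suc n)"]) (auto intro: less_imp_le)
qed

lemma fejer_left_tail:
  assumes b: "0 < b"
  shows "(\<integral>x. fejer x * indicator {..- b} x \<partial>lborel) \<le> 2 / b"
proof -
  have "(\<integral>x. fejer x * indicator {..- b} x \<partial>lborel)
      = \<bar>-1\<bar> *\<^sub>R (\<integral>x. fejer (0 + -1 * x) * indicator {..- b} (0 + -1 * x) \<partial>lborel)"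
    by (rule lborel_integral_real_affine) simp
  also have "\<dots> = (\<integral>x. fejer (- x) * indicator {b..} x \<partial>lborel)"
    by (simp, rule Bochner_Integration.integral_cong) (auto split: split_indicator)
  also have "\<dots> \<le> 2 / b"
  proof (rule integral_real_bounded)
    have "(\<integral>\<^sup>+x. ennreal (fejer (- x) * indicator {b..} x) \<partial>lborel) \<le> (\<integral>\<^sup>+x. ennreal (2 / x\<^sup>2) * indicator {b..} x \<partial>lborel)"
    proof (rule nn_integral_mono)
      fix x :: real
      show "ennreal (fejer (- x) * indicator {b..} x) \<le> ennreal (2 / x\<^sup>2) * indicator {b..} x"
        using fejer_le[of "- x"] b by (auto split: split_indicator intro!: ennreal_leI)
    qed
    also have "\<dots> = 0 - (- 2 / b)"
    proof (rule nn_integral_FTC_atLeast)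
      show "((\<lambda>x::real. - 2 / x) \<longlongrightarrow> 0) at_top" by (intro tendsto_divide_0[OF tendsto_const] filterlim_at_top_imp_at_infinity filterlim_ident)
      show "((\<lambda>x::real. - 2 / x) has_real_derivative 2 / x\<^sup>2) (at x)" if "b \<le> x" for x
        using that b by (auto intro!: derivative_eq_intros simp: power2_eq_square)
    qed auto
    finally show "(\<integral>\<^sup>+x. ennreal (fejer (- x) * indicator {b..} x) \<partial>lborel) \<le> ennreal (2 / b)" by simp
  qed (use b in simp)
  finally show ?thesis .
qed

section \<open>Smoothing of distribution functions\<close>

context real_distribution
begin

text \<open>Fubini: averaging the kernel at scale \<open>1 / T\<close> involves the characteristic function on
  \<open>[0, T]\<close> only.\<close>

lemma fejer_expectation_char:
  "(\<integral>y. fejer (T * (p - y)) \<partial>M) = (\<integral>t. (1 - t) * Re (iexp (- (t * T * p)) * char M (t * T)) \<partial>unif)"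
proof -
  interpret PU: pair_prob_space M unif ..
  have int: "integrable (M \<Otimes>\<^sub>M unif) (\<lambda>(y, t). (1 - t) * cos (t * (T * (p - y))))"
  proof (rule PU.Fubini_integrable)
    show "integrable M (\<lambda>y. \<integral>t. norm (case (y, t) of (y, t) \<Rightarrow> (1 - t) * cos (t * (T * (p - y)))) \<partial>unif)"
    proof (rule integrable_const_bound[of _ 1])
      show "AE y in M. norm (\<integral>t. norm (case (y, t) of (y, t) \<Rightarrow> (1 - t) * cos (t * (T * (p - y)))) \<partial>unif) \<le> 1"
      proof (rule AE_I2)
        fix y
        have "(\<integral>t. norm ((1 - t) * cos (t * (T * (p - y)))) \<partial>unif) \<le> (\<integral>t. 1 \<partial>unif)"
        proof (rule integral_mono_AE)
          show "AE t in unif. norm ((1 - t) * cos (t * (T * (p - y)))) \<le> 1"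
            using AE_unif by eventually_elim (simp add: abs_mult mult_le_one)
        qed (intro integrable_norm integrable_fejer_integrand, simp)
        then show "norm (\<integral>t. norm (case (y, t) of (y, t) \<Rightarrow> (1 - t) * cos (t * (T * (p - y)))) \<partial>unif) \<le> 1"
          by (simp add: unif.prob_space)
      qed
    qed simp
    show "AE y in M. integrable unif (\<lambda>t. case (y, t) of (y, t) \<Rightarrow> (1 - t) * cos (t * (T * (p - y))))"
      by (simp add: integrable_fejer_integrand)
  qed simp
  have cos: "(\<integral>y. cos (s * (p - y)) \<partial>M) = Re (iexp (- (s * p)) * char M s)" for s
  proof -
    have "Re (iexp (- (s * p)) * char M s) = Re (\<integral>y. iexp (- (s * p)) * iexp (s * y) \<partial>M)"
      by (simp add: char_def)
    also have "\<dots> = (\<integral>y. Re (iexp (- (s * p)) * iexp (s * y)) \<partial>M)"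
      by (rule integral_Re[symmetric]) (intro integrable_mult_right integrable_iexp, auto)
    also have "\<dots> = (\<integral>y. cos (s * (p - y)) \<partial>M)"
    proof (rule Bochner_Integration.integral_cong)
      fix y
      have "Re (iexp (- (s * p)) * iexp (s * y)) = cos (- (s * p) + s * y)"
        by (simp flip: exp_add add: Re_exp)
      also have "- (s * p) + s * y = - (s * (p - y))" by (simp add: algebra_simps)
      finally show "Re (iexp (- (s * p)) * iexp (s * y)) = cos (s * (p - y))" by simp
    qed simp
    finally show ?thesis ..
  qed
  have "(\<integral>y. fejer (T * (p - y)) \<partial>M) = (\<integral>t. (\<integral>y. (1 - t) * cos (t * (T * (p - y))) \<partial>M) \<partial>unif)"
    unfolding fejer_def by (rule PU.Fubini_integral[OF int, symmetric])
  also have "\<dots> = (\<integral>t. (1 - t) * Re (iexp (- (t * T * p)) * char M (t * T)) \<partial>unif)"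
    by (simp add: cos flip: mult.assoc)
  finally show ?thesis .
qed

text \<open>The smoothed law has the density \<open>T E fejer (T (p - Y))\<close>, up to the mass of the kernel, so its
  increment over an interval is the integral of that density.\<close>

lemma fejer_smoothed_interval:
  assumes T: "0 < T" and au: "a \<le> u"
  shows "(\<integral>x. fejer x * (cdf M (u - x / T) - cdf M (a - x / T)) \<partial>lborel)
    = (\<integral>p. T * (\<integral>y. fejer (T * (p - y)) \<partial>M) * indicator {a<..u} p \<partial>lborel)"
proof -
  interpret P: pair_sigma_finite M lborel ..
  let ?f = "\<lambda>y x. fejer x * indicator {a<..u} (y + x / T)"
  have int1: "integrable (M \<Otimes>\<^sub>M lborel) (\<lambda>(y, x). ?f y x)"
  proof (rule P.Fubini_integrable)
    have i: "integrable lborel (\<lambda>x. ?f y x)" for y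
      by (rule Bochner_Integration.integrable_bound[OF integrable_fejer])
        (auto simp: fejer_nonneg split: split_indicator)
    then show "AE y in M. integrable lborel (\<lambda>x. case (y, x) of (y, x) \<Rightarrow> ?f y x)" by simp
    show "integrable M (\<lambda>y. \<integral>x. norm (case (y, x) of (y, x) \<Rightarrow> ?f y x) \<partial>lborel)"
    proof (rule integrable_const_bound[of _ fejer_mass])
      have "(\<integral>x. norm (?f y x) \<partial>lborel) \<le> fejer_mass" for y
        unfolding fejer_mass_def
        by (intro integral_mono integrable_norm i integrable_fejer) (auto simp: fejer_nonneg split: split_indicator)
      moreover have "0 \<le> (\<integral>x. norm (?f y x) \<partial>lborel)" for y by simp
      ultimately show "AE y in M. norm (\<integral>x. norm (case (y, x) of (y, x) \<Rightarrow> ?f y x) \<partial>lborel) \<le> fejer_mass"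
        by (intro AE_I2) (simp del: integral_nonneg)
    qed simp
  qed simp
  have int2: "integrable (M \<Otimes>\<^sub>M lborel) (\<lambda>(y, p). T * (fejer (T * (p - y)) * indicator {a<..u} p))"
  proof (rule P.Fubini_integrable)
    have c: "integrable lborel (\<lambda>p. indicator {a<..u} p :: real)" using au by simp
    have i: "integrable lborel (\<lambda>p. T * (fejer (T * (p - y)) * indicator {a<..u} p))" for y
      by (intro integrable_mult_right Bochner_Integration.integrable_bound[OF c])
        (use abs_fejer_le_1 in \<open>auto split: split_indicator\<close>)
    then show "AE y in M. integrable lborel (\<lambda>p. case (y, p) of (y, p) \<Rightarrow> T * (fejer (T * (p - y)) * indicator {a<..u} p))" by simp
    show "integrable M (\<lambda>y. \<integral>p. norm (case (y, p) of (y, p) \<Rightarrow> T * (fejer (T * (p - y)) * indicator {a<..u} p)) \<partial>lborel)"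
    proof (rule integrable_const_bound[of _ "T * (u - a)"])
      have "(\<integral>p. norm (T * (fejer (T * (p - y)) * indicator {a<..u} p)) \<partial>lborel) \<le> (\<integral>p. T * indicator {a<..u} p \<partial>lborel)" for y
        using T abs_fejer_le_1 by (intro integral_mono integrable_norm i integrable_mult_right c) (auto simp: abs_mult split: split_indicator)
      then show "AE y in M. norm (\<integral>p. norm (case (y, p) of (y, p) \<Rightarrow> T * (fejer (T * (p - y)) * indicator {a<..u} p)) \<partial>lborel) \<le> T * (u - a)"
        using au by (intro AE_I2) (simp add: measure_def)
    qed simp
  qed simp
  have diff: "cdf M (u - x / T) - cdf M (a - x / T) = (\<integral>y. indicator {a<..u} (y + x / T) \<partial>M)" for x
  proof (cases "a = u")
    case False
    then have "cdf M (u - x / T) - cdf M (a - x / T) = measure M {a - x / T<..u - x / T}"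
      using au by (intro cdf_diff_eq) auto
    also have "\<dots> = (\<integral>y. indicator {a - x / T<..u - x / T} y \<partial>M)" by simp
    also have "\<dots> = (\<integral>y. indicator {a<..u} (y + x / T) \<partial>M)"
      by (intro Bochner_Integration.integral_cong) (auto split: split_indicator)
    finally show ?thesis .
  qed simp
  have "(\<integral>x. fejer x * (cdf M (u - x / T) - cdf M (a - x / T)) \<partial>lborel) = (\<integral>x. (\<integral>y. ?f y x \<partial>M) \<partial>lborel)"
    by (simp add: diff)
  also have "\<dots> = (\<integral>y. (\<integral>x. ?f y x \<partial>lborel) \<partial>M)"
    by (rule P.Fubini_integral[OF int1])
  also have "\<dots> = (\<integral>y. (\<integral>p. T * (fejer (T * (p - y)) * indicator {a<..u} p) \<partial>lborel) \<partial>M)"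
  proof (rule Bochner_Integration.integral_cong)
    fix y
    have "(\<integral>x. ?f y x \<partial>lborel) = \<bar>T\<bar> *\<^sub>R (\<integral>p. ?f y (- T * y + T * p) \<partial>lborel)"
      using T by (intro lborel_integral_real_affine) auto
    also have "\<dots> = (\<integral>p. T * (fejer (T * (p - y)) * indicator {a<..u} p) \<partial>lborel)"
    proof -
      have "- T * y + T * p = T * (p - y)" for p by (simp add: algebra_simps)
      moreover have "y + T * (p - y) / T = p" for p using T by simp
      ultimately show ?thesis using T by simp
    qed
    finally show "(\<integral>x. ?f y x \<partial>lborel) = (\<integral>p. T * (fejer (T * (p - y)) * indicator {a<..u} p) \<partial>lborel)" .
  qed simp
  also have "\<dots> = (\<integral>p. (\<integral>y. T * (fejer (T * (p - y)) * indicator {a<..u} p) \<partial>M) \<partial>lborel)"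
    by (rule P.Fubini_integral[OF int2, symmetric])
  also have "\<dots> = (\<integral>p. T * (\<integral>y. fejer (T * (p - y)) \<partial>M) * indicator {a<..u} p \<partial>lborel)"
    by (simp add: mult.assoc)
  finally show ?thesis .
qed

lemma integrable_fejer_cdf: "integrable lborel (\<lambda>x. fejer x * cdf M (v - x / T))"
proof (rule Bochner_Integration.integrable_bound[OF integrable_fejer])
  have [measurable]: "cdf M \<in> borel_measurable borel"
    by (rule borel_measurable_mono) (simp add: mono_def cdf_nondecreasing)
  show "(\<lambda>x. fejer x * cdf M (v - x / T)) \<in> borel_measurable lborel" by measurable
  show "AE x in lborel. norm (fejer x * cdf M (v - x / T)) \<le> norm (fejer x)"
    using cdf_nonneg cdf_bounded_prob by (intro AE_I2) (simp add: abs_mult mult_left_le)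
qed

text \<open>Markov's inequality for the square.\<close>

lemma cdf_tail:
  assumes "integrable M (\<lambda>x. x\<^sup>2)" "(\<integral>x. x\<^sup>2 \<partial>M) \<le> 1"
  shows "v < 0 \<Longrightarrow> cdf M v \<le> 1 / v\<^sup>2" "0 < v \<Longrightarrow> 1 - cdf M v \<le> 1 / v\<^sup>2"
proof -
  have markov: "measure M A \<le> 1 / v\<^sup>2" if A: "A \<in> sets borel" "\<And>x. x \<in> A \<Longrightarrow> v\<^sup>2 \<le> x\<^sup>2" and v: "v \<noteq> 0" for A
  proof -
    have "measure M A = (\<integral>x. indicator A x \<partial>M)" using A by simp
    also have "\<dots> \<le> (\<integral>x. x\<^sup>2 / v\<^sup>2 \<partial>M)"
      using A v by (intro integral_mono) (auto split: split_indicator intro!: assms(1) integrable_real_indicator simp: less_top[symmetric])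
    also have "\<dots> \<le> 1 / v\<^sup>2" using assms(2) by (simp add: divide_right_mono)
    finally show ?thesis .
  qed
  show "v < 0 \<Longrightarrow> cdf M v \<le> 1 / v\<^sup>2"
    unfolding cdf_def by (rule markov) (auto simp: abs_le_square_iff[symmetric])
  assume v: "0 < v"
  have "1 - cdf M v = measure M (space M - {..v})"
    using prob_compl[of "{..v}"] by (simp add: cdf_def)
  also have "space M - {..v} = {v<..}" by auto
  also have "measure M {v<..} \<le> 1 / v\<^sup>2"
    using v by (intro markov) (auto simp: abs_le_square_iff[symmetric])
  finally show "1 - cdf M v \<le> 1 / v\<^sup>2" .
qed

end

lemma std_normal_second_moment:
  "integrable std_normal_distribution (\<lambda>x. x\<^sup>2)" "(\<integral>x. x\<^sup>2 \<partial>std_normal_distribution) = 1"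
proof -
  show "integrable std_normal_distribution (\<lambda>x. x\<^sup>2)" by (rule integrable_std_normal_distribution_moment)
  show "(\<integral>x. x\<^sup>2 \<partial>std_normal_distribution) = 1"
    using std_normal_distribution_even_moments[of 1] by simp
qed

lemma std_normal_cdf_lipschitz:
  assumes "u \<le> v" shows "cdf std_normal_distribution v - cdf std_normal_distribution u \<le> v - u"
proof (cases "u = v")
  case False
  then have "cdf std_normal_distribution v - cdf std_normal_distribution u = measure std_normal_distribution {u<..v}"
    using assms by (intro std_normal.cdf_diff_eq) auto
  also have "\<dots> = (\<integral>x. indicator {u<..v} x \<partial>std_normal_distribution)" by simp
  also have "\<dots> = (\<integral>x. std_normal_density x * indicator {u<..v} x \<partial>lborel)"
    by (subst integral_density) auto
  also have "\<dots> \<le> (\<integral>x. indicator {u<..v} x \<partial>lborel)"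
  proof (rule integral_mono')
    show "integrable lborel (\<lambda>x. indicator {u<..v} x :: real)" using assms by simp
    have "std_normal_density x \<le> 1" for x
    proof -
      have "1 \<le> sqrt (2 * pi)" using pi_gt3 by simp
      moreover have "exp (- x\<^sup>2 / 2) \<le> 1" by simp
      ultimately have "exp (- x\<^sup>2 / 2) \<le> sqrt (2 * pi)" by linarith
      then show ?thesis unfolding std_normal_density_def by (simp add: field_simps)
    qed
    then show "std_normal_density x * indicator {u<..v} x \<le> indicator {u<..v} x" for x
      by (auto split: split_indicator)
  qed auto
  also have "\<dots> = v - u" using assms by simp
  finally show ?thesis .
qed simp

text \<open>The two smoothed laws have densities that differ by at most \<open>T \<eta>\<close>.\<close>

lemma (in real_distribution) fejer_smoothed_difference:
  assumes T: "0 < T" and au: "a \<le> u"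
    and char: "\<And>t. 0 \<le> t \<Longrightarrow> t \<le> T \<Longrightarrow> norm (char M t - char std_normal_distribution t) \<le> \<eta>"
  defines "D \<equiv> \<lambda>v. cdf M v - cdf std_normal_distribution v"
  shows "\<bar>(\<integral>x. fejer x * D (u - x / T) \<partial>lborel) - (\<integral>x. fejer x * D (a - x / T) \<partial>lborel)\<bar> \<le> T * \<eta> * (u - a)"
proof -
  let ?N = std_normal_distribution
  have \<eta>: "0 \<le> \<eta>" using order_trans[OF norm_ge_zero char[of 0]] T by simp
  have point: "\<bar>(\<integral>y. fejer (T * (p - y)) \<partial>M) - (\<integral>y. fejer (T * (p - y)) \<partial>?N)\<bar> \<le> \<eta>" for p
  proof -
    let ?d = "\<lambda>t. (1 - t) * Re (iexp (- (t * T * p)) * (char M (t * T) - char ?N (t * T)))"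
    have int: "integrable unif (\<lambda>t. (1 - t) * Re (iexp (- (t * T * p)) * char L (t * T)))" if "real_distribution L" for L
    proof (rule unif.integrable_const_bound[of _ 1])
      interpret L: real_distribution L by fact
      have b: "\<bar>Re (iexp (- (t * T * p)) * char L (t * T))\<bar> \<le> 1" for t
      proof -
        have "norm (iexp (- (t * T * p)) * char L (t * T)) \<le> 1"
          using L.cmod_char_le_1[of "t * T"] by (simp add: norm_mult)
        then show ?thesis by (rule order_trans[OF abs_Re_le_cmod])
      qed
      show "AE t in unif. norm ((1 - t) * Re (iexp (- (t * T * p)) * char L (t * T))) \<le> 1"
        using AE_unif
      proof eventually_elim
        fix t :: real assume t: "0 \<le> t \<and> t \<le> 1"
        have "\<bar>1 - t\<bar> * \<bar>Re (iexp (- (t * T * p)) * char L (t * T))\<bar> \<le> 1 * 1"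
          using t by (intro mult_mono b) auto
        then show "norm ((1 - t) * Re (iexp (- (t * T * p)) * char L (t * T))) \<le> 1"
          by (simp only: real_norm_def abs_mult)
      qed
      define g where "g t = char L (t * T)" for t
      have [measurable]: "g \<in> borel_measurable borel"
        unfolding g_def[abs_def] by (rule measurable_compose[OF _ L.char_measurable]) measurable
      show "(\<lambda>t. (1 - t) * Re (iexp (- (t * T * p)) * char L (t * T))) \<in> borel_measurable unif"
        unfolding g_def[symmetric] by measurable
    qed
    have d: "?d t = (1 - t) * Re (iexp (- (t * T * p)) * char M (t * T)) - (1 - t) * Re (iexp (- (t * T * p)) * char ?N (t * T))" for t
      unfolding right_diff_distrib minus_complex.sel ..
    have diff: "(\<integral>y. fejer (T * (p - y)) \<partial>M) - (\<integral>y. fejer (T * (p - y)) \<partial>?N) = (\<integral>t. ?d t \<partial>unif)"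
      unfolding fejer_expectation_char std_normal.fejer_expectation_char d
      by (rule Bochner_Integration.integral_diff[symmetric, OF int[OF real_distribution_axioms] int[OF std_normal.real_distribution_axioms]])
    have "\<bar>(\<integral>y. fejer (T * (p - y)) \<partial>M) - (\<integral>y. fejer (T * (p - y)) \<partial>?N)\<bar> \<le> (\<integral>t. \<bar>?d t\<bar> \<partial>unif)"
      unfolding diff by (rule integral_abs_bound)
    also have "\<dots> \<le> (\<integral>t. \<eta> \<partial>unif)"
    proof (rule integral_mono_AE)
      show "integrable unif (\<lambda>t. \<bar>?d t\<bar>)"
        unfolding d by (intro integrable_abs Bochner_Integration.integrable_diff int std_normal.real_distribution_axioms real_distribution_axioms)
      show "AE t in unif. \<bar>?d t\<bar> \<le> \<eta>"
        using AE_unif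
      proof eventually_elim
        fix t :: real assume t: "0 \<le> t \<and> t \<le> 1"
        have "t * T \<le> 1 * T" using t T by (intro mult_right_mono) auto
        then have "norm (iexp (- (t * T * p)) * (char M (t * T) - char ?N (t * T))) \<le> \<eta>"
          using char[of "t * T"] t T by (simp add: norm_mult)
        then have "\<bar>Re (iexp (- (t * T * p)) * (char M (t * T) - char ?N (t * T)))\<bar> \<le> \<eta>"
          by (rule order_trans[OF abs_Re_le_cmod])
        then have "(1 - t) * \<bar>Re (iexp (- (t * T * p)) * (char M (t * T) - char ?N (t * T)))\<bar> \<le> 1 * \<eta>"
          using t by (intro mult_mono) auto
        then show "\<bar>?d t\<bar> \<le> \<eta>" using t by (simp only: abs_mult) simp
      qed
    qed simp
    finally show ?thesis by (simp add: unif.prob_space)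
  qed
  let ?g = "\<lambda>L p. T * (\<integral>y. fejer (T * (p - y)) \<partial>L) * indicator {a<..u} p"
  have int_g: "integrable lborel (?g L)" if "real_distribution L" for L
  proof -
    interpret L: real_distribution L by fact
    have [measurable]: "(\<lambda>p. \<integral>y. fejer (T * (p - y)) \<partial>L) \<in> borel_measurable borel" by measurable
    have "\<bar>\<integral>y. fejer (T * (p - y)) \<partial>L\<bar> \<le> 1" for p
    proof -
      have i: "integrable L (\<lambda>y. fejer (T * (p - y)))"
        using abs_fejer_le_1 by (intro L.integrable_const_bound[of _ 1]) auto
      have "\<bar>\<integral>y. fejer (T * (p - y)) \<partial>L\<bar> \<le> (\<integral>y. \<bar>fejer (T * (p - y))\<bar> \<partial>L)" by (rule integral_abs_bound)
      also have "\<dots> \<le> (\<integral>y. 1 \<partial>L)"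
        using abs_fejer_le_1 i by (intro integral_mono integrable_abs) auto
      finally show ?thesis using L.prob_space by simp
    qed
    then have b: "norm (?g L p) \<le> norm (T * indicator {a<..u} p)" for p
      using T by (auto simp: abs_mult split: split_indicator)
    have i: "integrable lborel (\<lambda>p. T * indicator {a<..u} p)" using au by simp
    have "?g L \<in> borel_measurable lborel" by measurable
    then show ?thesis by (rule Bochner_Integration.integrable_bound[OF i]) (intro AE_I2 b)
  qed
  have eq: "(\<integral>x. fejer x * D (u - x / T) \<partial>lborel) - (\<integral>x. fejer x * D (a - x / T) \<partial>lborel)
     = (\<integral>p. ?g M p \<partial>lborel) - (\<integral>p. ?g ?N p \<partial>lborel)"
  proof -
    have split: "(\<integral>x. fejer x * (f x - g x) \<partial>lborel) = (\<integral>x. fejer x * f x \<partial>lborel) - (\<integral>x. fejer x * g x \<partial>lborel)"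
      if "integrable lborel (\<lambda>x. fejer x * f x)" "integrable lborel (\<lambda>x. fejer x * g x)" for f g
      unfolding right_diff_distrib by (rule Bochner_Integration.integral_diff[OF that])
    show ?thesis
      unfolding fejer_smoothed_interval[OF T au, symmetric] std_normal.fejer_smoothed_interval[OF T au, symmetric] D_def
        split[OF integrable_fejer_cdf integrable_fejer_cdf] split[OF std_normal.integrable_fejer_cdf std_normal.integrable_fejer_cdf]
        split[OF integrable_fejer_cdf std_normal.integrable_fejer_cdf] by simp
  qed
  have eq': "(\<integral>p. ?g M p \<partial>lborel) - (\<integral>p. ?g ?N p \<partial>lborel) = (\<integral>p. ?g M p - ?g ?N p \<partial>lborel)"
    by (rule Bochner_Integration.integral_diff[symmetric, OF int_g[OF real_distribution_axioms] int_g[OF std_normal.real_distribution_axioms]])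
  have "\<bar>(\<integral>x. fejer x * D (u - x / T) \<partial>lborel) - (\<integral>x. fejer x * D (a - x / T) \<partial>lborel)\<bar>
      \<le> (\<integral>p. \<bar>?g M p - ?g ?N p\<bar> \<partial>lborel)"
    unfolding eq eq' by (rule integral_abs_bound)
  also have "\<dots> \<le> (\<integral>p. T * \<eta> * indicator {a<..u} p \<partial>lborel)"
  proof (rule integral_mono')
    show "integrable lborel (\<lambda>p. T * \<eta> * indicator {a<..u} p)" using au by simp
    show "\<bar>?g M p - ?g ?N p\<bar> \<le> T * \<eta> * indicator {a<..u} p" for p
    proof (cases "p \<in> {a<..u}")
      case True
      have "\<bar>T * ((\<integral>y. fejer (T * (p - y)) \<partial>M) - (\<integral>y. fejer (T * (p - y)) \<partial>?N))\<bar> \<le> T * \<eta>"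
        using T point[of p] by (simp add: abs_mult mult_left_mono)
      then show ?thesis using True by (simp add: right_diff_distrib)
    qed simp
  qed (use T \<eta> in simp)
  also have "\<dots> = T * \<eta> * (u - a)" using au by simp
  finally show ?thesis .
qed

text \<open>Let \<open>\<Delta>\<close> be the supremum of the absolute difference \<open>D\<close> of the distribution functions. At a
  point where \<open>\<bar>D\<bar>\<close> is nearly \<open>\<Delta>\<close>, monotonicity of one function and the Lipschitz bound for the
  normal one keep \<open>\<bar>D\<bar>\<close> at least \<open>0.4 \<Delta>\<close>, with the same sign of \<open>D\<close>, on an interval of length \<open>\<Delta> / 2\<close> to one side. Unless
  \<open>\<Delta>\<close> is of order \<open>1 / T\<close> already, most of the mass of the kernel at scale \<open>1 / T\<close>, centred
  at the midpoint, falls into that interval, so that the smoothed difference is at least a constant times \<open>\<Delta>\<close>.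
  Closeness of the characteristic functions bounds the smoothed difference by order \<open>1 / T\<close>.
  The second moments confine the argument to a bounded range: the smoothed densities are only
  close to each other pointwise, and the accuracy \<open>1 / T\<^sup>4\<close> is what an interval of length of order
  \<open>T\<^sup>2\<close> requires.\<close>

lemma esseen_smoothing:
  obtains C where "0 < C"
    "\<And>\<mu> T u. real_distribution \<mu> \<Longrightarrow> integrable \<mu> (\<lambda>x. x\<^sup>2) \<Longrightarrow> (\<integral>x. x\<^sup>2 \<partial>\<mu>) \<le> 1 \<Longrightarrow> 1 \<le> T \<Longrightarrow>
      (\<And>t. 0 \<le> t \<Longrightarrow> t \<le> T \<Longrightarrow> norm (char \<mu> t - char std_normal_distribution t) \<le> 1 / T ^ 4) \<Longrightarrow>
      \<bar>cdf \<mu> u - cdf std_normal_distribution u\<bar> \<le> C / T"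
proof -
  let ?N = std_normal_distribution
  let ?\<kappa> = fejer_mass
  note \<kappa> = fejer_mass_pos
  obtain B where B: "0 < B" "(\<integral>x. fejer x * indicator {x. B < \<bar>x\<bar>} x \<partial>lborel) \<le> ?\<kappa> / 10"
    using fejer_tail_small[of "?\<kappa> / 10"] \<kappa> by auto
  \<comment> \<open>The summands belong to three cases: \<open>\<Delta>\<close> too small for the kernel to fit into the interval, \<open>\<Delta>\<close> below the tail bound at \<open>T\<close>, and the main case.\<close>
  define C where "C = 4 * B + 2 + 4 / ?\<kappa> * (?\<kappa> + 8)"
  have C: "0 < C" using B(1) \<kappa> unfolding C_def by (intro add_pos_pos mult_pos_pos divide_pos_pos) auto
  show thesis
  proof (rule that[OF C])
    fix \<mu> :: "real measure" and T u :: real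
    assume "real_distribution \<mu>" and mom: "integrable \<mu> (\<lambda>x. x\<^sup>2)" "(\<integral>x. x\<^sup>2 \<partial>\<mu>) \<le> 1" and T: "1 \<le> T"
      and char: "\<And>t. 0 \<le> t \<Longrightarrow> t \<le> T \<Longrightarrow> norm (char \<mu> t - char ?N t) \<le> 1 / T ^ 4"
    interpret \<mu>: real_distribution \<mu> by fact
    define D where "D v = cdf \<mu> v - cdf ?N v" for v
    define DT where "DT v = (\<integral>x. fejer x * D (v - x / T) \<partial>lborel)" for v
    have N_mom: "integrable ?N (\<lambda>x. x\<^sup>2)" "(\<integral>x. x\<^sup>2 \<partial>?N) \<le> 1" using std_normal_second_moment by auto
    have D1: "\<bar>D v\<bar> \<le> 1" for v
      using \<mu>.cdf_nonneg[of v] \<mu>.cdf_bounded_prob[of v] std_normal.cdf_nonneg[of v] std_normal.cdf_bounded_prob[of v] by (simp add: D_def)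
    have D_tail: "\<bar>D v\<bar> \<le> 1 / v\<^sup>2" if "v \<noteq> 0" for v
      using that \<mu>.cdf_nonneg[of v] \<mu>.cdf_bounded_prob[of v] std_normal.cdf_nonneg[of v] std_normal.cdf_bounded_prob[of v]
        \<mu>.cdf_tail[OF mom, of v] std_normal.cdf_tail[OF N_mom, of v]
      by (cases "v < 0") (auto simp: D_def abs_le_iff)
    have int_D: "integrable lborel (\<lambda>x. fejer x * D (v - x / T))" for v
      unfolding D_def right_diff_distrib
      by (intro Bochner_Integration.integrable_diff \<mu>.integrable_fejer_cdf std_normal.integrable_fejer_cdf)
    have T2: "1 \<le> T\<^sup>2" "1 \<le> T ^ 3" "1 \<le> T ^ 4" using T by auto
    have TT: "T \<le> T\<^sup>2" "T\<^sup>2 \<le> T ^ 4" "T \<le> T ^ 3" "T \<le> T ^ 4"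
      using T power_increasing[of 1 2 T] power_increasing[of 2 4 T] power_increasing[of 1 3 T] power_increasing[of 1 4 T] by auto
    \<comment> \<open>So far to the left that the tail bounds alone make the smoothed difference small; from here on differences are integrated.\<close>
    define a where "a = - (2 * T\<^sup>2)"
    have DT_a: "\<bar>DT a\<bar> \<le> (?\<kappa> + 4) / T"
    proof -
      have "\<bar>DT a\<bar> \<le> (\<integral>x. \<bar>fejer x * D (a - x / T)\<bar> \<partial>lborel)" unfolding DT_def by (rule integral_abs_bound)
      also have "\<dots> \<le> (\<integral>x. fejer x * (1 / T ^ 4) + fejer x * indicator {..- (T ^ 3)} x \<partial>lborel)"
      proof (rule integral_mono)
        have i: "integrable lborel (\<lambda>x. fejer x * indicator {..- (T ^ 3)} x)"
          by (rule Bochner_Integration.integrable_bound[OF integrable_fejer]) (auto split: split_indicator)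
        show "integrable lborel (\<lambda>x. \<bar>fejer x * D (a - x / T)\<bar>)" by (intro integrable_abs int_D)
        show "integrable lborel (\<lambda>x. fejer x * (1 / T ^ 4) + fejer x * indicator {..- (T ^ 3)} x)"
          by (intro Bochner_Integration.integrable_add integrable_mult_left integrable_fejer i)
        fix x
        show "\<bar>fejer x * D (a - x / T)\<bar> \<le> fejer x * (1 / T ^ 4) + fejer x * indicator {..- (T ^ 3)} x"
        proof (cases "x \<le> - (T ^ 3)")
          case True
          have "fejer x * \<bar>D (a - x / T)\<bar> \<le> fejer x * 1" by (intro mult_left_mono D1 fejer_nonneg)
          moreover have "0 \<le> fejer x * (1 / T ^ 4)" using T fejer_nonneg[of x] by simp
          ultimately have "fejer x * \<bar>D (a - x / T)\<bar> \<le> fejer x * (1 / T ^ 4) + fejer x * 1" by linarith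
          then show ?thesis using True fejer_nonneg[of x] by (simp add: abs_mult)
        next
          case False
          then have "- (x / T) < T\<^sup>2"
            using T by (simp add: field_simps power2_eq_square power3_eq_cube)
          then have v: "a - x / T < - (T\<^sup>2)" by (simp add: a_def)
          then have "\<bar>T\<^sup>2\<bar> \<le> \<bar>a - x / T\<bar>" using T2(1) by linarith
          then have "(T\<^sup>2)\<^sup>2 \<le> (a - x / T)\<^sup>2" by (simp only: abs_le_square_iff)
          then have "1 / (a - x / T)\<^sup>2 \<le> 1 / (T\<^sup>2)\<^sup>2" using T by (intro frac_le) simp_all
          then have "1 / (a - x / T)\<^sup>2 \<le> 1 / T ^ 4" by (simp flip: power_mult)
          moreover have "\<bar>D (a - x / T)\<bar> \<le> 1 / (a - x / T)\<^sup>2" using v T2(1) by (intro D_tail) linarith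
          ultimately have "\<bar>D (a - x / T)\<bar> \<le> 1 / T ^ 4" by linarith
          then have "fejer x * \<bar>D (a - x / T)\<bar> \<le> fejer x * (1 / T ^ 4)" by (intro mult_left_mono fejer_nonneg)
          then show ?thesis using False fejer_nonneg[of x] by (simp add: abs_mult)
        qed
      qed
      also have "\<dots> = ?\<kappa> * (1 / T ^ 4) + (\<integral>x. fejer x * indicator {..- (T ^ 3)} x \<partial>lborel)"
      proof -
        have i: "integrable lborel (\<lambda>x. fejer x * indicator {..- (T ^ 3)} x)"
          by (rule Bochner_Integration.integrable_bound[OF integrable_fejer]) (auto split: split_indicator)
        show ?thesis unfolding fejer_mass_def
          by (subst Bochner_Integration.integral_add) (simp_all add: integrable_fejer i)
      qed
      also have "\<dots> \<le> ?\<kappa> * (1 / T) + 4 / T"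
      proof (rule add_mono)
        show "?\<kappa> * (1 / T ^ 4) \<le> ?\<kappa> * (1 / T)"
          using TT T \<kappa> by (intro mult_left_mono divide_left_mono) auto
        have "(\<integral>x. fejer x * indicator {..- (T ^ 3)} x \<partial>lborel) \<le> 2 / T ^ 3"
          using T2 by (intro fejer_left_tail) linarith
        also have "\<dots> \<le> 4 / T" using TT T by (intro frac_le) auto
        finally show "(\<integral>x. fejer x * indicator {..- (T ^ 3)} x \<partial>lborel) \<le> 4 / T" .
      qed
      finally show ?thesis by (simp add: add_divide_distrib)
    qed
    have DT_bound: "\<bar>DT v\<bar> \<le> (?\<kappa> + 8) / T" if v: "- T - 1 / 2 \<le> v" "v \<le> T + 1 / 2" for v
    proof -
      have av: "a \<le> v" using v(1) TT(1) T T2(1) unfolding a_def by linarith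
      have "v - a \<le> 4 * T\<^sup>2" using v(2) TT(1) T T2(1) unfolding a_def by linarith
      then have "T * (1 / T ^ 4) * (v - a) \<le> T * (1 / T ^ 4) * (4 * T\<^sup>2)"
        using T by (intro mult_left_mono) auto
      also have "\<dots> = 4 / T" using T by (simp add: power2_eq_square power4_eq_xxxx)
      finally have 4: "T * (1 / T ^ 4) * (v - a) \<le> 4 / T" .
      have "0 < T" using T by simp
      from \<mu>.fejer_smoothed_difference[OF this av char]
      have "\<bar>DT v - DT a\<bar> \<le> T * (1 / T ^ 4) * (v - a)" unfolding DT_def D_def .
      with 4 have "\<bar>DT v - DT a\<bar> \<le> 4 / T" by linarith
      then show ?thesis using DT_a by (simp add: add_divide_distrib)
    qed
    define \<Delta> where "\<Delta> = (SUP v. \<bar>D v\<bar>)"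
    have bdd: "bdd_above (range (\<lambda>v. \<bar>D v\<bar>))" using D1 by (intro bdd_aboveI[of _ 1]) auto
    have D_le: "\<bar>D v\<bar> \<le> \<Delta>" for v unfolding \<Delta>_def by (rule cSUP_upper[OF _ bdd]) simp
    have \<Delta>1: "\<Delta> \<le> 1" unfolding \<Delta>_def by (rule cSUP_least) (auto simp: D1)
    have "\<Delta> \<le> C / T"
    proof (cases "\<Delta> \<le> 4 * B / T \<or> \<Delta> \<le> 2 / T")
      case True
      moreover have "4 * B / T \<le> C / T" "2 / T \<le> C / T"
        using T B(1) \<kappa> by (auto simp: C_def intro!: divide_right_mono)
      ultimately show ?thesis by linarith
    next
      case False
      then have \<Delta>B: "4 * B / T < \<Delta>" and \<Delta>2: "2 / T < \<Delta>" by auto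
      have \<Delta>0: "0 < \<Delta>" by (rule order.strict_trans[OF _ \<Delta>2]) (use T in simp)
      have "\<exists>v. 9 / 10 * \<Delta> < \<bar>D v\<bar>"
        using less_cSUP_iff[OF _ bdd, of "9 / 10 * \<Delta>"] \<Delta>0 unfolding \<Delta>_def[symmetric] by simp
      then obtain v where v: "9 / 10 * \<Delta> < \<bar>D v\<bar>" by blast
      have vT: "\<bar>v\<bar> < T"
      proof (rule ccontr)
        assume "\<not> ?thesis"
        then have vT: "T \<le> \<bar>v\<bar>" by simp
        then have "T * 1 \<le> \<bar>v\<bar> * \<bar>v\<bar>" using T by (intro mult_mono) auto
        then have "T \<le> v\<^sup>2" by (simp add: power2_eq_square)
        then have "1 / v\<^sup>2 \<le> 1 / T" using T by (intro frac_le) auto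
        moreover have "\<bar>D v\<bar> \<le> 1 / v\<^sup>2" using vT T by (intro D_tail) auto
        ultimately have "9 / 10 * \<Delta> < 1 / T" using v by linarith
        moreover have "0 < 1 / T" "2 / T = 2 * (1 / T)" using T by auto
        ultimately show False using \<Delta>2 by linarith
      qed
      define h where "h = \<Delta> / 2"
      have h: "0 < h" "h \<le> 1 / 2" using \<Delta>0 \<Delta>1 by (auto simp: h_def)
      have hB: "\<bar>x / T\<bar> \<le> h / 2" if "\<bar>x\<bar> \<le> B" for x
      proof -
        have "\<bar>x / T\<bar> \<le> B / T" using that T by (simp add: divide_right_mono)
        also have "\<dots> \<le> h / 2" using \<Delta>B by (simp add: h_def mult.commute)
        finally show ?thesis .
      qed
      have lower: "?\<kappa> * (\<Delta> / 4) \<le> (\<integral>x. fejer x * G x \<partial>lborel)"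
        if G: "integrable lborel (\<lambda>x. fejer x * G x)" "\<And>x. - \<Delta> \<le> G x" "\<And>x. \<bar>x\<bar> \<le> B \<Longrightarrow> 4 / 10 * \<Delta> \<le> G x" for G
      proof -
        let ?t = "\<lambda>x. fejer x * indicator {x. B < \<bar>x\<bar>} x"
        have i: "integrable lborel ?t"
          by (rule Bochner_Integration.integrable_bound[OF integrable_fejer]) (auto split: split_indicator)
        \<comment> \<open>A fraction \<open>0.9\<close> of the mass sees at least \<open>0.4 \<Delta>\<close> and the rest at worst \<open>- \<Delta>\<close>: \<open>0.4 - 0.1 * 1.4 \<ge> 1/4\<close>.\<close>
        have "(\<integral>x. ?t x \<partial>lborel) * (14 / 10 * \<Delta>) \<le> ?\<kappa> / 10 * (14 / 10 * \<Delta>)"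
          using B(2) \<Delta>0 by (intro mult_right_mono) auto
        then have "?\<kappa> * (\<Delta> / 4) \<le> ?\<kappa> * (4 / 10 * \<Delta>) - (\<integral>x. ?t x \<partial>lborel) * (14 / 10 * \<Delta>)"
          using mult_pos_pos[OF \<kappa> \<Delta>0] by (simp add: field_simps)
        also have "\<dots> = (\<integral>x. fejer x * (4 / 10 * \<Delta>) - ?t x * (14 / 10 * \<Delta>) \<partial>lborel)"
          unfolding fejer_mass_def by (simp add: integrable_fejer i)
        also have "\<dots> \<le> (\<integral>x. fejer x * G x \<partial>lborel)"
        proof (rule integral_mono[OF _ G(1)])
          show "integrable lborel (\<lambda>x. fejer x * (4 / 10 * \<Delta>) - ?t x * (14 / 10 * \<Delta>))"
            by (intro Bochner_Integration.integrable_diff integrable_mult_left integrable_fejer i)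
          fix x
          show "fejer x * (4 / 10 * \<Delta>) - ?t x * (14 / 10 * \<Delta>) \<le> fejer x * G x"
          proof (cases "\<bar>x\<bar> \<le> B")
            case True
            then show ?thesis using mult_left_mono[OF G(3)[OF True] fejer_nonneg[of x]] by simp
          next
            case False
            then show ?thesis using mult_left_mono[OF G(2)[of x] fejer_nonneg[of x]] by (simp add: algebra_simps)
          qed
        qed
        finally show ?thesis .
      qed
      have "\<exists>w. - T - 1 / 2 \<le> w \<and> w \<le> T + 1 / 2 \<and> ?\<kappa> * (\<Delta> / 4) \<le> \<bar>DT w\<bar>"
      proof (cases "0 \<le> D v")
        case True
        define w where "w = v + h / 2"
        have "?\<kappa> * (\<Delta> / 4) \<le> DT w"
          unfolding DT_def
        proof (rule lower[OF int_D])
          show "- \<Delta> \<le> D (w - x / T)" for x using D_le[of "w - x / T"] by linarith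
          fix x assume "\<bar>x\<bar> \<le> B"
          then have y: "v \<le> w - x / T" "w - x / T \<le> v + h" using hB[of x] unfolding w_def by linarith+
          have "cdf \<mu> v \<le> cdf \<mu> (w - x / T)" using y by (intro \<mu>.cdf_nondecreasing)
          moreover have "cdf ?N (w - x / T) - cdf ?N v \<le> h" using std_normal_cdf_lipschitz[OF y(1)] y(2) by linarith
          ultimately have "D v - h \<le> D (w - x / T)" by (simp add: D_def)
          then show "4 / 10 * \<Delta> \<le> D (w - x / T)" using v True by (simp add: h_def)
        qed
        then show ?thesis using vT h by (intro exI[of _ w]) (auto simp: w_def)
      next
        case False
        define w where "w = v - h / 2"
        have "?\<kappa> * (\<Delta> / 4) \<le> (\<integral>x. fejer x * (- D (w - x / T)) \<partial>lborel)"
        proof (rule lower)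
          show "integrable lborel (\<lambda>x. fejer x * - D (w - x / T))" using int_D[of w] by simp
          show "- \<Delta> \<le> - D (w - x / T)" for x using D_le[of "w - x / T"] by linarith
          fix x assume "\<bar>x\<bar> \<le> B"
          then have y: "w - x / T \<le> v" "v - h \<le> w - x / T" using hB[of x] unfolding w_def by linarith+
          have "cdf \<mu> (w - x / T) \<le> cdf \<mu> v" using y by (intro \<mu>.cdf_nondecreasing)
          moreover have "cdf ?N v - cdf ?N (w - x / T) \<le> h" using std_normal_cdf_lipschitz[OF y(1)] y(2) by linarith
          ultimately have "D (w - x / T) \<le> D v + h" by (simp add: D_def)
          then show "4 / 10 * \<Delta> \<le> - D (w - x / T)" using v False by (simp add: h_def)
        qed
        then have "?\<kappa> * (\<Delta> / 4) \<le> - DT w" by (simp add: DT_def)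
        then show ?thesis using vT h by (intro exI[of _ w]) (auto simp: w_def)
      qed
      then obtain w where "- T - 1 / 2 \<le> w" "w \<le> T + 1 / 2" "?\<kappa> * (\<Delta> / 4) \<le> \<bar>DT w\<bar>" by blast
      with DT_bound[of w] have "?\<kappa> * (\<Delta> / 4) \<le> (?\<kappa> + 8) / T" by linarith
      then have "4 / ?\<kappa> * (?\<kappa> * (\<Delta> / 4)) \<le> 4 / ?\<kappa> * ((?\<kappa> + 8) / T)"
        using \<kappa> by (intro mult_left_mono) auto
      then have "\<Delta> \<le> 4 / ?\<kappa> * (?\<kappa> + 8) / T" using \<kappa> by simp
      also have "\<dots> \<le> C / T" using T B(1) unfolding C_def by (intro divide_right_mono) auto
      finally show ?thesis .
    qed
    then show "\<bar>cdf \<mu> u - cdf ?N u\<bar> \<le> C / T" using D_le[of u] by (simp add: D_def)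
  qed
qed

section \<open>Transforms of chi-squared laws\<close>

lemma integrable_std_normal_exp_square:
  fixes z :: complex
  assumes z: "Re z < 1 / 2"
  shows "integrable std_normal_distribution (\<lambda>t. exp (z * of_real (t\<^sup>2)))"
    "integrable std_normal_distribution (\<lambda>t. t\<^sup>2 *\<^sub>R exp (z * of_real (t\<^sup>2)))"
proof -
  have i: "integrable std_normal_distribution (\<lambda>t. exp (r * t\<^sup>2))" if "r < 1 / 2" for r
    by (rule integrableI_nonneg) (simp_all add: nn_integral_std_normal_exp_square[OF that])
  show "integrable std_normal_distribution (\<lambda>t. exp (z * of_real (t\<^sup>2)))"
    by (rule Bochner_Integration.integrable_bound[OF i[OF z]]) auto
  define \<eta> where "\<eta> = (1 / 2 - Re z) / 2"
  have \<eta>: "0 < \<eta>" "Re z + \<eta> < 1 / 2" using z by (auto simp: \<eta>_def field_simps)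
  show "integrable std_normal_distribution (\<lambda>t. t\<^sup>2 *\<^sub>R exp (z * of_real (t\<^sup>2)))"
  proof (rule Bochner_Integration.integrable_bound[OF integrable_mult_right[OF i[OF \<eta>(2)], of "1 / \<eta>"]])
    have "t\<^sup>2 * exp (Re z * t\<^sup>2) \<le> 1 / \<eta> * exp ((Re z + \<eta>) * t\<^sup>2)" for t :: real
    proof -
      have "\<eta> * t\<^sup>2 \<le> exp (\<eta> * t\<^sup>2)" using exp_ge_add_one_self[of "\<eta> * t\<^sup>2"] by linarith
      then have "t\<^sup>2 \<le> 1 / \<eta> * exp (\<eta> * t\<^sup>2)" using \<eta>(1) by (simp add: field_simps)
      then have "t\<^sup>2 * exp (Re z * t\<^sup>2) \<le> 1 / \<eta> * exp (\<eta> * t\<^sup>2) * exp (Re z * t\<^sup>2)"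
        by (rule mult_right_mono) simp
      also have "\<dots> = 1 / \<eta> * exp ((Re z + \<eta>) * t\<^sup>2)" by (simp add: distrib_right exp_add)
      finally show ?thesis .
    qed
    then show "AE t in std_normal_distribution. norm (t\<^sup>2 *\<^sub>R exp (z * of_real (t\<^sup>2))) \<le> norm (1 / \<eta> * exp ((Re z + \<eta>) * t\<^sup>2))"
      using \<eta>(1) by (intro AE_I2) simp
  qed measurable
qed

text \<open>Stein's identity for \<open>t exp (z t\<^sup>2)\<close>.\<close>

lemma std_normal_integration_by_parts:
  fixes z :: complex
  assumes z: "Re z < 1 / 2"
  shows "(1 - 2 * z) * (\<integral>t. t\<^sup>2 *\<^sub>R exp (z * of_real (t\<^sup>2)) \<partial>std_normal_distribution)
     = (\<integral>t. exp (z * of_real (t\<^sup>2)) \<partial>std_normal_distribution)"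
proof -
  \<comment> \<open>The normal density turns \<open>exp (z t\<^sup>2)\<close> into a multiple of \<open>exp (- w t\<^sup>2)\<close>, and \<open>g\<close> below is the derivative of \<open>G\<close>.\<close>
  define w where "w = (1 - 2 * z) / 2"
  have w: "0 < Re w" using z by (simp add: w_def)
  define G where "G t = of_real t * exp (- w * of_real (t\<^sup>2))" for t :: real
  define g where "g t = exp (- w * of_real (t\<^sup>2)) - (2 * w) * (t\<^sup>2 *\<^sub>R exp (- w * of_real (t\<^sup>2)))" for t :: real
  have conv: "std_normal_density t *\<^sub>R exp (z * of_real (t\<^sup>2)) = (1 / sqrt (2 * pi)) *\<^sub>R exp (- w * of_real (t\<^sup>2))" for t :: real
  proof -
    have "exp (- w * of_real (t\<^sup>2)) = exp (of_real (- t\<^sup>2 / 2) + z * of_real (t\<^sup>2))"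
      by (rule arg_cong[of _ _ exp]) (simp add: w_def field_simps)
    also have "\<dots> = of_real (exp (- t\<^sup>2 / 2)) * exp (z * of_real (t\<^sup>2))"
      by (simp only: exp_add exp_of_real)
    finally show ?thesis by (simp add: std_normal_density_def scaleR_conv_of_real)
  qed
  define k where "k = 1 / sqrt (2 * pi)"
  have k: "k \<noteq> 0" by (simp add: k_def)
  note conv = conv[folded k_def]
  have i0: "integrable lborel (\<lambda>t::real. exp (- w * of_real (t\<^sup>2)))"
  proof -
    have "integrable lborel (\<lambda>t. std_normal_density t *\<^sub>R exp (z * of_real (t\<^sup>2)))"
      using integrable_std_normal_exp_square(1)[OF z] by (subst (asm) integrable_density) auto
    from integrable_scaleR_right[OF this[unfolded conv], of "1 / k"] show ?thesis using k by simp
  qed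
  have i2: "integrable lborel (\<lambda>t::real. t\<^sup>2 *\<^sub>R exp (- w * of_real (t\<^sup>2)))"
  proof -
    have "integrable lborel (\<lambda>t. std_normal_density t *\<^sub>R (t\<^sup>2 *\<^sub>R exp (z * of_real (t\<^sup>2))))"
      using integrable_std_normal_exp_square(2)[OF z] by (subst (asm) integrable_density) auto
    then have "integrable lborel (\<lambda>t. k *\<^sub>R (t\<^sup>2 *\<^sub>R exp (- w * of_real (t\<^sup>2))))"
      unfolding scaleR_left_commute[of "std_normal_density _"] conv by (simp only: scaleR_left_commute)
    from integrable_scaleR_right[OF this, of "1 / k"] show ?thesis using k by simp
  qed
  have int_g: "integrable lborel g"
    unfolding g_def by (intro Bochner_Integration.integrable_diff i0 integrable_mult_right i2)
  have lim: "(G \<longlongrightarrow> 0) at_infinity"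
  proof (rule Lim_null_comparison)
    show "((\<lambda>t. 1 / Re w * \<bar>inverse t\<bar>) \<longlongrightarrow> 0) at_infinity"
      using tendsto_mult_right_zero[OF tendsto_rabs_zero[OF tendsto_inverse_0]] by blast
    have "norm (G t) \<le> 1 / Re w * \<bar>inverse t\<bar>" for t
    proof (cases "t = 0")
      case False
      have e: "norm (G t) = \<bar>t\<bar> * exp (- (Re w * t\<^sup>2))" by (simp add: G_def norm_mult)
      have "Re w * t\<^sup>2 \<le> exp (Re w * t\<^sup>2)" using exp_ge_add_one_self[of "Re w * t\<^sup>2"] by linarith
      then have "Re w * t\<^sup>2 * exp (- (Re w * t\<^sup>2)) \<le> exp (Re w * t\<^sup>2) * exp (- (Re w * t\<^sup>2))"
        by (rule mult_right_mono) simp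
      also have "\<dots> = 1" by (simp flip: exp_add)
      finally have "Re w * t\<^sup>2 * exp (- (Re w * t\<^sup>2)) \<le> 1" .
      moreover have "(Re w * \<bar>t\<bar>) * norm (G t) = Re w * (\<bar>t\<bar> * \<bar>t\<bar>) * exp (- (Re w * t\<^sup>2))"
        unfolding e by (simp only: mult_ac)
      moreover have "\<bar>t\<bar> * \<bar>t\<bar> = t\<^sup>2" by (simp add: power2_eq_square)
      ultimately have "(Re w * \<bar>t\<bar>) * norm (G t) \<le> 1" by (simp only:)
      then show ?thesis using w False by (simp add: field_simps)
    qed (simp add: G_def)
    then show "\<forall>\<^sub>F t in at_infinity. norm (G t) \<le> 1 / Re w * \<bar>inverse t\<bar>" by simp
  qed
  have "(LBINT t=-\<infinity>..\<infinity>. g t) = 0 - 0"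
  proof (rule interval_integral_FTC_integrable)
    fix t :: real
    have "((\<lambda>x. x * exp (- w * x\<^sup>2)) has_field_derivative exp (- w * (of_real t)\<^sup>2) + (- 2 * w * of_real t * exp (- w * (of_real t)\<^sup>2)) * of_real t) (at (of_real t))"
      by (auto intro!: derivative_eq_intros simp: algebra_simps)
    from has_vector_derivative_real_field[OF this]
    show "(G has_vector_derivative g t) (at t)"
      by (simp add: G_def[abs_def] g_def scaleR_conv_of_real power2_eq_square mult_ac)
    show "isCont g t" unfolding g_def by (intro continuous_intros)
  next
    show "set_integrable lborel (einterval (- \<infinity>) \<infinity>) g" using int_g by (simp add: set_integrable_def)
    show "((G \<circ> real_of_ereal) \<longlongrightarrow> 0) (at_right (- \<infinity>))"
      unfolding ereal_tendsto_simps by (rule tendsto_mono[OF at_bot_le_at_infinity lim])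
    show "((G \<circ> real_of_ereal) \<longlongrightarrow> 0) (at_left \<infinity>)"
      unfolding ereal_tendsto_simps by (rule tendsto_mono[OF at_top_le_at_infinity lim])
  qed simp
  then have "(\<integral>t. g t \<partial>lborel) = 0"
    by (simp add: interval_lebesgue_integral_def set_lebesgue_integral_def)
  moreover have "(\<integral>t. g t \<partial>lborel) = (\<integral>t. exp (- w * of_real (t\<^sup>2)) \<partial>lborel)
      - (\<integral>t. (2 * w) * (t\<^sup>2 *\<^sub>R exp (- w * of_real (t\<^sup>2))) \<partial>lborel)"
    unfolding g_def by (rule Bochner_Integration.integral_diff[OF i0 integrable_mult_right[OF i2]])
  ultimately have g0: "(\<integral>t. exp (- w * of_real (t\<^sup>2)) \<partial>lborel) = (2 * w) * (\<integral>t. t\<^sup>2 *\<^sub>R exp (- w * of_real (t\<^sup>2)) \<partial>lborel)"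
    by (simp only: integral_mult_right_zero) simp
  have n0: "(\<integral>t. exp (z * of_real (t\<^sup>2)) \<partial>std_normal_distribution) = k *\<^sub>R (\<integral>t. exp (- w * of_real (t\<^sup>2)) \<partial>lborel)"
    by (subst integral_density) (auto simp only: conv integral_scaleR_right intro!: AE_I2, auto)
  have n2: "(\<integral>t. t\<^sup>2 *\<^sub>R exp (z * of_real (t\<^sup>2)) \<partial>std_normal_distribution) = k *\<^sub>R (\<integral>t. t\<^sup>2 *\<^sub>R exp (- w * of_real (t\<^sup>2)) \<partial>lborel)"
  proof -
    have "(\<integral>t. t\<^sup>2 *\<^sub>R exp (z * of_real (t\<^sup>2)) \<partial>std_normal_distribution) = (\<integral>t. std_normal_density t *\<^sub>R (t\<^sup>2 *\<^sub>R exp (z * of_real (t\<^sup>2))) \<partial>lborel)"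
      by (subst integral_density) auto
    also have "\<dots> = (\<integral>t. k *\<^sub>R (t\<^sup>2 *\<^sub>R exp (- w * of_real (t\<^sup>2))) \<partial>lborel)"
      unfolding scaleR_left_commute[of "std_normal_density _"] conv by (simp only: scaleR_left_commute)
    finally show ?thesis by (simp only: integral_scaleR_right)
  qed
  have "1 - 2 * z = 2 * w" by (simp add: w_def)
  then show ?thesis unfolding n0 n2 g0 by (simp add: scaleR_conv_of_real)
qed

text \<open>The solution of \<open>1 - 2 \<zeta> = exp (-2 \<i> \<xi>)\<close>, the argument at which a squared standard normal variable
  has transform \<open>exp (\<i> \<xi>)\<close>.\<close>

definition \<zeta> :: "real \<Rightarrow> complex" where "\<zeta> \<xi> = (1 - iexp (- (2 * \<xi>))) / 2"

lemma \<zeta>_0 [simp]: "\<zeta> 0 = 0"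
  by (simp add: \<zeta>_def)

lemma norm_\<zeta>: "norm (\<zeta> \<xi>) \<le> \<bar>\<xi>\<bar>"
  using iexp_approx1[of "- (2 * \<xi>)" 0] by (simp add: \<zeta>_def norm_divide norm_minus_commute)

lemma \<zeta>_approx: "norm (\<zeta> \<xi> - \<i> * \<xi>) \<le> \<xi>\<^sup>2"
proof -
  have "\<zeta> \<xi> - \<i> * \<xi> = - (iexp (- (2 * \<xi>)) - (\<Sum>k\<le>1. (\<i> * of_real (- (2 * \<xi>))) ^ k / fact k)) / 2"
    by (simp add: \<zeta>_def field_simps)
  then have "norm (\<zeta> \<xi> - \<i> * \<xi>) = norm (iexp (- (2 * \<xi>)) - (\<Sum>k\<le>1. (\<i> * of_real (- (2 * \<xi>))) ^ k / fact k)) / 2"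
    by (simp only: norm_divide norm_minus_cancel norm_numeral)
  also have "\<dots> \<le> (\<bar>- (2 * \<xi>)\<bar> ^ Suc 1 / fact (Suc 1)) / 2" by (intro divide_right_mono iexp_approx1) simp
  also have "\<dots> = \<xi>\<^sup>2" by (simp add: power2_eq_square)
  finally show ?thesis .
qed

lemma Re_\<zeta>: "0 \<le> Re (\<zeta> \<xi>)" "Re (\<zeta> \<xi>) \<le> \<xi>\<^sup>2"
proof -
  show "0 \<le> Re (\<zeta> \<xi>)" by (simp add: \<zeta>_def Re_exp)
  have "Re (\<zeta> \<xi>) = Re (\<zeta> \<xi> - \<i> * \<xi>)" by simp
  also have "\<dots> \<le> \<xi>\<^sup>2" by (rule order_trans[OF complex_Re_le_cmod \<zeta>_approx])
  finally show "Re (\<zeta> \<xi>) \<le> \<xi>\<^sup>2" .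
qed

lemma \<zeta>_iexp: "1 - 2 * \<zeta> \<xi> = iexp (- (2 * \<xi>))"
proof -
  have "1 - 2 * ((1 - a) / 2) = a" for a :: complex by (simp add: field_simps)
  then show ?thesis unfolding \<zeta>_def .
qed

lemma has_vector_derivative_\<zeta>: "(\<zeta> has_vector_derivative \<i> * (1 - 2 * \<zeta> \<xi>)) (at \<xi>)"
proof -
  have "((\<lambda>x. (1 - exp (\<i> * - (2 * x))) / 2) has_field_derivative \<i> * exp (\<i> * - (2 * of_real \<xi>))) (at (of_real \<xi>))"
    by (auto intro!: derivative_eq_intros)
  from has_vector_derivative_real_field[OF this]
  have "((\<lambda>x. (1 - iexp (- (2 * x))) / 2) has_vector_derivative \<i> * iexp (- (2 * \<xi>))) (at \<xi>)" by simp
  moreover have "(\<lambda>x. (1 - iexp (- (2 * x))) / 2) = \<zeta>" by (simp add: \<zeta>_def[abs_def])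
  ultimately show ?thesis by (simp only: \<zeta>_iexp)
qed

lemma small_square: "\<bar>x\<bar> \<le> 1 / 4 \<Longrightarrow> x\<^sup>2 \<le> 1 / 16" for x :: real
  using power_mono[of "\<bar>x\<bar>" "1 / 4" 2] by (simp add: power2_eq_square)

text \<open>Both sides solve \<open>e' = \<i> e\<close> with \<open>e 0 = 1\<close>. This avoids choosing a branch of the
  square root in the closed form \<open>(1 - 2 z) powr (-1/2)\<close> of the left-hand side.\<close>

lemma integral_std_normal_\<zeta>:
  assumes "\<bar>\<xi>\<bar> < 1 / 4"
  shows "(\<integral>t. exp (\<zeta> \<xi> * of_real (t\<^sup>2)) \<partial>std_normal_distribution) = iexp \<xi>"
proof -
  let ?N = std_normal_distribution
  define e where "e x = (\<integral>t. exp (\<zeta> x * of_real (t\<^sup>2)) \<partial>?N)" for x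
  have R: "Re (\<zeta> x) \<le> 1 / 16" if "\<bar>x\<bar> \<le> 1 / 4" for x using Re_\<zeta>(2)[of x] small_square[OF that] by linarith
  have e': "(e has_vector_derivative \<i> * e x) (at x)" if x: "x \<in> {- (1/4)<..<1/4}" for x
  proof -
    have "(e has_vector_derivative (\<integral>t. (\<i> * (1 - 2 * \<zeta> x)) * (t\<^sup>2 *\<^sub>R exp (\<zeta> x * of_real (t\<^sup>2))) \<partial>?N)) (at x)"
      unfolding e_def[abs_def]
    proof (rule has_vector_derivative_integral[OF x, where g = "\<lambda>t. norm (t\<^sup>2 *\<^sub>R exp (complex_of_real (1 / 16) * of_real (t\<^sup>2)))"])
      show "integrable ?N (\<lambda>t. norm (t\<^sup>2 *\<^sub>R exp (complex_of_real (1 / 16) * of_real (t\<^sup>2))))"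
        by (intro integrable_norm integrable_std_normal_exp_square(2)) simp
      fix s :: real assume s: "s \<in> {- (1/4)<..<1/4}"
      then have Rs: "Re (\<zeta> s) \<le> 1 / 16" by (intro R) auto
      show "integrable ?N (\<lambda>t. exp (\<zeta> s * of_real (t\<^sup>2)))"
        by (rule integrable_std_normal_exp_square(1)) (use Rs in linarith)
      fix t :: real
      have "((\<lambda>s. \<zeta> s * of_real (t\<^sup>2)) has_vector_derivative (\<i> * (1 - 2 * \<zeta> s)) * of_real (t\<^sup>2)) (at s)"
        by (intro has_vector_derivative_mult_left has_vector_derivative_\<zeta>)
      moreover have "(exp has_field_derivative exp (\<zeta> s * of_real (t\<^sup>2))) (at (\<zeta> s * of_real (t\<^sup>2)))" by (rule DERIV_exp)
      ultimately have "((exp \<circ> (\<lambda>s. \<zeta> s * of_real (t\<^sup>2))) has_vector_derivative ((\<i> * (1 - 2 * \<zeta> s)) * of_real (t\<^sup>2)) * exp (\<zeta> s * of_real (t\<^sup>2))) (at s)"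
        by (rule field_vector_diff_chain_at)
      then show "((\<lambda>s. exp (\<zeta> s * of_real (t\<^sup>2))) has_vector_derivative (\<i> * (1 - 2 * \<zeta> s)) * (t\<^sup>2 *\<^sub>R exp (\<zeta> s * of_real (t\<^sup>2)))) (at s)"
        unfolding o_def scaleR_conv_of_real by (simp only: mult.assoc)
      have "exp (Re (\<zeta> s) * t\<^sup>2) \<le> exp (1 / 16 * t\<^sup>2)" using mult_right_mono[OF Rs, of "t\<^sup>2"] by simp
      then have "t\<^sup>2 * exp (Re (\<zeta> s) * t\<^sup>2) \<le> t\<^sup>2 * exp (1 / 16 * t\<^sup>2)" by (intro mult_left_mono) auto
      then show "norm ((\<i> * (1 - 2 * \<zeta> s)) * (t\<^sup>2 *\<^sub>R exp (\<zeta> s * of_real (t\<^sup>2))))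
          \<le> norm (t\<^sup>2 *\<^sub>R exp (complex_of_real (1 / 16) * of_real (t\<^sup>2)))"
        by (simp add: norm_mult \<zeta>_iexp)
    qed measurable
    also have "(\<integral>t. (\<i> * (1 - 2 * \<zeta> x)) * (t\<^sup>2 *\<^sub>R exp (\<zeta> x * of_real (t\<^sup>2))) \<partial>?N) = \<i> * e x"
    proof -
      have "Re (\<zeta> x) \<le> 1 / 16" using x by (intro R) auto
      then have "Re (\<zeta> x) < 1 / 2" by linarith
      from std_normal_integration_by_parts[OF this] show ?thesis
        unfolding e_def integral_mult_right_zero by (simp only: mult.assoc)
    qed
    finally show ?thesis .
  qed
  define h where "h x = iexp (- x) * e x" for x
  have h': "(h has_vector_derivative 0) (at x within {- \<bar>\<xi>\<bar>..\<bar>\<xi>\<bar>})" if "x \<in> {- \<bar>\<xi>\<bar>..\<bar>\<xi>\<bar>}" for x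
  proof -
    have x: "x \<in> {- (1/4)<..<1/4}" using that assms by auto
    have "((\<lambda>x. exp (\<i> * - x)) has_field_derivative - \<i> * exp (\<i> * - of_real x)) (at (of_real x))"
      by (auto intro!: derivative_eq_intros)
    from has_vector_derivative_real_field[OF this]
    have "((\<lambda>x. iexp (- x)) has_vector_derivative - \<i> * iexp (- x)) (at x)" by simp
    from has_vector_derivative_mult[OF this e'[OF x]]
    have "(h has_vector_derivative 0) (at x)" by (simp add: h_def[abs_def])
    then show ?thesis by (rule has_vector_derivative_at_within)
  qed
  have "norm (h \<xi> - h 0) \<le> 0 * \<bar>\<xi> - 0\<bar>"
    by (rule vector_mvt_bound[of "{- \<bar>\<xi>\<bar>..\<bar>\<xi>\<bar>}", OF _ _ _ h']) auto
  then have "h \<xi> = 1" using std_normal.prob_space by (simp add: h_def e_def)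
  then have "iexp \<xi> * h \<xi> = iexp \<xi>" by simp
  then show ?thesis by (simp add: h_def e_def flip: exp_add mult.assoc)
qed

lemma measurable_sum_squares:
  "(\<lambda>x. \<Sum>i<j. (x i)\<^sup>2) \<in> borel_measurable (Pi\<^sub>M {..<j} (\<lambda>_. std_normal_distribution))"
proof (intro borel_measurable_sum borel_measurable_power)
  fix i assume "i \<in> {..<j}"
  then have "(\<lambda>x. x i) \<in> measurable (Pi\<^sub>M {..<j} (\<lambda>_. std_normal_distribution)) std_normal_distribution"
    by (rule measurable_component_singleton)
  then show "(\<lambda>x. x i) \<in> borel_measurable (Pi\<^sub>M {..<j} (\<lambda>_. std_normal_distribution))" by simp
qed

lemma chi_squared_transform:
  fixes z :: complex
  assumes z: "Re z < 1 / 2"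
  shows "integrable (chi_squared j) (\<lambda>x. exp (z * of_real x))"
    "(\<integral>x. exp (z * of_real x) \<partial>chi_squared j) = (\<integral>t. exp (z * of_real (t\<^sup>2)) \<partial>std_normal_distribution) ^ j"
proof -
  interpret S: product_sigma_finite "\<lambda>_::nat. std_normal_distribution" ..
  let ?P = "Pi\<^sub>M {..<j} (\<lambda>_. std_normal_distribution)"
  note [measurable] = measurable_sum_squares
  have e: "exp (z * of_real (\<Sum>i<j. (x i)\<^sup>2)) = (\<Prod>i<j. exp (z * of_real ((x i)\<^sup>2)))" for x :: "nat \<Rightarrow> real"
    by (simp add: sum_distrib_left exp_sum)
  have "integrable ?P (\<lambda>x. exp (z * of_real (\<Sum>i<j. (x i)\<^sup>2)))"
    unfolding e by (intro S.product_integrable_prod integrable_std_normal_exp_square(1)[OF z]) auto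
  then show "integrable (chi_squared j) (\<lambda>x. exp (z * of_real x))"
    unfolding chi_squared_def by (subst integrable_distr_eq) auto
  have "(\<integral>x. exp (z * of_real x) \<partial>chi_squared j) = (\<integral>x. exp (z * of_real (\<Sum>i<j. (x i)\<^sup>2)) \<partial>?P)"
    unfolding chi_squared_def by (subst integral_distr) auto
  also have "\<dots> = (\<Prod>i<j. \<integral>t. exp (z * of_real (t\<^sup>2)) \<partial>std_normal_distribution)"
    unfolding e by (intro S.product_integral_prod integrable_std_normal_exp_square(1)[OF z]) auto
  finally show "(\<integral>x. exp (z * of_real x) \<partial>chi_squared j) = (\<integral>t. exp (z * of_real (t\<^sup>2)) \<partial>std_normal_distribution) ^ j" by simp
qed

lemma sets_chi_squared [simp, measurable_cong]: "sets (chi_squared j) = sets borel"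
  by (simp add: chi_squared_def)

lemma prob_space_chi_squared: "prob_space (chi_squared j)"
  unfolding chi_squared_def
  by (intro prob_space.prob_space_distr prob_space_PiM measurable_sum_squares)
    (rule std_normal.prob_space_axioms)

section \<open>The chi-squared mixture of a cone\<close>

locale cone_with_law = convex_cone +
  fixes V :: "nat pmf"
  assumes law: "intrinsic_volume_law d C V"
begin

lemma set_V: "set_pmf V \<subseteq> {..d}"
  using law by (simp add: intrinsic_volume_law_def)

lemma integral_V: "(\<integral>j. f j \<partial>measure_pmf V) = (\<Sum>j\<le>d. pmf V j *\<^sub>R f j)"
  for f :: "nat \<Rightarrow> 'b::{banach, second_countable_topology}"
  by (rule integral_measure_pmf) (use set_V in auto)

lemma mixture_bounded:
  fixes g :: "real \<Rightarrow> real"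
  assumes [measurable]: "g \<in> borel_measurable borel" and b: "\<And>x. \<bar>g x\<bar> \<le> K"
  shows "(\<integral>x. g (F x) \<partial>std_gaussian d) = (\<Sum>j\<le>d. pmf V j * (\<integral>x. g x \<partial>chi_squared j))"
proof -
  have m: "(\<lambda>p::real \<times> real. g (fst p)) \<in> borel_measurable borel"
    by (subst borel_prod[symmetric]) measurable
  have bd: "bounded (range (\<lambda>p::real \<times> real. g (fst p)))"
    using b by (intro boundedI[of _ K]) auto
  have marg: "(\<integral>p. g (fst p) \<partial>(chi_squared j \<Otimes>\<^sub>M chi_squared k)) = (\<integral>x. g x \<partial>chi_squared j)" for j k
  proof -
    have "(\<integral>p. g (fst p) \<partial>(chi_squared j \<Otimes>\<^sub>M chi_squared k)) = (\<integral>x. g x \<partial>distr (chi_squared j \<Otimes>\<^sub>M chi_squared k) (chi_squared j) fst)"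
      by (rule integral_distr[symmetric]) measurable
    also have "distr (chi_squared j \<Otimes>\<^sub>M chi_squared k) (chi_squared j) fst = chi_squared j"
      by (rule prob_space.distr_pair_fst[OF prob_space_chi_squared])
    finally show ?thesis .
  qed
  have "(\<integral>x. (\<lambda>p. g (fst p)) ((norm_d d (proj d C x))\<^sup>2, (norm_d d (proj d (polar_cone d C) x))\<^sup>2) \<partial>std_gaussian d)
      = (\<Sum>j\<le>d. pmf V j * (\<integral>p. (\<lambda>p. g (fst p)) p \<partial>(chi_squared j \<Otimes>\<^sub>M chi_squared (d - j))))"
    using law m bd unfolding intrinsic_volume_law_def by blast
  then show ?thesis by (simp add: marg F_def P_def)
qed

text \<open>Truncation extends the mixture identity from bounded functions to integrable ones, among them
  \<open>exp (\<zeta> x)\<close>, which grows with \<open>x\<close> because \<open>Re \<zeta>\<close> is positive for small \<open>\<xi> \<noteq> 0\<close>.\<close>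

lemma mixture:
  fixes h :: "real \<Rightarrow> real"
  assumes [measurable]: "h \<in> borel_measurable borel"
    and i1: "integrable (std_gaussian d) (\<lambda>x. h (F x))" and i2: "\<And>j. integrable (chi_squared j) h"
  shows "(\<integral>x. h (F x) \<partial>std_gaussian d) = (\<Sum>j\<le>d. pmf V j * (\<integral>x. h x \<partial>chi_squared j))"
proof (rule LIMSEQ_unique)
  define g where "g n x = max (- real n) (min (real n) (h x))" for n x
  have [measurable]: "g n \<in> borel_measurable borel" for n unfolding g_def[abs_def] by measurable
  have b1: "\<bar>g n x\<bar> \<le> real n" and b2: "\<bar>g n x\<bar> \<le> \<bar>h x\<bar>" for n x by (auto simp: g_def)
  have lim: "(\<lambda>n. g n x) \<longlonglongrightarrow> h x" for x
  proof -
    obtain N where "\<bar>h x\<bar> \<le> real N" using real_arch_simple by blast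
    then have "eventually (\<lambda>n. g n x = h x) sequentially"
      by (intro eventually_sequentiallyI[of N]) (auto simp: g_def abs_le_iff)
    then show ?thesis by (rule tendsto_eventually)
  qed
  show "(\<lambda>n. \<integral>x. g n (F x) \<partial>std_gaussian d) \<longlonglongrightarrow> (\<integral>x. h (F x) \<partial>std_gaussian d)"
    by (rule integral_dominated_convergence[where w = "\<lambda>x. \<bar>h (F x)\<bar>"])
      (use i1 lim b2 in \<open>auto intro!: integrable_abs\<close>)
  have "(\<lambda>n. \<integral>x. g n x \<partial>chi_squared j) \<longlonglongrightarrow> (\<integral>x. h x \<partial>chi_squared j)" for j
    by (rule integral_dominated_convergence[where w = "\<lambda>x. \<bar>h x\<bar>"])
      (use i2 lim b2 in \<open>auto intro!: integrable_abs\<close>)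
  then have sums: "(\<lambda>n. \<Sum>j\<le>d. pmf V j * (\<integral>x. g n x \<partial>chi_squared j)) \<longlonglongrightarrow> (\<Sum>j\<le>d. pmf V j * (\<integral>x. h x \<partial>chi_squared j))"
    by (intro tendsto_intros)
  show "(\<lambda>n. \<integral>x. g n (F x) \<partial>std_gaussian d) \<longlonglongrightarrow> (\<Sum>j\<le>d. pmf V j * (\<integral>x. h x \<partial>chi_squared j))"
  proof -
    have "(\<integral>x. g n (F x) \<partial>std_gaussian d) = (\<Sum>j\<le>d. pmf V j * (\<integral>x. g n x \<partial>chi_squared j))" for n
      by (rule mixture_bounded[OF _ b1]) measurable
    with sums show ?thesis by simp
  qed
qed

text \<open>The characteristic function of the random number of degrees of freedom.\<close>

definition \<phi> :: "real \<Rightarrow> complex" where "\<phi> \<xi> = (\<integral>j. iexp (\<xi> * real j) \<partial>measure_pmf V)"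

lemma M_\<zeta>:
  assumes \<xi>: "\<bar>\<xi>\<bar> < 1 / 4"
  shows "M 0 (\<zeta> \<xi>) = \<phi> \<xi>"
proof -
  have R: "Re (\<zeta> \<xi>) < 1 / 2" using Re_\<zeta>(2)[of \<xi>] small_square[of \<xi>] \<xi> by linarith
  let ?h = "\<lambda>x. exp (\<zeta> \<xi> * of_real x)"
  have iM: "integrable (std_gaussian d) (\<lambda>x. ?h (F x))" using integrable_M[OF R, of 0] by simp
  note ic = chi_squared_transform[OF R]
  have "Re (M 0 (\<zeta> \<xi>)) = (\<Sum>j\<le>d. pmf V j * Re (\<integral>x. ?h x \<partial>chi_squared j))"
  proof -
    have "Re (M 0 (\<zeta> \<xi>)) = (\<integral>x. Re (?h (F x)) \<partial>std_gaussian d)"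
      unfolding M_def power_0 scaleR_one using iM by (rule integral_Re[symmetric])
    also have "\<dots> = (\<Sum>j\<le>d. pmf V j * (\<integral>x. Re (?h x) \<partial>chi_squared j))"
      by (rule mixture) (use iM ic(1) in \<open>auto intro!: integrable_Re simp del: Re_exp\<close>)
    finally show ?thesis using ic(1) by (simp only: integral_Re)
  qed
  moreover have "Im (M 0 (\<zeta> \<xi>)) = (\<Sum>j\<le>d. pmf V j * Im (\<integral>x. ?h x \<partial>chi_squared j))"
  proof -
    have "Im (M 0 (\<zeta> \<xi>)) = (\<integral>x. Im (?h (F x)) \<partial>std_gaussian d)"
      unfolding M_def power_0 scaleR_one using iM by (rule integral_Im[symmetric])
    also have "\<dots> = (\<Sum>j\<le>d. pmf V j * (\<integral>x. Im (?h x) \<partial>chi_squared j))"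
      by (rule mixture) (use iM ic(1) in \<open>auto intro!: integrable_Im\<close>)
    finally show ?thesis using ic(1) by (simp only: integral_Im)
  qed
  ultimately have "M 0 (\<zeta> \<xi>) = (\<Sum>j\<le>d. pmf V j *\<^sub>R (\<integral>x. ?h x \<partial>chi_squared j))"
    by (intro complex_eqI) (simp_all only: Re_sum Im_sum scaleR_complex.sel)
  also have "\<dots> = \<phi> \<xi>"
    unfolding \<phi>_def integral_V ic(2) integral_std_normal_\<zeta>[OF \<xi>]
    by (intro sum.cong) (simp_all add: mult_ac flip: exp_of_nat_mult)
  finally show ?thesis .
qed

lemma norm_\<phi>_le: "norm (\<phi> \<xi>) \<le> 1"
proof -
  have "norm (\<phi> \<xi>) \<le> (\<integral>j. norm (iexp (\<xi> * real j)) \<partial>measure_pmf V)"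
    unfolding \<phi>_def by (rule integral_norm_bound)
  then show ?thesis by simp
qed

text \<open>Comparison of the first two derivatives at \<open>0\<close> of both sides of \<open>M (\<zeta> \<xi>) = \<phi> \<xi>\<close>. The term
  \<open>2 \<delta>\<close> comes from the curvature of the path \<open>\<zeta>\<close>.\<close>

lemma V_moments:
  shows "stat_dim V = \<delta>" "tau2 V = \<sigma>2 - 2 * \<delta>"
proof -
  \<comment> \<open>The \<open>k\<close>-th derivative of \<open>\<phi>\<close>.\<close>
  define \<psi> where "\<psi> k \<xi> = (\<Sum>j\<le>d. of_real (pmf V j) * ((\<i> * of_nat j) ^ k * iexp (\<xi> * real j)))" for k \<xi>
  have \<psi>': "(\<psi> k has_vector_derivative \<psi> (Suc k) \<xi>) (at \<xi>)" for k \<xi>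
    unfolding \<psi>_def[abs_def]
  proof (intro has_vector_derivative_sum has_vector_derivative_mult_right)
    fix j
    have "((\<lambda>x. (\<i> * of_nat j) ^ k * exp (\<i> * (x * of_nat j))) has_field_derivative (\<i> * of_nat j) ^ Suc k * exp (\<i> * (of_real \<xi> * of_nat j))) (at (of_real \<xi>))"
      by (auto intro!: derivative_eq_intros simp: mult_ac)
    from has_vector_derivative_real_field[OF this]
    show "((\<lambda>\<xi>. (\<i> * of_nat j) ^ k * iexp (\<xi> * real j)) has_vector_derivative (\<i> * of_nat j) ^ Suc k * iexp (\<xi> * real j)) (at \<xi>)"
      by simp
  qed
  let ?S = "{- (1/4)<..<1/4::real}"
  have \<psi>0: "\<psi> 0 \<xi> = M 0 (\<zeta> \<xi>)" if "\<xi> \<in> ?S" for \<xi>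
    using that by (subst M_\<zeta>) (auto simp: \<psi>_def \<phi>_def integral_V scaleR_conv_of_real)
  have M': "((\<lambda>s. M k (\<zeta> s)) has_vector_derivative (\<i> * (1 - 2 * \<zeta> \<xi>)) * M (Suc k) (\<zeta> \<xi>)) (at \<xi>)" if "\<xi> \<in> ?S" for k \<xi>
  proof (rule M_along_path[OF that has_vector_derivative_\<zeta>, where B = 1])
    fix s assume "s \<in> ?S"
    then have "\<bar>s\<bar> \<le> 1 / 4" by auto
    from small_square[OF this] show "Re (\<zeta> s) \<le> 1 / 4" using Re_\<zeta>(2)[of s] by linarith
    show "norm (\<i> * (1 - 2 * \<zeta> s)) \<le> 1" by (simp add: \<zeta>_iexp norm_mult)
  qed
  have \<psi>1: "\<psi> 1 \<xi> = (\<i> * (1 - 2 * \<zeta> \<xi>)) * M 1 (\<zeta> \<xi>)" if "\<xi> \<in> ?S" for \<xi>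
  proof -
    have "((\<lambda>s. M 0 (\<zeta> s)) has_vector_derivative \<psi> 1 \<xi>) (at \<xi>)"
      using has_vector_derivative_transform_within_open[OF \<psi>'[of 0 \<xi>] _ that \<psi>0] by simp
    from vector_derivative_unique_at[OF this M'[OF that, of 0]] show ?thesis by simp
  qed
  have "\<psi> 2 0 = 2 * M 1 0 - M 2 0"
  proof -
    have "((\<lambda>\<xi>. \<i> * (1 - 2 * \<zeta> \<xi>)) has_vector_derivative \<i> * (0 - 2 * (\<i> * (1 - 2 * \<zeta> 0)))) (at 0)"
      by (intro has_vector_derivative_mult_right has_vector_derivative_diff has_vector_derivative_const has_vector_derivative_\<zeta>)
    moreover have "((\<lambda>s. M 1 (\<zeta> s)) has_vector_derivative (\<i> * (1 - 2 * \<zeta> 0)) * M (Suc 1) (\<zeta> 0)) (at 0)"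
      by (rule M') auto
    ultimately have "((\<lambda>\<xi>. (\<i> * (1 - 2 * \<zeta> \<xi>)) * M 1 (\<zeta> \<xi>)) has_vector_derivative
        \<i> * (1 - 2 * \<zeta> 0) * ((\<i> * (1 - 2 * \<zeta> 0)) * M (Suc 1) (\<zeta> 0)) + \<i> * (0 - 2 * (\<i> * (1 - 2 * \<zeta> 0))) * M 1 (\<zeta> 0)) (at 0)"
      by (rule has_vector_derivative_mult)
    moreover have "\<i> * (1 - 2 * \<zeta> 0) * ((\<i> * (1 - 2 * \<zeta> 0)) * M (Suc 1) (\<zeta> 0)) + \<i> * (0 - 2 * (\<i> * (1 - 2 * \<zeta> 0))) * M 1 (\<zeta> 0)
        = 2 * M 1 0 - M 2 0"
      by (simp add: numeral_2_eq_2 algebra_simps)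
    ultimately have "((\<lambda>\<xi>. (\<i> * (1 - 2 * \<zeta> \<xi>)) * M 1 (\<zeta> \<xi>)) has_vector_derivative 2 * M 1 0 - M 2 0) (at 0)"
      by (simp only:)
    moreover have "((\<lambda>\<xi>. (\<i> * (1 - 2 * \<zeta> \<xi>)) * M 1 (\<zeta> \<xi>)) has_vector_derivative \<psi> 2 0) (at 0)"
      using has_vector_derivative_transform_within_open[OF \<psi>'[of 1 0] _ _ \<psi>1, of ?S] by (simp add: numeral_2_eq_2)
    ultimately show ?thesis by (metis vector_derivative_unique_at)
  qed
  moreover have "\<psi> 2 0 = - of_real (\<integral>j. (real j)\<^sup>2 \<partial>measure_pmf V)"
    by (simp add: \<psi>_def integral_V power_mult_distrib sum_negf)
  moreover have "M 2 0 = of_real (\<integral>x. (F x)\<^sup>2 \<partial>std_gaussian d)"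
    using M_of_real[of 2 0] by (simp add: m_def)
  ultimately have "- complex_of_real (\<integral>j. (real j)\<^sup>2 \<partial>measure_pmf V) = 2 * of_real \<delta> - of_real (\<integral>x. (F x)\<^sup>2 \<partial>std_gaussian d)"
    by (simp add: M_1_0[simplified])
  then have "complex_of_real (- (\<integral>j. (real j)\<^sup>2 \<partial>measure_pmf V)) = of_real (2 * \<delta> - (\<integral>x. (F x)\<^sup>2 \<partial>std_gaussian d))"
    by simp
  then have second: "(\<integral>j. (real j)\<^sup>2 \<partial>measure_pmf V) = (\<integral>x. (F x)\<^sup>2 \<partial>std_gaussian d) - 2 * \<delta>"
    unfolding of_real_eq_iff by simp
  have "\<psi> 1 0 = \<i> * of_real (stat_dim V)"
    by (simp add: \<psi>_def stat_dim_def integral_V sum_distrib_left mult_ac)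
  moreover have "\<psi> 1 0 = \<i> * of_real \<delta>" using \<psi>1[of 0] by (simp add: M_1_0[simplified])
  ultimately have "\<i> * complex_of_real (stat_dim V) = \<i> * of_real \<delta>" by simp
  then show sd: "stat_dim V = \<delta>" by simp
  have fin: "finite (set_pmf V)" using set_V by (rule finite_subset) simp
  have "tau2 V = (\<integral>j. (real j)\<^sup>2 \<partial>measure_pmf V) - (stat_dim V)\<^sup>2"
    unfolding tau2_def stat_dim_def
    by (rule measure_pmf.variance_eq) (intro integrable_measure_pmf_finite fin)+
  then show "tau2 V = \<sigma>2 - 2 * \<delta>" by (simp add: second sd \<sigma>2_eq)
qed

lemma sigma2_eq: "sigma2 d C = \<sigma>2"
  by (simp add: sigma2_def \<sigma>2_def F_def[abs_def] P_def)

end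

section \<open>Bounds for characteristic functions\<close>

text \<open>Integrating factor: \<open>exp (a x\<^sup>2 / 2) f x\<close> has a derivative of norm at most
  \<open>exp (a X\<^sup>2 / 2) B\<close> on \<open>[0, X]\<close>.\<close>

lemma gaussian_ode_comparison:
  fixes f f' :: "real \<Rightarrow> complex"
  assumes X: "0 \<le> X" and a: "0 \<le> a" and f0: "f 0 = 1"
    and deriv: "\<And>x. 0 \<le> x \<Longrightarrow> x \<le> X \<Longrightarrow> (f has_vector_derivative f' x) (at x)"
    and bound: "\<And>x. 0 \<le> x \<Longrightarrow> x \<le> X \<Longrightarrow> norm (f' x + of_real (a * x) * f x) \<le> B"
  shows "norm (f X - of_real (exp (- (a * X\<^sup>2 / 2)))) \<le> B * X"
proof -
  define g where "g x = of_real (exp (a * x\<^sup>2 / 2)) * f x" for x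
  let ?E = "exp (a * X\<^sup>2 / 2)"
  have "norm (g X - g 0) \<le> (?E * B) * \<bar>X - 0\<bar>"
  proof (rule vector_mvt_bound[of "{0..X}"])
    fix x assume x: "x \<in> {0..X}"
    have "((\<lambda>x. exp (a * x\<^sup>2 / 2)) has_real_derivative exp (a * x\<^sup>2 / 2) * (a * x)) (at x)"
      by (auto intro!: derivative_eq_intros)
    then have "((\<lambda>x. complex_of_real (exp (a * x\<^sup>2 / 2))) has_vector_derivative of_real (exp (a * x\<^sup>2 / 2) * (a * x))) (at x)"
      by (intro has_vector_derivative_of_real) (simp add: has_real_derivative_iff_has_vector_derivative)
    from has_vector_derivative_mult[OF this deriv[of x]] x
    have "(g has_vector_derivative of_real (exp (a * x\<^sup>2 / 2)) * f' x + of_real (exp (a * x\<^sup>2 / 2) * (a * x)) * f x) (at x)"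
      by (simp add: g_def[abs_def])
    moreover have "of_real (exp (a * x\<^sup>2 / 2)) * f' x + of_real (exp (a * x\<^sup>2 / 2) * (a * x)) * f x
        = of_real (exp (a * x\<^sup>2 / 2)) * (f' x + of_real (a * x) * f x)"
      by (simp add: distrib_left mult.assoc)
    ultimately show "(g has_vector_derivative of_real (exp (a * x\<^sup>2 / 2)) * (f' x + of_real (a * x) * f x)) (at x within {0..X})"
      by (metis has_vector_derivative_at_within)
    have "x\<^sup>2 \<le> X\<^sup>2" using x by (intro power_mono) auto
    then have "exp (a * x\<^sup>2 / 2) \<le> ?E" using a by (simp add: divide_right_mono mult_left_mono)
    then show "norm (of_real (exp (a * x\<^sup>2 / 2)) * (f' x + of_real (a * x) * f x)) \<le> ?E * B"
      unfolding norm_mult norm_of_real using bound[of x] x by (intro mult_mono) auto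
  qed (use X in auto)
  then have "norm (of_real ?E * f X - 1) \<le> ?E * (B * X)" using X by (simp add: g_def f0 mult.assoc)
  then have "exp (- (a * X\<^sup>2 / 2)) * norm (of_real ?E * f X - 1) \<le> exp (- (a * X\<^sup>2 / 2)) * (?E * (B * X))"
    by (rule mult_left_mono) simp
  also have "\<dots> = B * X" by (simp add: exp_minus)
  also have "exp (- (a * X\<^sup>2 / 2)) * norm (of_real ?E * f X - 1) = norm (of_real (exp (- (a * X\<^sup>2 / 2))) * (of_real ?E * f X - 1))"
    by (simp only: norm_mult norm_of_real abs_exp_cancel)
  also have "of_real (exp (- (a * X\<^sup>2 / 2))) * (of_real ?E * f X - 1) = f X - of_real (exp (- (a * X\<^sup>2 / 2)))"
    by (simp add: right_diff_distrib mult.assoc[symmetric] exp_minus)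
  finally show ?thesis .
qed

context cone_with_law
begin

text \<open>Along \<open>\<zeta>\<close> the transform is the characteristic function of \<open>V\<close>, hence bounded by \<open>1\<close>. The constant
  is \<open>58 = 48 + 10\<close>: the first part is the error in the differential inequality, the second the
  terms of second order in \<open>\<zeta>\<close> and its derivative.\<close>

lemma char_V_bound:
  assumes \<xi>: "0 \<le> \<xi>" "\<xi> \<le> 1 / 5"
  shows "norm (iexp (- (\<delta> * \<xi>)) * \<phi> \<xi> - of_real (exp (- (tau2 V * \<xi>\<^sup>2 / 2)))) \<le> 58 * \<xi> ^ 3 * \<delta> * exp (2 * \<delta> * \<xi>\<^sup>2)"
proof -
  define f where "f x = iexp (- (\<delta> * x)) * M 0 (\<zeta> x)" for x
  define f' where "f' x = iexp (- (\<delta> * x)) * ((\<i> * (1 - 2 * \<zeta> x)) * M 1 (\<zeta> x)) + (- \<i> * \<delta> * iexp (- (\<delta> * x))) * M 0 (\<zeta> x)" for x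
  have \<tau>: "0 \<le> tau2 V" unfolding tau2_def by (intro integral_nonneg_AE AE_I2) simp
  have \<tau>2: "tau2 V \<le> 2 * \<delta>" and \<sigma>: "0 \<le> \<sigma>2" using V_moments(2) \<sigma>2_le \<tau> \<delta>_nonneg by linarith+
  have S: "x \<in> {- (1/4)<..<1/4}" if "0 \<le> x" "x \<le> \<xi>" for x using that \<xi> by auto
  have "norm (f \<xi> - of_real (exp (- (tau2 V * \<xi>\<^sup>2 / 2)))) \<le> (58 * \<xi>\<^sup>2 * \<delta> * exp (2 * \<delta> * \<xi>\<^sup>2)) * \<xi>"
  proof (rule gaussian_ode_comparison[OF \<xi>(1) \<tau>])
    show "f 0 = 1" by (simp add: f_def M_0_0)
    fix x assume x: "0 \<le> x" "x \<le> \<xi>"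
    have "((\<lambda>x. exp (\<i> * - (\<delta> * x))) has_field_derivative - \<i> * \<delta> * exp (\<i> * - (\<delta> * of_real x))) (at (of_real x))"
      by (auto intro!: derivative_eq_intros)
    from has_vector_derivative_real_field[OF this]
    have "((\<lambda>x. iexp (- (\<delta> * x))) has_vector_derivative - \<i> * \<delta> * iexp (- (\<delta> * x))) (at x)" by simp
    moreover have "((\<lambda>s. M 0 (\<zeta> s)) has_vector_derivative (\<i> * (1 - 2 * \<zeta> x)) * M (Suc 0) (\<zeta> x)) (at x)"
    proof (rule M_along_path[OF S[OF x] has_vector_derivative_\<zeta>, where B = 1])
      fix s :: real assume "s \<in> {- (1/4)<..<1/4}"
      then have "\<bar>s\<bar> \<le> 1 / 4" by auto
      from small_square[OF this] show "Re (\<zeta> s) \<le> 1 / 4" using Re_\<zeta>(2)[of s] by linarith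
      show "norm (\<i> * (1 - 2 * \<zeta> s)) \<le> 1" by (simp add: \<zeta>_iexp norm_mult)
    qed
    ultimately show "(f has_vector_derivative f' x) (at x)"
      unfolding f_def[abs_def] f'_def by (simp only: One_nat_def) (rule has_vector_derivative_mult)
    define R where "R = M 1 (\<zeta> x) - (\<delta> + \<zeta> x * \<sigma>2) * M 0 (\<zeta> x)"
    have x2: "x\<^sup>2 \<le> \<xi>\<^sup>2" using x by (intro power_mono) auto
    have x16: "x\<^sup>2 \<le> 1 / 16" using S[OF x] by (intro small_square) auto
    have nf: "norm (f x) \<le> 1"
    proof -
      have "\<bar>x\<bar> < 1 / 4" using S[OF x] by auto
      from M_\<zeta>[OF this] show ?thesis using norm_\<phi>_le[of x] by (simp add: f_def norm_mult)
    qed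
    have "norm R \<le> 48 * (norm (\<zeta> x))\<^sup>2 * \<delta> * exp (2 * \<delta> * Re (\<zeta> x))"
      unfolding R_def using Re_\<zeta>[of x] x16 by (intro M_ode) linarith+
    also have "\<dots> \<le> 48 * x\<^sup>2 * \<delta> * exp (2 * \<delta> * \<xi>\<^sup>2)"
    proof (intro mult_mono)
      show "(norm (\<zeta> x))\<^sup>2 \<le> x\<^sup>2" using norm_\<zeta>[of x] power_mono[of "norm (\<zeta> x)" "\<bar>x\<bar>" 2] by simp
      have "Re (\<zeta> x) \<le> \<xi>\<^sup>2" using Re_\<zeta>(2)[of x] x2 by linarith
      then show "exp (2 * \<delta> * Re (\<zeta> x)) \<le> exp (2 * \<delta> * \<xi>\<^sup>2)" using \<delta>_nonneg by (simp add: mult_left_mono)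
    qed (use \<delta>_nonneg in auto)
    finally have nR: "norm R \<le> 48 * x\<^sup>2 * \<delta> * exp (2 * \<delta> * \<xi>\<^sup>2)" .
    \<comment> \<open>What remains of \<open>\<zeta>' (\<delta> + \<zeta> \<sigma>2)\<close> beyond the terms \<open>\<i> \<delta>\<close> and \<open>- \<tau>\<^sup>2 x\<close>; the identity \<open>\<sigma>2 = \<tau>\<^sup>2 + 2 \<delta>\<close> cancels the first-order part.\<close>
    define k where "k = \<i> * (\<zeta> x - \<i> * x) * tau2 V - 2 * \<i> * (\<zeta> x)\<^sup>2 * \<sigma>2"
    have eq: "f' x + of_real (tau2 V * x) * f x = k * f x + iexp (- (\<delta> * x)) * (\<i> * (1 - 2 * \<zeta> x)) * R"
    proof -
      have M1: "M 1 (\<zeta> x) = (\<delta> + \<zeta> x * \<sigma>2) * M 0 (\<zeta> x) + R" by (simp add: R_def)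
      have kk: "k = \<i> * (1 - 2 * \<zeta> x) * (\<delta> + \<zeta> x * \<sigma>2) - \<i> * \<delta> + tau2 V * x"
        unfolding k_def V_moments(2) by (simp add: algebra_simps power2_eq_square)
      show ?thesis unfolding f'_def f_def M1 kk by (simp add: algebra_simps)
    qed
    have nk: "norm k \<le> 10 * x\<^sup>2 * \<delta>"
    proof -
      have "norm k \<le> norm (\<i> * (\<zeta> x - \<i> * x) * tau2 V) + norm (2 * \<i> * (\<zeta> x)\<^sup>2 * \<sigma>2)"
        unfolding k_def by (rule norm_triangle_ineq4)
      also have "\<dots> = norm (\<zeta> x - \<i> * x) * tau2 V + 2 * (norm (\<zeta> x))\<^sup>2 * \<sigma>2"
        using \<tau> \<sigma> by (simp add: norm_mult norm_power)
      also have "\<dots> \<le> x\<^sup>2 * (2 * \<delta>) + 2 * x\<^sup>2 * (4 * \<delta>)"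
        using \<tau> \<sigma> norm_\<zeta>[of x] power_mono[of "norm (\<zeta> x)" "\<bar>x\<bar>" 2]
        by (intro add_mono mult_mono \<zeta>_approx \<tau>2 \<sigma>2_le) auto
      finally show ?thesis by (simp add: mult_ac)
    qed
    have e1: "1 \<le> exp (2 * \<delta> * \<xi>\<^sup>2)" using \<delta>_nonneg by simp
    have "norm (f' x + of_real (tau2 V * x) * f x) \<le> norm k * norm (f x) + norm R"
      unfolding eq by (rule order_trans[OF norm_triangle_ineq]) (simp add: norm_mult \<zeta>_iexp)
    also have "\<dots> \<le> 10 * x\<^sup>2 * \<delta> * 1 + 48 * x\<^sup>2 * \<delta> * exp (2 * \<delta> * \<xi>\<^sup>2)"
      using nk nf nR \<delta>_nonneg by (intro add_mono mult_mono) auto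
    also have "\<dots> \<le> 10 * x\<^sup>2 * \<delta> * exp (2 * \<delta> * \<xi>\<^sup>2) + 48 * x\<^sup>2 * \<delta> * exp (2 * \<delta> * \<xi>\<^sup>2)"
      using e1 \<delta>_nonneg by (intro add_mono mult_left_mono) auto
    also have "\<dots> = 58 * x\<^sup>2 * \<delta> * exp (2 * \<delta> * \<xi>\<^sup>2)" by simp
    also have "\<dots> \<le> 58 * \<xi>\<^sup>2 * \<delta> * exp (2 * \<delta> * \<xi>\<^sup>2)"
      using x2 \<delta>_nonneg by (intro mult_right_mono mult_left_mono) auto
    finally show "norm (f' x + of_real (tau2 V * x) * f x) \<le> 58 * \<xi>\<^sup>2 * \<delta> * exp (2 * \<delta> * \<xi>\<^sup>2)" .
  qed
  moreover have "f \<xi> = iexp (- (\<delta> * \<xi>)) * \<phi> \<xi>" using \<xi> by (simp add: f_def M_\<zeta>)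
  moreover have "(58 * \<xi>\<^sup>2 * \<delta> * exp (2 * \<delta> * \<xi>\<^sup>2)) * \<xi> = 58 * \<xi> ^ 3 * \<delta> * exp (2 * \<delta> * \<xi>\<^sup>2)"
    by (simp add: power2_eq_square power3_eq_cube)
  ultimately show ?thesis by simp
qed

end

context convex_cone
begin

text \<open>On the imaginary axis the exponential factor of the differential inequality is \<open>1\<close>. The sign \<open>\<epsilon>\<close>
  covers arguments on both halves of the axis with one integration over \<open>[0, s]\<close>.\<close>

lemma char_F_bound:
  assumes s: "0 \<le> s" and \<epsilon>: "\<epsilon> = 1 \<or> \<epsilon> = - 1"
  shows "norm (iexp (- (\<delta> * (\<epsilon> * s))) * M 0 (\<i> * of_real (\<epsilon> * s)) - of_real (exp (- (\<sigma>2 * s\<^sup>2 / 2)))) \<le> 48 * s ^ 3 * \<delta>"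
proof -
  define f where "f x = iexp (- (\<delta> * (\<epsilon> * x))) * M 0 (\<i> * of_real (\<epsilon> * x))" for x
  define f' where "f' x = iexp (- (\<delta> * (\<epsilon> * x))) * ((\<i> * \<epsilon>) * M 1 (\<i> * of_real (\<epsilon> * x))) + (- \<i> * \<delta> * \<epsilon> * iexp (- (\<delta> * (\<epsilon> * x)))) * M 0 (\<i> * of_real (\<epsilon> * x))" for x
  have \<sigma>: "0 \<le> \<sigma>2" unfolding \<sigma>2_def by (intro integral_nonneg_AE AE_I2) simp
  have \<epsilon>2: "complex_of_real \<epsilon> * of_real \<epsilon> = 1" and \<epsilon>a: "\<bar>\<epsilon>\<bar> = 1" using \<epsilon> by auto
  have "norm (f s - of_real (exp (- (\<sigma>2 * s\<^sup>2 / 2)))) \<le> (48 * s\<^sup>2 * \<delta>) * s"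
  proof (rule gaussian_ode_comparison[OF s \<sigma>])
    show "f 0 = 1" by (simp add: f_def M_0_0)
    fix x assume x: "0 \<le> x" "x \<le> s"
    have "((\<lambda>x. exp (\<i> * - (\<delta> * (\<epsilon> * x)))) has_field_derivative - \<i> * \<delta> * \<epsilon> * exp (\<i> * - (\<delta> * (\<epsilon> * of_real x)))) (at (of_real x))"
      by (auto intro!: derivative_eq_intros)
    from has_vector_derivative_real_field[OF this]
    have "((\<lambda>x. iexp (- (\<delta> * (\<epsilon> * x)))) has_vector_derivative - \<i> * \<delta> * \<epsilon> * iexp (- (\<delta> * (\<epsilon> * x)))) (at x)" by simp
    moreover have "((\<lambda>x. M 0 (\<i> * of_real (\<epsilon> * x))) has_vector_derivative (\<i> * \<epsilon>) * M (Suc 0) (\<i> * of_real (\<epsilon> * x))) (at x)"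
    proof (rule M_along_path[where a = "x - 1" and b = "x + 1" and B = 1])
      fix y :: real
      have "((\<lambda>x. \<i> * (\<epsilon> * x)) has_field_derivative \<i> * \<epsilon>) (at (of_real y))"
        by (auto intro!: derivative_eq_intros)
      from has_vector_derivative_real_field[OF this]
      show "((\<lambda>x. \<i> * of_real (\<epsilon> * x)) has_vector_derivative \<i> * \<epsilon>) (at y)" by simp
      show "norm (\<i> * complex_of_real \<epsilon>) \<le> 1" using \<epsilon>a by (simp add: norm_mult)
    qed auto
    ultimately show "(f has_vector_derivative f' x) (at x)"
      unfolding f_def[abs_def] f'_def by (simp only: One_nat_def) (rule has_vector_derivative_mult)
    define z where "z = \<i> * of_real (\<epsilon> * x)"
    define R where "R = M 1 z - (\<delta> + z * \<sigma>2) * M 0 z"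
    have M1: "M 1 z = (\<delta> + z * \<sigma>2) * M 0 z + R" by (simp add: R_def)
    have "norm R \<le> 48 * (norm z)\<^sup>2 * \<delta> * exp (2 * \<delta> * Re z)"
      unfolding R_def by (rule M_ode) (simp_all add: z_def)
    also have "\<dots> = 48 * x\<^sup>2 * \<delta>" using \<epsilon>a x by (simp add: z_def norm_mult abs_mult)
    also have "\<dots> \<le> 48 * s\<^sup>2 * \<delta>"
      using x \<delta>_nonneg by (intro mult_right_mono mult_left_mono power_mono) auto
    finally have nR: "norm R \<le> 48 * s\<^sup>2 * \<delta>" .
    have "f' x + of_real (\<sigma>2 * x) * f x = iexp (- (\<delta> * (\<epsilon> * x))) * ((\<i> * \<epsilon>) * R)
        + (\<sigma>2 * x) * (1 - complex_of_real \<epsilon> * of_real \<epsilon>) * f x"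
      unfolding f'_def f_def z_def[symmetric] M1 by (simp add: z_def algebra_simps)
    then have "f' x + of_real (\<sigma>2 * x) * f x = iexp (- (\<delta> * (\<epsilon> * x))) * ((\<i> * \<epsilon>) * R)"
      unfolding \<epsilon>2 by simp
    then show "norm (f' x + of_real (\<sigma>2 * x) * f x) \<le> 48 * s\<^sup>2 * \<delta>"
      using nR \<epsilon>a by (simp add: norm_mult)
  qed
  then show ?thesis by (simp add: f_def power2_eq_square power3_eq_cube mult_ac)
qed

lemma char_normalized_F:
  assumes \<sigma>: "0 < \<sigma>2"
  shows "norm (char (distr (std_gaussian d) borel (\<lambda>g. (F g - \<delta>) / sqrt \<sigma>2)) t - char std_normal_distribution t)
    \<le> 48 * (\<bar>t\<bar> / sqrt \<sigma>2) ^ 3 * \<delta>"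
proof -
  define \<epsilon> :: real where "\<epsilon> = (if 0 \<le> t then 1 else - 1)"
  have \<epsilon>: "\<epsilon> = 1 \<or> \<epsilon> = - 1" and t: "\<epsilon> * \<bar>t\<bar> = t" by (auto simp: \<epsilon>_def)
  define s where "s = \<bar>t\<bar> / sqrt \<sigma>2"
  have es: "\<epsilon> * s = t / sqrt \<sigma>2" using t by (simp add: s_def)
  have "char (distr (std_gaussian d) borel (\<lambda>g. (F g - \<delta>) / sqrt \<sigma>2)) t
      = (\<integral>g. iexp (t * ((F g - \<delta>) / sqrt \<sigma>2)) \<partial>std_gaussian d)"
    unfolding char_def by (rule integral_distr) measurable
  also have "\<dots> = (\<integral>g. iexp (- (\<delta> * (\<epsilon> * s))) * exp ((\<i> * of_real (\<epsilon> * s)) * of_real (F g)) \<partial>std_gaussian d)"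
    unfolding es exp_add[symmetric]
    by (intro Bochner_Integration.integral_cong arg_cong[where f = exp]) (simp_all add: field_simps diff_divide_distrib)
  also have "\<dots> = iexp (- (\<delta> * (\<epsilon> * s))) * M 0 (\<i> * of_real (\<epsilon> * s))"
    unfolding integral_mult_right_zero by (simp add: M_def)
  finally have "char (distr (std_gaussian d) borel (\<lambda>g. (F g - \<delta>) / sqrt \<sigma>2)) t
    = iexp (- (\<delta> * (\<epsilon> * s))) * M 0 (\<i> * of_real (\<epsilon> * s))" .
  moreover have "char std_normal_distribution t = of_real (exp (- (\<sigma>2 * s\<^sup>2 / 2)))"
    using \<sigma> by (simp add: char_std_normal_distribution s_def power_divide)
  moreover have "0 \<le> s" using \<sigma> by (simp add: s_def)
  ultimately show ?thesis using char_F_bound[of s \<epsilon>] \<epsilon> by (simp only: s_def[symmetric])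
qed

end

context cone_with_law
begin

lemma char_normalized_V:
  assumes \<tau>: "0 < tau2 V" and t: "0 \<le> t" "t / sqrt (tau2 V) \<le> 1 / 5"
  shows "norm (char (distr (measure_pmf V) borel (\<lambda>j. (real j - stat_dim V) / sqrt (tau2 V))) t - char std_normal_distribution t)
    \<le> 58 * (t / sqrt (tau2 V)) ^ 3 * \<delta> * exp (2 * \<delta> * (t / sqrt (tau2 V))\<^sup>2)"
proof -
  define s where "s = t / sqrt (tau2 V)"
  have "char (distr (measure_pmf V) borel (\<lambda>j. (real j - stat_dim V) / sqrt (tau2 V))) t
      = (\<integral>j. iexp (t * ((real j - stat_dim V) / sqrt (tau2 V))) \<partial>measure_pmf V)"
    unfolding char_def by (rule integral_distr) measurable
  also have "\<dots> = (\<integral>j. iexp (- (\<delta> * s)) * iexp (s * real j) \<partial>measure_pmf V)"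
    unfolding s_def exp_add[symmetric] V_moments(1)
    by (intro Bochner_Integration.integral_cong arg_cong[where f = exp]) (simp_all add: field_simps diff_divide_distrib)
  also have "\<dots> = iexp (- (\<delta> * s)) * \<phi> s"
    unfolding integral_mult_right_zero \<phi>_def ..
  finally have "char (distr (measure_pmf V) borel (\<lambda>j. (real j - stat_dim V) / sqrt (tau2 V))) t = iexp (- (\<delta> * s)) * \<phi> s" .
  moreover have "char std_normal_distribution t = of_real (exp (- (tau2 V * s\<^sup>2 / 2)))"
    using \<tau> by (simp add: char_std_normal_distribution s_def power_divide)
  moreover have "0 \<le> s" using t \<tau> by (simp add: s_def)
  ultimately show ?thesis using char_V_bound[of s] t by (simp only: s_def[symmetric])
qed

lemma normalized_V_second_moment:
  assumes \<tau>: "0 < tau2 V"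
  defines "\<mu> \<equiv> distr (measure_pmf V) borel (\<lambda>j. (real j - stat_dim V) / sqrt (tau2 V))"
  shows "integrable \<mu> (\<lambda>x. x\<^sup>2)" "(\<integral>x. x\<^sup>2 \<partial>\<mu>) = 1"
proof -
  have fin: "finite (set_pmf V)" using set_V by (rule finite_subset) simp
  show "integrable \<mu> (\<lambda>x. x\<^sup>2)"
    unfolding \<mu>_def by (subst integrable_distr_eq) (auto intro!: integrable_measure_pmf_finite fin)
  have "(\<integral>x. x\<^sup>2 \<partial>\<mu>) = (\<integral>j. ((real j - stat_dim V) / sqrt (tau2 V))\<^sup>2 \<partial>measure_pmf V)"
    unfolding \<mu>_def by (rule integral_distr) measurable
  also have "\<dots> = (\<integral>j. (real j - stat_dim V)\<^sup>2 \<partial>measure_pmf V) / tau2 V"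
    using \<tau> by (simp add: power_divide)
  also have "\<dots> = 1" using \<tau> by (simp add: tau2_def stat_dim_def)
  finally show "(\<integral>x. x\<^sup>2 \<partial>\<mu>) = 1" .
qed

end

section \<open>Asymptotic normality\<close>

text \<open>The growth conditions for the cutoff \<open>T = sqrt (\<kappa> ln x / 8)\<close>, where \<open>x\<close> stands for \<open>\<delta>\<close> and \<open>\<tau>\<^sup>2 \<ge> \<kappa> x\<close>.
  The exponential factor of the characteristic function bound at \<open>t = T\<close> is then at most
  \<open>exp (2 T\<^sup>2 / \<kappa>) = exp (ln x / 4)\<close>, which leaves a power of \<open>x\<close> to spare against \<open>1 / sqrt x\<close>.\<close>

lemma log_rate_eventually:
  assumes \<kappa>: "(0::real) < \<kappa>"
  shows "eventually (\<lambda>x. 1 \<le> x \<and> 1 \<le> sqrt (\<kappa> * ln x / 8) \<and> sqrt (\<kappa> * ln x / 8) \<le> sqrt (\<kappa> * x) / 5 \<and>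
    58 * sqrt (\<kappa> * ln x / 8) ^ 3 / (\<kappa> * sqrt \<kappa> * sqrt x) * exp (ln x / 4) \<le> 1 / sqrt (\<kappa> * ln x / 8) ^ 4) at_top"
  using \<kappa> by (intro eventually_conj) real_asymp+

theorem theorem1p1:
  fixes d :: "nat \<Rightarrow> nat"
    and C :: "nat \<Rightarrow> (nat \<Rightarrow> real) set"
    and V :: "nat \<Rightarrow> nat pmf"
  assumes cone: "\<And>n. closed_convex_cone (d n) (C n)"
    and V: "\<And>n. intrinsic_volume_law (d n) (C n) (V n)"
    and stat_dim_at_top: "filterlim (\<lambda>n. stat_dim (V n)) at_top sequentially"
  shows
    "((\<forall>n. 2 * stat_dim (V n) \<le> sigma2 (d n) (C n) \<and>
           sigma2 (d n) (C n) \<le> 4 * stat_dim (V n)) \<and>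
      weak_conv_m
        (\<lambda>n. distr (std_gaussian (d n)) borel
           (\<lambda>g. ((norm_d (d n) (proj (d n) (C n) g))\<^sup>2 - stat_dim (V n))
                 / sqrt (sigma2 (d n) (C n))))
        std_normal_distribution) \<and>
     (liminf (\<lambda>n. ereal (tau2 (V n) / stat_dim (V n))) > 0 \<longrightarrow>
      weak_conv_m
        (\<lambda>n. distr (measure_pmf (V n)) borel
           (\<lambda>j. (real j - stat_dim (V n)) / sqrt (tau2 (V n))))
        std_normal_distribution \<and>
      (\<lambda>n. SUP u::real.
         \<bar>measure_pmf.prob (V n) {j. (real j - stat_dim (V n)) / sqrt (tau2 (V n)) \<le> u}
          - measure std_normal_distribution {..u}\<bar>)
        \<in> O(\<lambda>n. 1 / sqrt (ln (stat_dim (V n)))))"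
proof -
  let ?N = std_normal_distribution
  interpret L: cone_with_law "d n" "C n" "V n" for n
    by (intro cone_with_law.intro convex_cone.intro cone_with_law_axioms.intro cone V)
  define \<delta> where "\<delta> n = stat_dim (V n)" for n
  define \<sigma>2 where "\<sigma>2 n = sigma2 (d n) (C n)" for n
  have \<delta>_eq: "L.\<delta> n = \<delta> n" and \<sigma>2_eq: "L.\<sigma>2 n = \<sigma>2 n" for n
    by (simp_all add: \<delta>_def \<sigma>2_def L.V_moments(1) L.sigma2_eq)
  have F_eq: "L.F n g = (norm_d (d n) (proj (d n) (C n) g))\<^sup>2" for n g
    by (simp add: L.F_def L.P_def)
  have \<tau>_eq: "tau2 (V n) = \<sigma>2 n - 2 * \<delta> n" for n
    using L.V_moments(2)[of n] by (simp add: \<delta>_eq \<sigma>2_eq)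
  have \<tau>0: "0 \<le> tau2 (V n)" for n unfolding tau2_def by (intro integral_nonneg_AE AE_I2) simp
  have bounds: "2 * \<delta> n \<le> \<sigma>2 n" "\<sigma>2 n \<le> 4 * \<delta> n" for n
    using \<tau>0[of n] \<tau>_eq[of n] L.\<sigma>2_le[of n] by (simp_all add: \<delta>_eq \<sigma>2_eq)
  have \<delta>_top: "filterlim \<delta> at_top sequentially" using stat_dim_at_top by (simp add: \<delta>_def[abs_def])
  have \<delta>_ev: "eventually (\<lambda>n. 1 \<le> \<delta> n) sequentially" using \<delta>_top by (simp add: filterlim_at_top)
  define \<mu> where "\<mu> n = distr (std_gaussian (d n)) borel (\<lambda>g. (L.F n g - \<delta> n) / sqrt (\<sigma>2 n))" for n
  have clt_F: "weak_conv_m \<mu> ?N"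
  proof (rule levy_continuity)
    show "real_distribution (\<mu> n)" for n
      unfolding \<mu>_def by (rule gauss.real_distribution_distr) measurable
    show "real_distribution ?N" by (rule real_dist_normal_dist)
    show "(\<lambda>n. char (\<mu> n) t) \<longlonglongrightarrow> char ?N t" for t
    proof (rule LIM_zero_cancel, rule Lim_null_comparison)
      show "eventually (\<lambda>n. norm (char (\<mu> n) t - char ?N t) \<le> 48 * \<bar>t\<bar> ^ 3 / sqrt (\<delta> n)) sequentially"
        using \<delta>_ev
      proof eventually_elim
        fix n assume \<delta>1: "1 \<le> \<delta> n"
        then have \<sigma>: "0 < \<sigma>2 n" using bounds(1)[of n] by linarith
        have "norm (char (\<mu> n) t - char ?N t) \<le> 48 * (\<bar>t\<bar> / sqrt (\<sigma>2 n)) ^ 3 * \<delta> n"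
          using L.char_normalized_F[of n t] \<sigma> by (simp add: \<mu>_def \<delta>_eq \<sigma>2_eq)
        also have "\<dots> \<le> 48 * (\<bar>t\<bar> / sqrt (\<delta> n)) ^ 3 * \<delta> n"
          using bounds(1)[of n] \<delta>1 by (intro mult_right_mono mult_left_mono power_mono frac_le) auto
        also have "\<dots> = 48 * \<bar>t\<bar> ^ 3 / sqrt (\<delta> n)"
        proof -
          have "sqrt (\<delta> n) ^ 3 = sqrt (\<delta> n) * \<delta> n" using \<delta>1 by (simp add: power3_eq_cube)
          then show ?thesis using \<delta>1 by (simp add: power_divide)
        qed
        finally show "norm (char (\<mu> n) t - char ?N t) \<le> 48 * \<bar>t\<bar> ^ 3 / sqrt (\<delta> n)" .
      qed
      have "((\<lambda>x. 48 * \<bar>t\<bar> ^ 3 / sqrt x) \<longlongrightarrow> 0) at_top" by real_asymp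
      then show "(\<lambda>n. 48 * \<bar>t\<bar> ^ 3 / sqrt (\<delta> n)) \<longlonglongrightarrow> 0" by (rule filterlim_compose[OF _ \<delta>_top])
    qed
  qed
  define \<nu> where "\<nu> n = distr (measure_pmf (V n)) borel (\<lambda>j. (real j - \<delta> n) / sqrt (tau2 (V n)))" for n
  have \<nu>: "real_distribution (\<nu> n)" for n
    unfolding \<nu>_def by (rule prob_space.real_distribution_distr[OF prob_space_measure_pmf]) simp
  have part2: "weak_conv_m \<nu> ?N \<and> (\<lambda>n. SUP u. \<bar>cdf (\<nu> n) u - cdf ?N u\<bar>) \<in> O(\<lambda>n. 1 / sqrt (ln (\<delta> n)))"
    if liminf: "liminf (\<lambda>n. ereal (tau2 (V n) / \<delta> n)) > 0"
  proof -
    obtain \<kappa> where \<kappa>: "0 < \<kappa>" "ereal \<kappa> < liminf (\<lambda>n. ereal (tau2 (V n) / \<delta> n))"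
      using ereal_dense2[OF liminf] by auto
    have "eventually (\<lambda>n. ereal \<kappa> < ereal (tau2 (V n) / \<delta> n)) sequentially"
      by (rule le_Liminf_iff[THEN iffD1, OF order_refl, rule_format]) (rule \<kappa>(2))
    then have ev1: "eventually (\<lambda>n. \<kappa> < tau2 (V n) / \<delta> n) sequentially" by simp
    define T where "T n = sqrt (\<kappa> * ln (\<delta> n) / 8)" for n
    note ev2 = eventually_compose_filterlim[OF log_rate_eventually[OF \<kappa>(1)] \<delta>_top, folded T_def]
    obtain B where B: "0 < B" and esseen:
      "\<And>\<mu> T u. real_distribution \<mu> \<Longrightarrow> integrable \<mu> (\<lambda>x. x\<^sup>2) \<Longrightarrow> (\<integral>x. x\<^sup>2 \<partial>\<mu>) \<le> 1 \<Longrightarrow> 1 \<le> T \<Longrightarrow>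
        (\<And>t. 0 \<le> t \<Longrightarrow> t \<le> T \<Longrightarrow> norm (char \<mu> t - char ?N t) \<le> 1 / T ^ 4) \<Longrightarrow>
        \<bar>cdf \<mu> u - cdf ?N u\<bar> \<le> B / T"
      using esseen_smoothing by blast
    have kolmogorov: "eventually (\<lambda>n. 1 \<le> T n \<and> (\<forall>u. \<bar>cdf (\<nu> n) u - cdf ?N u\<bar> \<le> B / T n)) sequentially"
      using ev1 ev2
    proof eventually_elim
      case (elim n)
      let ?\<tau> = "sqrt (tau2 (V n))"
      have \<delta>1: "1 \<le> \<delta> n" and T1: "1 \<le> T n" and T5: "T n \<le> sqrt (\<kappa> * \<delta> n) / 5"
        and rate: "58 * T n ^ 3 / (\<kappa> * sqrt \<kappa> * sqrt (\<delta> n)) * exp (ln (\<delta> n) / 4) \<le> 1 / T n ^ 4"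
        using elim by auto
      have \<tau>\<kappa>: "\<kappa> * \<delta> n \<le> tau2 (V n)" using elim(1) \<delta>1 by (simp add: field_simps)
      have \<kappa>\<delta>: "0 < \<kappa> * \<delta> n" using \<kappa>(1) \<delta>1 by simp
      have \<tau>_pos: "0 < tau2 (V n)" using \<tau>\<kappa> \<kappa>\<delta> by linarith
      have \<tau>_ge: "sqrt (\<kappa> * \<delta> n) \<le> ?\<tau>" using \<tau>\<kappa> by simp
      have T2: "(T n)\<^sup>2 = \<kappa> * ln (\<delta> n) / 8" using \<kappa>(1) \<delta>1 by (simp add: T_def)
      have "\<bar>cdf (\<nu> n) u - cdf ?N u\<bar> \<le> B / T n" for u
      proof (rule esseen[OF \<nu> _ _ T1])
        show "integrable (\<nu> n) (\<lambda>x. x\<^sup>2)" "(\<integral>x. x\<^sup>2 \<partial>\<nu> n) \<le> 1"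
          using L.normalized_V_second_moment[OF \<tau>_pos] by (simp_all add: \<nu>_def \<delta>_def)
        fix t assume t: "0 \<le> t" "t \<le> T n"
        have q0: "0 \<le> t / ?\<tau>" using t \<tau>_pos by simp
        have q1: "t / ?\<tau> \<le> T n / sqrt (\<kappa> * \<delta> n)" using t \<tau>_ge \<kappa>\<delta> by (intro frac_le) auto
        have "T n / sqrt (\<kappa> * \<delta> n) \<le> 1 / 5" using T5 \<kappa>\<delta> by (simp add: field_simps)
        with q1 have q5: "t / ?\<tau> \<le> 1 / 5" by linarith
        have "norm (char (\<nu> n) t - char ?N t) \<le> 58 * (t / ?\<tau>) ^ 3 * \<delta> n * exp (2 * \<delta> n * (t / ?\<tau>)\<^sup>2)"
          using L.char_normalized_V[OF \<tau>_pos t(1) q5] by (simp add: \<nu>_def \<delta>_eq) (simp add: \<delta>_def)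
        also have "\<dots> \<le> 58 * (T n / sqrt (\<kappa> * \<delta> n)) ^ 3 * \<delta> n * exp (2 * \<delta> n * (T n / sqrt (\<kappa> * \<delta> n))\<^sup>2)"
          using q0 q1 \<delta>1 T1 \<kappa>\<delta> by (intro mult_mono) (auto intro!: power_mono mult_left_mono divide_nonneg_pos mult_nonneg_nonneg)
        also have "2 * \<delta> n * (T n / sqrt (\<kappa> * \<delta> n))\<^sup>2 = ln (\<delta> n) / 4"
          using \<kappa>\<delta> \<kappa>(1) \<delta>1 by (simp add: power_divide T2)
        also have "58 * (T n / sqrt (\<kappa> * \<delta> n)) ^ 3 * \<delta> n = 58 * T n ^ 3 / (\<kappa> * sqrt \<kappa> * sqrt (\<delta> n))"
        proof -
          have "sqrt (\<kappa> * \<delta> n) ^ 3 = (\<kappa> * \<delta> n) * (sqrt \<kappa> * sqrt (\<delta> n))"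
            using \<kappa>\<delta> by (simp add: power3_eq_cube real_sqrt_mult[symmetric])
          then show ?thesis using \<delta>1 by (simp add: power_divide mult_ac)
        qed
        finally show "norm (char (\<nu> n) t - char ?N t) \<le> 1 / T n ^ 4" using rate by linarith
      qed
      with T1 show ?case by blast
    qed
    have "((\<lambda>x. B / sqrt (\<kappa> * ln x / 8)) \<longlongrightarrow> 0) at_top" using \<kappa>(1) by real_asymp
    from filterlim_compose[OF this \<delta>_top] have T_lim: "(\<lambda>n. B / T n) \<longlonglongrightarrow> 0" by (simp add: T_def)
    have "weak_conv_m \<nu> ?N"
      unfolding weak_conv_m_def weak_conv_def
    proof (intro allI impI)
      fix x show "(\<lambda>n. cdf (\<nu> n) x) \<longlonglongrightarrow> cdf ?N x"
      proof (rule LIM_zero_cancel, rule Lim_null_comparison[OF _ T_lim])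
        show "eventually (\<lambda>n. norm (cdf (\<nu> n) x - cdf ?N x) \<le> B / T n) sequentially"
          using kolmogorov by eventually_elim simp
      qed
    qed
    moreover have "(\<lambda>n. SUP u. \<bar>cdf (\<nu> n) u - cdf ?N u\<bar>) \<in> O(\<lambda>n. 1 / sqrt (ln (\<delta> n)))"
    proof (rule bigoI[where c = "B * sqrt (8 / \<kappa>)"])
      show "eventually (\<lambda>n. norm (SUP u. \<bar>cdf (\<nu> n) u - cdf ?N u\<bar>) \<le> B * sqrt (8 / \<kappa>) * norm (1 / sqrt (ln (\<delta> n)))) sequentially"
        using kolmogorov \<delta>_ev
      proof eventually_elim
        case (elim n)
        have bdd: "bdd_above (range (\<lambda>u. \<bar>cdf (\<nu> n) u - cdf ?N u\<bar>))"
          using elim by (intro bdd_aboveI[of _ "B / T n"]) auto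
        have "0 \<le> \<bar>cdf (\<nu> n) 0 - cdf ?N 0\<bar>" by simp
        also have "\<dots> \<le> (SUP u. \<bar>cdf (\<nu> n) u - cdf ?N u\<bar>)" by (rule cSUP_upper[OF _ bdd]) simp
        finally have "0 \<le> (SUP u. \<bar>cdf (\<nu> n) u - cdf ?N u\<bar>)" .
        moreover have "(SUP u. \<bar>cdf (\<nu> n) u - cdf ?N u\<bar>) \<le> B / T n"
          using elim by (intro cSUP_least) auto
        moreover have "B / T n = B * sqrt (8 / \<kappa>) * (1 / sqrt (ln (\<delta> n)))"
          by (simp add: T_def real_sqrt_mult real_sqrt_divide)
        ultimately show ?case using elim by simp
      qed
    qed
    ultimately show ?thesis ..
  qed
  have cdf_\<nu>: "cdf (\<nu> n) u = measure_pmf.prob (V n) {j. (real j - stat_dim (V n)) / sqrt (tau2 (V n)) \<le> u}" for n u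
    unfolding \<nu>_def \<delta>_def cdf_def by (subst measure_distr) (auto intro!: arg_cong[where f = "measure _"])
  have cdf_N: "cdf ?N u = measure ?N {..u}" for u by (simp add: cdf_def)
  show ?thesis
    using bounds clt_F part2
    unfolding \<mu>_def[abs_def] \<nu>_def[abs_def, symmetric] cdf_\<nu> cdf_N F_eq \<delta>_def \<sigma>2_def
    by (auto simp: \<nu>_def[abs_def] \<delta>_def)
qed

end
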